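(* Let $\alpha:\mathbb{R}\to[c,d]\subset(1,2)$ and $b:\mathbb{R}\to(0,\infty)$ be continuously differentiable. Let $(\Gamma_i)_{i\ge1}$ be the sequence of arrival times of a Poisson process with unit rate, let $(V_i)_{i\ge1}$ be a sequence of i.i.d. random variables with distribution $\hat m(dx)=\sum_{j=1}^{\infty}2^{-j}\mathbf{1}_{[j-1,j)}(x)\,dx$ on $\mathbb{R}$, and let $(\gamma_i)_{i\ge1}$ be a sequence of i.i.d. random variables with $P(\gamma_i=1)=P(\gamma_i=-1)=1/2$. Assume that the three sequences $(\Gamma_i)_{i\ge1}$, $(V_i)_{i\ge1}$, $(\gamma_i)_{i\ge1}$ are independent, and define $$Y(t)=b(t)\,C_{\alpha(t)}^{1/\alpha(t)}\sum_{i=1}^{\infty}\sum_{j=1}^{\infty}\gamma_i\,\Gamma_i^{-1/\alpha(t)}\,2^{j/\alpha(t)}\,\mathbf{1}_{[0,t]\cap[j-1,j)}(V_i)\qquad(t\in[0,\infty)).$$ Then $Y$ is $1/\alpha(u)$-localisable at every $u\in[0,\infty)$, with local form $Y'_u=b(u)L_{\alpha(u)}$.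
   Context: $C_\alpha=\left(\int_0^\infty x^{-\alpha}\sin(x)\,dx\right)^{-1}$. In the double sum, for each $i$ at most one index $j$ gives a non-zero term; the sum over $j$ is performed first. $L_\alpha$ denotes symmetric $\alpha$-stable Lévy motion, $L_\alpha(t)=\int_0^tM(dz)$, $t\in\mathbb{R}$ (with $\int_0^t=-\int_t^0$ for $t<0$), where $M$ is a symmetric $\alpha$-stable random measure on $\mathbb{R}$ with Lebesgue control measure; i.e. for $f\in L^\alpha(\mathbb{R})$, $\int f\,dM$ is symmetric $\alpha$-stable with characteristic function $\theta\mapsto\exp(-|\theta|^\alpha\int|f(x)|^\alpha dx)$, and $f\mapsto\int f\,dM$ is linear. Localisability: a process $Y$ indexed by an interval $I$ is $h$-localisable at $u\in I$ if there is a non-trivial process $Y'_u$, called the local form of $Y$ at $u$, such that $r^{-h}(Y(u+rt)-Y(u))\to Y'_u(t)$ as $r\to0^+$ in the sense of convergence of finite-dimensional distributions (as processes in $t$), where $t$ ranges over all reals such that $u+rt\in I$ for all small $r>0$ (so $t\in\mathbb{R}$ if $u$ is an interior point of $I$, and $t\ge0$ if $u$ is the left endpoint). Local forms are identified up to equality of finite-dimensional distributions. *)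

theory Defs
  imports "HOL-Probability.Probability"
begin

section \<open>Convergence of finite-dimensional distributions and localisability\<close>

definition fdd :: "'a measure \<Rightarrow> (real \<Rightarrow> 'a \<Rightarrow> real) \<Rightarrow> real set \<Rightarrow> (real \<Rightarrow> real) measure" where
  "fdd M X J = distr M (\<Pi>\<^sub>M t\<in>J. borel) (\<lambda>\<omega>. \<lambda>t\<in>J. X t \<omega>)"

text \<open>Weak convergence of laws on the finite product \<open>\<real>\<^sup>J\<close>, tested on bounded continuous functions
  (\<^const>\<open>weak_conv_m\<close> only covers sequences of laws on the real line).\<close>

definition weak_tendsto_PiM ::
    "real set \<Rightarrow> ('i \<Rightarrow> (real \<Rightarrow> real) measure) \<Rightarrow> (real \<Rightarrow> real) measure \<Rightarrow> 'i filter \<Rightarrow> bool" where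
  "weak_tendsto_PiM J \<mu> \<nu> F \<longleftrightarrow>
    (\<forall>f. continuous_map (product_topology (\<lambda>_. euclideanreal) J) euclideanreal f \<and>
         bounded (f ` (\<Pi>\<^sub>E t\<in>J. UNIV)) \<longrightarrow>
         ((\<lambda>r. \<integral>x. f x \<partial>\<mu> r) \<longlongrightarrow> (\<integral>x. f x \<partial>\<nu>)) F)"

definition fdd_tendsto ::
    "real set \<Rightarrow> 'a measure \<Rightarrow> ('i \<Rightarrow> real \<Rightarrow> 'a \<Rightarrow> real) \<Rightarrow>
     'b measure \<Rightarrow> (real \<Rightarrow> 'b \<Rightarrow> real) \<Rightarrow> 'i filter \<Rightarrow> bool" where
  "fdd_tendsto T M X N Z F \<longleftrightarrow>
    (\<forall>J. finite J \<and> J \<subseteq> T \<longrightarrow> weak_tendsto_PiM J (\<lambda>r. fdd M (X r) J) (fdd N Z J) F)"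

definition local_times :: "real set \<Rightarrow> real \<Rightarrow> real set" where
  "local_times I u = {t. \<forall>\<^sub>F r in at_right 0. u + r * t \<in> I}"

text \<open>The process \<open>Y\<close> is indexed by \<open>I\<close> and lives on \<open>M\<close>; the local form \<open>Z\<close> may live on a different
  probability space \<open>N\<close>. Values of \<open>Y\<close> outside \<open>I\<close> and of \<open>Z\<close> outside \<^term>\<open>local_times I u\<close> are
  irrelevant. Non-trivial means: not almost surely zero at every time.\<close>

definition is_local_form ::
    "'a measure \<Rightarrow> (real \<Rightarrow> 'a \<Rightarrow> real) \<Rightarrow> real set \<Rightarrow> real \<Rightarrow> real \<Rightarrow>
     'b measure \<Rightarrow> (real \<Rightarrow> 'b \<Rightarrow> real) \<Rightarrow> bool" where
  "is_local_form M Y I h u N Z \<longleftrightarrow>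
    prob_space M \<and> (\<forall>t\<in>I. Y t \<in> borel_measurable M) \<and>
    prob_space N \<and> (\<forall>t\<in>local_times I u. Z t \<in> borel_measurable N) \<and>
    (\<exists>t\<in>local_times I u. \<not> (AE \<omega> in N. Z t \<omega> = 0)) \<and>
    fdd_tendsto (local_times I u)
      M (\<lambda>r t \<omega>. r powr (- h) * (Y (u + r * t) \<omega> - Y u \<omega>)) N Z (at_right 0)"

text \<open>By Kolmogorov's extension theorem every process indexed by reals has a version, with the same
  finite-dimensional distributions, on the path space; so letting \<open>N\<close> range over measures on
  \<^typ>\<open>real \<Rightarrow> real\<close> loses no generality.\<close>

definition localisable ::
    "'a measure \<Rightarrow> (real \<Rightarrow> 'a \<Rightarrow> real) \<Rightarrow> real set \<Rightarrow> real \<Rightarrow> real \<Rightarrow> bool" where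
  "localisable M Y I h u \<longleftrightarrow>
    (\<exists>(N :: (real \<Rightarrow> real) measure) Z. is_local_form M Y I h u N Z)"


section \<open>Symmetric stable random measures and Levy motion\<close>

definition Lp_real :: "real \<Rightarrow> (real \<Rightarrow> real) set" where
  "Lp_real a = {f \<in> borel_measurable lborel. integrable lborel (\<lambda>x. \<bar>f x\<bar> powr a)}"

text \<open>\<open>J f\<close> is the integral of \<open>f\<close> with respect to a symmetric \<open>a\<close>-stable random measure on \<open>\<real>\<close> with
  Lebesgue control measure, defined on the probability space \<open>N\<close>.\<close>

definition sas_integral :: "'b measure \<Rightarrow> real \<Rightarrow> ((real \<Rightarrow> real) \<Rightarrow> 'b \<Rightarrow> real) \<Rightarrow> bool" where
  "sas_integral N a J \<longleftrightarrow>
    prob_space N \<and>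
    (\<forall>f\<in>Lp_real a. J f \<in> borel_measurable N \<and>
       (\<forall>\<theta>. char (distr N borel (J f)) \<theta> =
             of_real (exp (- (\<bar>\<theta>\<bar> powr a) * (\<integral>x. \<bar>f x\<bar> powr a \<partial>lborel))))) \<and>
    (\<forall>f\<in>Lp_real a. \<forall>g\<in>Lp_real a. \<forall>p q.
       AE \<omega> in N. J (\<lambda>x. p * f x + q * g x) \<omega> = p * J f \<omega> + q * J g \<omega>)"

definition levy_motion :: "((real \<Rightarrow> real) \<Rightarrow> 'b \<Rightarrow> real) \<Rightarrow> real \<Rightarrow> 'b \<Rightarrow> real" where
  "levy_motion J t \<omega> = (if 0 \<le> t then J (indicator {0..t}) \<omega> else - J (indicator {t..0}) \<omega>)"


section \<open>The series representation\<close>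

definition stable_const :: "real \<Rightarrow> real" where
  "stable_const a = inverse (LBINT x:{0<..}. x powr (- a) * sin x)"

text \<open>All sequences start at index 0: \<open>\<Gamma> i\<close>, \<open>V i\<close>, \<open>\<gamma> i\<close> are the \<open>(i+1)\<close>-st terms, and
  \<open>[j, j+1)\<close>, \<open>j \<ge> 0\<close>, is the block of weight \<open>2 powr -(j+1)\<close>.\<close>

text \<open>Arrival times of a unit-rate Poisson process: the first arrival and the subsequent waiting
  times are i.i.d. standard exponential.\<close>

definition (in prob_space) poisson_arrival_times :: "(nat \<Rightarrow> 'a \<Rightarrow> real) \<Rightarrow> bool" where
  "poisson_arrival_times \<Gamma> \<longleftrightarrow>
    (let W = (\<lambda>i \<omega>. case i of 0 \<Rightarrow> \<Gamma> 0 \<omega> | Suc k \<Rightarrow> \<Gamma> (Suc k) \<omega> - \<Gamma> k \<omega>) in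
      indep_vars (\<lambda>_. borel) W UNIV \<and>
      (\<forall>i. distributed M lborel (W i) (exponential_density 1)))"

definition dyadic_block_density :: "real \<Rightarrow> ennreal" where
  "dyadic_block_density x = (\<Sum>j. ennreal ((1/2) ^ Suc j) * indicator {real j..<real (Suc j)} x)"

definition (in prob_space) iid_dyadic_blocks :: "(nat \<Rightarrow> 'a \<Rightarrow> real) \<Rightarrow> bool" where
  "iid_dyadic_blocks V \<longleftrightarrow>
    indep_vars (\<lambda>_. borel) V UNIV \<and> (\<forall>i. distributed M lborel (V i) dyadic_block_density)"

definition (in prob_space) iid_signs :: "(nat \<Rightarrow> 'a \<Rightarrow> real) \<Rightarrow> bool" where
  "iid_signs \<gamma> \<longleftrightarrow>
    indep_vars (\<lambda>_. borel) \<gamma> UNIV \<and>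
    (\<forall>i. \<P>(\<omega> in M. \<gamma> i \<omega> = 1) = 1/2 \<and> \<P>(\<omega> in M. \<gamma> i \<omega> = -1) = 1/2)"

definition (in prob_space) indep_sequences3 ::
    "(nat \<Rightarrow> 'a \<Rightarrow> real) \<Rightarrow> (nat \<Rightarrow> 'a \<Rightarrow> real) \<Rightarrow> (nat \<Rightarrow> 'a \<Rightarrow> real) \<Rightarrow> bool" where
  "indep_sequences3 X Y Z \<longleftrightarrow>
    indep_vars (\<lambda>_. \<Pi>\<^sub>M i\<in>UNIV. borel) (\<lambda>k \<omega> i. ([X, Y, Z] ! k) i \<omega>) {..<3}"

definition multistable_levy ::
    "(real \<Rightarrow> real) \<Rightarrow> (real \<Rightarrow> real) \<Rightarrow> (nat \<Rightarrow> 'a \<Rightarrow> real) \<Rightarrow> (nat \<Rightarrow> 'a \<Rightarrow> real) \<Rightarrow>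
     (nat \<Rightarrow> 'a \<Rightarrow> real) \<Rightarrow> real \<Rightarrow> 'a \<Rightarrow> real" where
  "multistable_levy \<alpha> b \<Gamma> V \<gamma> t \<omega> =
    b t * stable_const (\<alpha> t) powr (1 / \<alpha> t) *
    (\<Sum>i. \<Sum>j. \<gamma> i \<omega> * \<Gamma> i \<omega> powr (- 1 / \<alpha> t) * 2 powr (real (Suc j) / \<alpha> t) *
              indicator ({0..t} \<inter> {real j..<real (Suc j)}) (V i \<omega>))"

end

theory Submission
  imports Defs
begin

text \<open>Write \<open>B v = b v * C powr (1 / \<alpha> v)\<close>, with \<open>C\<close> the stable constant of index \<open>\<alpha> v\<close>, and let \<open>X t v\<close> be the series that
defines \<open>Y t\<close>, but with \<open>\<alpha>\<close> and \<open>B\<close> evaluated at \<open>v\<close>; so \<open>Y t = X t t\<close>. The increment splits as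
\<open>Y (u + r t) - Y u = (X (u + r t) u - X u u) + (X (u + r t) (u + r t) - X (u + r t) u)\<close>.

The first bracket is a functional of a stable process with the fixed index \<open>\<alpha> u\<close>. Its rescaled
finite-dimensional laws do not depend on \<open>r\<close> and agree with those of \<open>b u\<close> times the Levy motion
(\<open>expectation_cos_main\<close>). This rests on the law of a series \<open>\<Sum>i. \<gamma>\<^sub>i \<Gamma>\<^sub>i powr (- 1/a) * k V\<^sub>i\<close>
(\<open>expectation_cos_stable_series\<close>). Averaging over signs and marks turns its cosine transform into
\<open>E (\<Prod>i. \<psi> \<Gamma>\<^sub>i)\<close>, and such a product over a Poisson process has expectation \<open>exp (- \<integral>(1 - \<psi>))\<close>. To see
the latter, let \<open>G s = exp (- \<integral>\<^bsub>x > s\<^esub>(1 - \<psi>))\<close>: the renewal identity \<open>G s = E (\<psi> (s + W) * G (s + W))\<close> for an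
exponential \<open>W\<close> (\<open>pgf_renewal\<close>) says that \<open>(\<Prod>i<n. \<psi> \<Gamma>\<^sub>i) * G \<Gamma>\<^sub>n\<^sub>-\<^sub>1\<close> has constant expectation, and
\<open>G \<Gamma>\<^sub>n\<^sub>-\<^sub>1\<close> tends to 1.

The second bracket is negligible. The map \<open>v \<mapsto> B v * z powr (1 / \<alpha> v)\<close> is Lipschitz at \<open>u\<close>, with a
constant of order \<open>z powr p + z powr q\<close> for some \<open>p, q > 1/2\<close> (\<open>scaled_powr_calm\<close>). So, given the \<open>\<Gamma>\<^sub>i\<close> and \<open>V\<^sub>i\<close>, the
second bracket is a random-sign series whose squared coefficients sum to at most \<open>r\<^sup>2 * Q\<close>, with a finite random
variable \<open>Q\<close> that does not depend on \<open>r\<close>. A Kolmogorov maximal inequality for random signs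
(\<open>maximal_inequality\<close>) makes it of order \<open>r\<close> in probability; after division by \<open>r powr (1 / \<alpha> u)\<close> it
still tends to 0, because \<open>\<alpha> u > 1\<close> (\<open>remainder_small\<close>). The same inequality shows that all the series
involved converge almost surely.

Convergence of the expectations of \<open>cos ((\<Sum>t\<in>J. w t * x t) + \<phi>)\<close> for all \<open>w\<close> and \<open>\<phi>\<close> implies weak
convergence on the finite product (\<open>weak_tendsto_PiM_sequentially\<close>). Finally, a limit process on some
probability space is needed even if no stable random measure is given: it is built from the same
\<open>\<Gamma>\<close>, \<open>V\<close>, \<open>\<gamma>\<close>, after the half line is rearranged into the whole line (\<open>limit_process_law\<close>).\<close>

section \<open>The Cramer-Wold device\<close>

text \<open>Real trigonometric polynomials in the coordinates from \<open>J\<close>. They are closed under products, so they serve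
as an algebra of test functions whose expectations are determined by characteristic functions of
linear combinations.\<close>
inductive trig_poly :: "'i set \<Rightarrow> (('i \<Rightarrow> real) \<Rightarrow> real) \<Rightarrow> bool" for J where
  cosine: "trig_poly J (\<lambda>x. cos ((\<Sum>t\<in>J. w t * x t) + p))"
| add: "trig_poly J f \<Longrightarrow> trig_poly J g \<Longrightarrow> trig_poly J (\<lambda>x. f x + g x)"
| scale: "trig_poly J f \<Longrightarrow> trig_poly J (\<lambda>x. a * f x)"

lemma trig_poly_const: "trig_poly J (\<lambda>x. a)"
  using trig_poly.scale[OF trig_poly.cosine[of J "\<lambda>_. 0" 0], of a] by simp

lemma trig_poly_sin:
  assumes "finite J" "t \<in> J"
  shows "trig_poly J (\<lambda>x. sin (a * x t))"
proof -
  have *: "(\<Sum>s\<in>J. (if s = t then a else 0) * x s) = a * x t" for x :: "'a \<Rightarrow> real"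
    using assms by (simp add: if_distrib[of "\<lambda>y. y * _"] sum.delta cong: if_cong)
  show ?thesis
    using trig_poly.cosine[of J "\<lambda>s. if s = t then a else 0" "- (pi / 2)"]
    unfolding * by (simp add: cos_diff)
qed

lemma trig_poly_mult:
  assumes "trig_poly J f" "trig_poly J g"
  shows "trig_poly J (\<lambda>x. f x * g x)"
  using assms
proof (induction arbitrary: g)
  case (cosine w p)
  from cosine show ?case
  proof (induction)
    case (cosine v q)
    have "cos ((\<Sum>t\<in>J. w t * x t) + p) * cos ((\<Sum>t\<in>J. v t * x t) + q) =
      (1/2) * cos ((\<Sum>t\<in>J. (w t - v t) * x t) + (p - q)) + (1/2) * cos ((\<Sum>t\<in>J. (w t + v t) * x t) + (p + q))"
      for x :: "'a \<Rightarrow> real"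
    proof -
      have "(\<Sum>t\<in>J. (w t - v t) * x t) + (p - q) = ((\<Sum>t\<in>J. w t * x t) + p) - ((\<Sum>t\<in>J. v t * x t) + q)"
        by (simp add: left_diff_distrib sum_subtractf)
      moreover have "(\<Sum>t\<in>J. (w t + v t) * x t) + (p + q) = ((\<Sum>t\<in>J. w t * x t) + p) + ((\<Sum>t\<in>J. v t * x t) + q)"
        by (simp add: distrib_right sum.distrib)
      ultimately show ?thesis
        by (simp only: cos_add[of "_ + _" "_ + _"] cos_diff[of "_ + _" "_ + _"]) (simp add: field_simps)
    qed
    then show ?case
      by (simp only: trig_poly.add trig_poly.scale trig_poly.cosine)
  next
    case (add f g)
    from trig_poly.add[OF add.IH] show ?case by (simp add: distrib_left)
  next
    case (scale f a)
    from trig_poly.scale[OF scale.IH, of a] show ?case by (simp add: mult_ac)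
  qed
next
  case (add f1 f2)
  from trig_poly.add[OF add.IH(1)[OF add.prems] add.IH(2)[OF add.prems]]
  show ?case by (simp add: distrib_right)
next
  case (scale f a)
  from trig_poly.scale[OF scale.IH[OF scale.prems], of a] show ?case by (simp add: mult_ac)
qed

lemma trig_poly_measurable:
  assumes "trig_poly J g" shows "g \<in> borel_measurable (PiM J (\<lambda>_. borel))"
  using assms
proof induction
  case (cosine w p)
  have "(\<lambda>x. x t) \<in> borel_measurable (PiM J (\<lambda>_. borel))" if "t \<in> J" for t
    using that by (rule measurable_component_singleton)
  then show ?case by measurable
qed simp_all

lemma trig_poly_bounded:
  assumes "trig_poly J g" shows "\<exists>B. \<forall>x. \<bar>g x\<bar> \<le> B"
  using assms
proof induction
  case (cosine w p) show ?case by (intro exI[of _ 1]) auto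
next
  case (add f g)
  then obtain B C where "\<forall>x. \<bar>f x\<bar> \<le> B" "\<forall>x. \<bar>g x\<bar> \<le> C" by auto
  then have "\<forall>x. \<bar>f x + g x\<bar> \<le> B + C" by (meson abs_triangle_ineq add_mono order_trans)
  then show ?case by blast
next
  case (scale f a)
  then obtain B where "\<forall>x. \<bar>f x\<bar> \<le> B" by auto
  then have "\<forall>x. \<bar>a * f x\<bar> \<le> \<bar>a\<bar> * B" by (simp add: abs_mult mult_left_mono)
  then show ?case by blast
qed

text \<open>Polynomials on the Hilbert cube. Coordinates are indexed by \<^typ>\<open>nat\<close> rather than by \<open>J\<close>, since functions
on a countable index type form a metric space, to which the Stone-Weierstrass theorem applies directly.\<close>
inductive coord_poly :: "((nat \<Rightarrow> real) \<Rightarrow> real) \<Rightarrow> bool" where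
  const: "coord_poly (\<lambda>s. a)"
| coord: "coord_poly (\<lambda>s. s n)"
| add: "coord_poly f \<Longrightarrow> coord_poly g \<Longrightarrow> coord_poly (\<lambda>s. f s + g s)"
| mult: "coord_poly f \<Longrightarrow> coord_poly g \<Longrightarrow> coord_poly (\<lambda>s. f s * g s)"

lemma coord_poly_continuous: "coord_poly f \<Longrightarrow> continuous_on S f"
proof (induction rule: coord_poly.induct)
  case (coord n)
  show ?case by (rule continuous_on_subset[OF continuous_on_product_coordinates]) auto
qed (simp_all add: continuous_on_add continuous_on_mult)

lemma coord_poly_dense:
  assumes "continuous_on (PiE UNIV (\<lambda>_. {-1..1})) F" "0 < e"
  shows "\<exists>g. coord_poly g \<and> (\<forall>s\<in>PiE UNIV (\<lambda>_. {-1..1}). \<bar>F s - g s\<bar> < e)"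
proof -
  interpret function_ring_on "Collect coord_poly" "PiE UNIV (\<lambda>_::nat. {-1..1::real})"
  proof
    show "compact (PiE UNIV (\<lambda>_::nat. {-1..1::real}))"
      unfolding compactin_euclidean_iff[symmetric] euclidean_product_topology[symmetric] compactin_PiE
      by simp
    fix x y :: "nat \<Rightarrow> real"
    assume "x \<noteq> y"
    then obtain n where "x n \<noteq> y n" by auto
    then show "\<exists>f\<in>Collect coord_poly. f x \<noteq> f y"
      by (intro bexI[of _ "\<lambda>s. s n"]) (auto intro: coord_poly.intros)
  qed (auto intro: coord_poly.intros coord_poly_continuous)
  from Stone_Weierstrass_basic[OF assms] show ?thesis by auto
qed

text \<open>The triangle wave of period \<open>4 * R\<close>: the identity on \<open>[-R, R]\<close>, folded back and forth outside.\<close>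
definition fold_line :: "real \<Rightarrow> real \<Rightarrow> real" where
  "fold_line R x = (2 * R / pi) * arcsin (sin (pi / (2 * R) * x))"

lemma fold_line_eq:
  assumes "0 < R" "\<bar>x\<bar> \<le> R" shows "fold_line R x = x"
proof -
  have "\<bar>pi / (2 * R) * x\<bar> = pi / (2 * R) * \<bar>x\<bar>"
    using assms by (simp add: abs_mult)
  also have "\<dots> \<le> pi / (2 * R) * R"
    using assms by (intro mult_left_mono) auto
  also have "\<dots> = pi / 2" using assms by simp
  finally have "- (pi / 2) \<le> pi / (2 * R) * x" "pi / (2 * R) * x \<le> pi / 2" by linarith+
  then have "arcsin (sin (pi / (2 * R) * x)) = pi / (2 * R) * x"
    by (intro arcsin_sin)
  then show ?thesis using assms by (simp add: fold_line_def)
qed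

text \<open>Folding makes \<open>f\<close> a continuous function of \<open>sin (pi / (2 * R) * x t)\<close>, \<open>t \<in> J\<close>, and polynomials in these sines
are trigonometric polynomials. The approximation is uniform on the whole space, which is why one may
integrate it against measures that are not concentrated on the cube.\<close>
lemma trig_poly_approx:
  fixes f :: "('i \<Rightarrow> real) \<Rightarrow> real"
  assumes J: "finite J" and f: "continuous_map (product_topology (\<lambda>_. euclideanreal) J) euclideanreal f"
    and R: "0 < R" and e: "0 < e"
  shows "\<exists>g. trig_poly J g \<and> (\<forall>x. \<bar>f (\<lambda>t\<in>J. fold_line R (x t)) - g x\<bar> < e)"
proof -
  let ?S = "PiE UNIV (\<lambda>_::nat. {-1..1::real})"
  let ?c = "pi / (2 * R)"
  let ?u = "\<lambda>s::nat \<Rightarrow> real. \<lambda>t\<in>J. (2 * R / pi) * arcsin (s (to_nat_on J t))"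
  have "continuous_on ?S (\<lambda>s. f (?u s))"
  proof -
    have "continuous_map (top_of_set ?S) (product_topology (\<lambda>_. euclideanreal) J) ?u"
      unfolding continuous_map_componentwise
    proof (intro conjI ballI)
      fix t assume "t \<in> J"
      have "continuous_on ?S (\<lambda>s. (2 * R / pi) * arcsin (s (to_nat_on J t)))"
        by (intro continuous_intros continuous_on_subset[OF continuous_on_product_coordinates])
           (auto simp: PiE_def Pi_def)
      then show "continuous_map (top_of_set ?S) euclideanreal (\<lambda>s. (?u s) t)"
        using \<open>t \<in> J\<close> by simp
    qed auto
    from continuous_map_compose[OF this f] show ?thesis by (simp add: o_def)
  qed
  from coord_poly_dense[OF this e] obtain g where
    g: "coord_poly g" "\<And>s. s \<in> ?S \<Longrightarrow> \<bar>f (?u s) - g s\<bar> < e" by auto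
  define s where "s x = (\<lambda>n. if n \<in> to_nat_on J ` J then sin (?c * x (from_nat_into J n)) else 0)"
    for x :: "'i \<Rightarrow> real"
  have tp: "trig_poly J (\<lambda>x. g (s x))"
    using g(1)
  proof induction
    case (const a) show ?case by (rule trig_poly_const)
  next
    case (coord n)
    show ?case
    proof (cases "n \<in> to_nat_on J ` J")
      case True
      then have "J \<noteq> {}" by auto
      then have "from_nat_into J n \<in> J" by (rule from_nat_into)
      from trig_poly_sin[OF J this, of ?c] True show ?thesis by (simp add: s_def)
    qed (simp add: s_def trig_poly_const)
  qed (auto intro: trig_poly.add trig_poly_mult)
  have "\<bar>f (\<lambda>t\<in>J. fold_line R (x t)) - g (s x)\<bar> < e" for x
  proof -
    have "s x \<in> ?S" by (auto simp: s_def)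
    moreover have "?u (s x) = (\<lambda>t\<in>J. fold_line R (x t))"
      using J by (auto simp: s_def fold_line_def fun_eq_iff restrict_def countable_finite)
    ultimately show ?thesis using g(2)[of "s x"] by simp
  qed
  with tp show ?thesis by blast
qed

text \<open>A continuous function is the pointwise limit of the trigonometric polynomials that approximate it on growing
cubes.\<close>
lemma continuous_map_PiM_measurable:
  fixes f :: "('i \<Rightarrow> real) \<Rightarrow> real"
  assumes J: "finite J" and f: "continuous_map (product_topology (\<lambda>_. euclideanreal) J) euclideanreal f"
  shows "f \<in> borel_measurable (PiM J (\<lambda>_. borel))"
proof -
  have "\<exists>g. trig_poly J g \<and> (\<forall>x. \<bar>f (\<lambda>t\<in>J. fold_line (real (Suc n)) (x t)) - g x\<bar> < 1 / Suc n)" for n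
    using trig_poly_approx[OF J f, of "real (Suc n)" "1 / Suc n"] by simp
  then have "\<forall>n. \<exists>g. trig_poly J g \<and> (\<forall>x. \<bar>f (\<lambda>t\<in>J. fold_line (real (Suc n)) (x t)) - g x\<bar> < 1 / Suc n)"
    by blast
  from choice[OF this] obtain g where g: "\<And>n. trig_poly J (g n)"
    "\<And>n x. \<bar>f (\<lambda>t\<in>J. fold_line (real (Suc n)) (x t)) - g n x\<bar> < 1 / Suc n" by blast
  show ?thesis
  proof (rule borel_measurable_LIMSEQ_real)
    show "g n \<in> borel_measurable (PiM J (\<lambda>_. borel))" for n
      by (rule trig_poly_measurable[OF g(1)])
    fix x :: "'i \<Rightarrow> real" assume "x \<in> space (PiM J (\<lambda>_. borel))"
    then have x: "x \<in> extensional J" by (auto simp: space_PiM PiE_def)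
    obtain m :: nat where m: "(\<Sum>t\<in>J. \<bar>x t\<bar>) \<le> real m" using real_arch_simple by blast
    have "\<forall>\<^sub>F n in sequentially. norm (g n x - f x) \<le> 1 / real (Suc n)"
    proof (rule eventually_sequentiallyI)
      fix n assume "m \<le> n"
      have "\<bar>x t\<bar> \<le> Suc n" if "t \<in> J" for t
      proof -
        have "\<bar>x t\<bar> \<le> (\<Sum>t\<in>J. \<bar>x t\<bar>)" using that J by (intro member_le_sum) auto
        then show ?thesis using m \<open>m \<le> n\<close> by linarith
      qed
      then have "(\<lambda>t\<in>J. fold_line (real (Suc n)) (x t)) = x"
        using x by (auto simp: fun_eq_iff restrict_def extensional_def fold_line_eq)
      with g(2)[of n x] show "norm (g n x - f x) \<le> 1 / real (Suc n)" by simp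
    qed
    moreover have "(\<lambda>n. 1 / real (Suc n)) \<longlonglongrightarrow> 0"
      by (rule LIMSEQ_Suc[OF lim_1_over_n])
    ultimately have "(\<lambda>n. g n x - f x) \<longlonglongrightarrow> 0"
      by (rule Lim_null_comparison)
    then show "(\<lambda>n. g n x) \<longlonglongrightarrow> f x" by (rule LIM_zero_cancel)
  qed
qed

text \<open>The imaginary part is a cosine with a shifted phase; so real cosines with arbitrary phase carry the
same information as the characteristic function.\<close>
lemma (in prob_space) char_distr_eq_cos:
  assumes [measurable]: "X \<in> borel_measurable M"
  shows "char (distr M borel X) \<theta> =
    Complex (\<integral>\<omega>. cos (\<theta> * X \<omega>) \<partial>M) (\<integral>\<omega>. cos (\<theta> * X \<omega> - pi / 2) \<partial>M)"
proof -
  have i: "integrable M (\<lambda>\<omega>. iexp (\<theta> * X \<omega>))"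
    by (rule integrable_const_bound[where B=1]) auto
  have "char (distr M borel X) \<theta> = (\<integral>\<omega>. iexp (\<theta> * X \<omega>) \<partial>M)"
    unfolding char_def by (simp add: integral_distr)
  moreover have "Re (\<integral>\<omega>. iexp (\<theta> * X \<omega>) \<partial>M) = (\<integral>\<omega>. cos (\<theta> * X \<omega>) \<partial>M)"
    using i by (subst integral_Re[symmetric]) (auto simp: Re_exp)
  moreover have "Im (\<integral>\<omega>. iexp (\<theta> * X \<omega>) \<partial>M) = (\<integral>\<omega>. cos (\<theta> * X \<omega> - pi / 2) \<partial>M)"
    using i by (subst integral_Im[symmetric]) (auto simp: Im_exp cos_diff)
  ultimately show ?thesis by (simp add: complex_eq_iff)
qed

lemma (in prob_space) prob_abs_gt_le_ramp:
  assumes X[measurable]: "X \<in> borel_measurable M" and L: "k + 1 \<le> (L::real)"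
  shows "prob {\<omega>\<in>space M. L < \<bar>X \<omega>\<bar>} \<le> (\<integral>\<omega>. min 1 (max 0 (\<bar>X \<omega>\<bar> - k)) \<partial>M)"
proof -
  have "prob {\<omega>\<in>space M. L < \<bar>X \<omega>\<bar>} = (\<integral>\<omega>. indicator {\<omega>\<in>space M. L < \<bar>X \<omega>\<bar>} \<omega> \<partial>M)"
    by simp
  also have "\<dots> \<le> (\<integral>\<omega>. min 1 (max 0 (\<bar>X \<omega>\<bar> - k)) \<partial>M)"
  proof (rule integral_mono)
    show "integrable M (\<lambda>\<omega>. min 1 (max 0 (\<bar>X \<omega>\<bar> - k)))"
      by (rule integrable_const_bound[where B=1]) auto
    show "integrable M (\<lambda>\<omega>. indicator {\<omega>\<in>space M. L < \<bar>X \<omega>\<bar>} \<omega>::real)"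
      by (rule integrable_const_bound[where B=1]) auto
    fix \<omega> assume "\<omega> \<in> space M"
    show "indicator {\<omega>\<in>space M. L < \<bar>X \<omega>\<bar>} \<omega> \<le> min 1 (max 0 (\<bar>X \<omega>\<bar> - k))"
      using L by (simp split: split_indicator)
  qed
  finally show ?thesis .
qed

text \<open>Levy's continuity theorem on the line gives weak convergence of \<open>X n\<close>; testing it on a ramp from 0 to 1 bounds
the tails of all late \<open>X n\<close> by a tail of \<open>Z\<close>.\<close>
lemma tight_of_cos_convergence:
  fixes X :: "nat \<Rightarrow> 'a \<Rightarrow> real" and Z :: "'b \<Rightarrow> real"
  assumes M: "prob_space M" and N: "prob_space N"
    and X[measurable]: "\<And>n. X n \<in> borel_measurable M" and Z[measurable]: "Z \<in> borel_measurable N"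
    and lim: "\<And>a p. (\<lambda>n. \<integral>\<omega>. cos (a * X n \<omega> + p) \<partial>M) \<longlonglongrightarrow> (\<integral>\<omega>. cos (a * Z \<omega> + p) \<partial>N)"
    and e: "0 < e"
  shows "\<exists>K. (\<forall>L\<ge>K. (\<forall>\<^sub>F n in sequentially. measure M {\<omega>\<in>space M. L < \<bar>X n \<omega>\<bar>} < e) \<and>
    measure N {\<omega>\<in>space N. L < \<bar>Z \<omega>\<bar>} < e)"
proof -
  interpret M: prob_space M by fact
  interpret N: prob_space N by fact
  define h where "h k x = min 1 (max 0 (\<bar>x\<bar> - real k))" for k x
  have h_bound: "norm (h k x) \<le> 1" for k x by (simp add: h_def)
  have h_cont: "isCont (h k) x" for k x
  proof -
    have "continuous_on UNIV (h k)" unfolding h_def by (intro continuous_intros)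
    then show ?thesis by (simp add: continuous_on_eq_continuous_at)
  qed
  have h_meas[measurable]: "h k \<in> borel_measurable borel" for k unfolding h_def by measurable
  have "(\<lambda>k. \<integral>\<omega>. h k (Z \<omega>) \<partial>N) \<longlonglongrightarrow> (\<integral>\<omega>. 0 \<partial>N)"
  proof (rule integral_dominated_convergence[where w="\<lambda>_. 1"])
    show "AE \<omega> in N. (\<lambda>k. h k (Z \<omega>)) \<longlonglongrightarrow> 0"
    proof (rule AE_I2)
      fix \<omega>
      obtain m :: nat where m: "\<bar>Z \<omega>\<bar> \<le> m" using real_arch_simple by blast
      have "\<forall>\<^sub>F k in sequentially. h k (Z \<omega>) = 0"
        by (rule eventually_sequentiallyI[of m]) (use m in \<open>simp add: h_def\<close>)
      then show "(\<lambda>k. h k (Z \<omega>)) \<longlonglongrightarrow> 0" by (rule tendsto_eventually)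
    qed
  qed (use h_bound in simp_all)
  then have "(\<lambda>k. \<integral>\<omega>. h k (Z \<omega>) \<partial>N) \<longlonglongrightarrow> 0" by simp
  from order_tendstoD(2)[OF this e] obtain k where k: "(\<integral>\<omega>. h k (Z \<omega>) \<partial>N) < e"
    using eventually_happens'[OF sequentially_bot] by blast
  have "weak_conv_m (\<lambda>n. distr M borel (X n)) (distr N borel Z)"
  proof (rule levy_continuity)
    fix t
    show "(\<lambda>n. char (distr M borel (X n)) t) \<longlonglongrightarrow> char (distr N borel Z) t"
      unfolding M.char_distr_eq_cos[OF X] N.char_distr_eq_cos[OF Z]
      using lim[of t 0] lim[of t "- (pi / 2)"] by (intro tendsto_Complex) simp_all
  qed (intro M.real_distribution_distr N.real_distribution_distr X Z)+
  then have "(\<lambda>n. \<integral>x. h k x \<partial>distr M borel (X n)) \<longlonglongrightarrow> (\<integral>x. h k x \<partial>distr N borel Z)"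
    by (intro weak_conv_imp_integral_bdd_continuous_conv[where B=1]
        M.real_distribution_distr N.real_distribution_distr X Z h_cont h_bound)
  then have "(\<lambda>n. \<integral>\<omega>. h k (X n \<omega>) \<partial>M) \<longlonglongrightarrow> (\<integral>\<omega>. h k (Z \<omega>) \<partial>N)"
    by (simp add: integral_distr)
  from order_tendstoD(2)[OF this k]
  have ev: "\<forall>\<^sub>F n in sequentially. (\<integral>\<omega>. h k (X n \<omega>) \<partial>M) < e" .
  show ?thesis
  proof (intro exI[of _ "real k + 1"] allI impI conjI)
    fix L assume L: "real k + 1 \<le> L"
    show "measure N {\<omega>\<in>space N. L < \<bar>Z \<omega>\<bar>} < e"
      using N.prob_abs_gt_le_ramp[OF Z L] k unfolding h_def by (rule le_less_trans)
    from ev show "\<forall>\<^sub>F n in sequentially. measure M {\<omega>\<in>space M. L < \<bar>X n \<omega>\<bar>} < e"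
    proof eventually_elim
      case (elim n)
      from M.prob_abs_gt_le_ramp[OF X L, of n] elim show ?case unfolding h_def by (rule le_less_trans)
    qed
  qed
qed

text \<open>Outside the cube of side \<open>2 * R\<close> the difference of \<open>f\<close> and its approximation is only bounded, so it is paid for
with the probability that some coordinate leaves the cube.\<close>
lemma (in prob_space) expectation_diff_le_tail:
  fixes f g :: "('i \<Rightarrow> real) \<Rightarrow> real"
  assumes J: "finite J" and y[measurable]: "y \<in> measurable M (PiM J (\<lambda>_. borel))"
    and fm[measurable]: "f \<in> borel_measurable (PiM J (\<lambda>_. borel))"
    and gm[measurable]: "g \<in> borel_measurable (PiM J (\<lambda>_. borel))"
    and B: "\<And>x. x \<in> (\<Pi>\<^sub>E t\<in>J. UNIV) \<Longrightarrow> \<bar>f x\<bar> \<le> B" and C: "\<And>x. \<bar>g x\<bar> \<le> C"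
    and approx: "\<And>x. x \<in> (\<Pi>\<^sub>E t\<in>J. UNIV) \<Longrightarrow>
      \<bar>f x - g x\<bar> \<le> \<epsilon> + (\<Sum>t\<in>J. 2 * B * indicator {x. R < \<bar>x\<bar>} (x t))"
    and B0: "0 \<le> B"
    and small: "\<And>t. t \<in> J \<Longrightarrow> prob {\<omega>\<in>space M. R < \<bar>y \<omega> t\<bar>} < \<epsilon>"
  shows "\<bar>(\<integral>\<omega>. f (y \<omega>) \<partial>M) - (\<integral>\<omega>. g (y \<omega>) \<partial>M)\<bar> \<le> \<epsilon> + 2 * (B * card J * \<epsilon>)"
proof -
  have yJ: "y \<omega> \<in> (\<Pi>\<^sub>E t\<in>J. UNIV)" if "\<omega> \<in> space M" for \<omega>
    using measurable_space[OF y that] by (simp add: space_PiM)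
  have i1: "integrable M (\<lambda>\<omega>. f (y \<omega>))"
    by (rule integrable_const_bound[where B=B]) (auto intro!: B yJ)
  have i2: "integrable M (\<lambda>\<omega>. g (y \<omega>))"
    by (rule integrable_const_bound[where B=C]) (auto intro!: C)
  have mt: "{\<omega>\<in>space M. R < \<bar>y \<omega> t\<bar>} \<in> events" if "t \<in> J" for t
    using that by measurable
  have i3: "integrable M (\<lambda>\<omega>. \<Sum>t\<in>J. 2 * B * indicator {\<omega>\<in>space M. R < \<bar>y \<omega> t\<bar>} \<omega>)"
    by (intro Bochner_Integration.integrable_sum integrable_mult_right)
       (simp add: mt integrable_indicator_iff emeasure_eq_measure)
  have "\<bar>(\<integral>\<omega>. f (y \<omega>) \<partial>M) - (\<integral>\<omega>. g (y \<omega>) \<partial>M)\<bar> = \<bar>\<integral>\<omega>. f (y \<omega>) - g (y \<omega>) \<partial>M\<bar>"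
    using i1 i2 by simp
  also have "\<dots> \<le> (\<integral>\<omega>. \<bar>f (y \<omega>) - g (y \<omega>)\<bar> \<partial>M)" by (rule integral_abs_bound)
  also have "\<dots> \<le> (\<integral>\<omega>. \<epsilon> + (\<Sum>t\<in>J. 2 * B * indicator {\<omega>\<in>space M. R < \<bar>y \<omega> t\<bar>} \<omega>) \<partial>M)"
  proof (rule integral_mono)
    fix \<omega> assume "\<omega> \<in> space M"
    then show "\<bar>f (y \<omega>) - g (y \<omega>)\<bar> \<le> \<epsilon> + (\<Sum>t\<in>J. 2 * B * indicator {\<omega>\<in>space M. R < \<bar>y \<omega> t\<bar>} \<omega>)"
      using approx[OF yJ] by (simp add: indicator_def)
  qed (use i1 i2 i3 in auto)
  also have "\<dots> = \<epsilon> + (\<integral>\<omega>. (\<Sum>t\<in>J. 2 * B * indicator {\<omega>\<in>space M. R < \<bar>y \<omega> t\<bar>} \<omega>) \<partial>M)"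
    using i3 by (subst Bochner_Integration.integral_add) (auto simp: prob_space)
  also have "(\<integral>\<omega>. (\<Sum>t\<in>J. 2 * B * indicator {\<omega>\<in>space M. R < \<bar>y \<omega> t\<bar>} \<omega>) \<partial>M)
    = (\<Sum>t\<in>J. 2 * B * prob {\<omega>\<in>space M. R < \<bar>y \<omega> t\<bar>})"
    using mt by (subst Bochner_Integration.integral_sum)
      (simp_all add: integrable_indicator_iff emeasure_eq_measure)
  also have "\<dots> \<le> (\<Sum>t\<in>J. 2 * B * \<epsilon>)"
  proof (intro sum_mono mult_left_mono)
    fix t assume "t \<in> J" with small show "prob {\<omega>\<in>space M. R < \<bar>y \<omega> t\<bar>} \<le> \<epsilon>" by (simp add: less_imp_le)
  qed (use B0 in simp)
  finally show ?thesis by (simp add: mult_ac)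
qed

lemma abs_diff_chain:
  fixes a b c d :: real
  assumes "\<bar>a - b\<bar> \<le> k" "\<bar>c - d\<bar> \<le> k" "\<bar>b - d\<bar> < l"
  shows "\<bar>a - c\<bar> < 2 * k + l"
  using assms by linarith

text \<open>The Cramer-Wold device in terms of cosines. Linearity extends the hypothesis to all trigonometric polynomials;
tightness and the uniform approximation extend it to all bounded continuous functions.\<close>
lemma weak_tendsto_PiM_sequentially:
  fixes X :: "nat \<Rightarrow> real \<Rightarrow> 'a \<Rightarrow> real" and Z :: "real \<Rightarrow> 'b \<Rightarrow> real"
  assumes M: "prob_space M" and N: "prob_space N" and J: "finite J"
    and X[measurable]: "\<And>n t. t \<in> J \<Longrightarrow> X n t \<in> borel_measurable M"
    and Z[measurable]: "\<And>t. t \<in> J \<Longrightarrow> Z t \<in> borel_measurable N"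
    and lim: "\<And>w p. (\<lambda>n. \<integral>\<omega>. cos ((\<Sum>t\<in>J. w t * X n t \<omega>) + p) \<partial>M)
                      \<longlonglongrightarrow> (\<integral>\<omega>. cos ((\<Sum>t\<in>J. w t * Z t \<omega>) + p) \<partial>N)"
  shows "weak_tendsto_PiM J (\<lambda>n. fdd M (X n) J) (fdd N Z J) sequentially"
  unfolding weak_tendsto_PiM_def
proof (intro allI impI, elim conjE)
  fix f :: "(real \<Rightarrow> real) \<Rightarrow> real"
  assume f: "continuous_map (product_topology (\<lambda>_. euclideanreal) J) euclideanreal f"
    and "bounded (f ` (\<Pi>\<^sub>E t\<in>J. UNIV))"
  then obtain B where B: "\<And>x. x \<in> (\<Pi>\<^sub>E t\<in>J. UNIV) \<Longrightarrow> \<bar>f x\<bar> \<le> B"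
    by (auto simp: bounded_iff)
  then have B0: "0 \<le> B" using abs_ge_zero[of "f (\<lambda>t\<in>J. 0)"] by (meson order_trans restrict_PiE_iff UNIV_I)
  interpret M: prob_space M by fact
  interpret N: prob_space N by fact
  note fm[measurable] = continuous_map_PiM_measurable[OF J f]
  define x where "x n \<omega> = (\<lambda>t\<in>J. X n t \<omega>)" for n \<omega>
  define z where "z \<omega> = (\<lambda>t\<in>J. Z t \<omega>)" for \<omega>
  have x[measurable]: "x n \<in> measurable M (PiM J (\<lambda>_. borel))" for n unfolding x_def by measurable
  have z[measurable]: "z \<in> measurable N (PiM J (\<lambda>_. borel))" unfolding z_def by measurable
  have fx: "(\<integral>y. f y \<partial>fdd M (X n) J) = (\<integral>\<omega>. f (x n \<omega>) \<partial>M)" for n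
    unfolding fdd_def x_def[symmetric] by (rule integral_distr) measurable
  have fz: "(\<integral>y. f y \<partial>fdd N Z J) = (\<integral>\<omega>. f (z \<omega>) \<partial>N)"
    unfolding fdd_def z_def[symmetric] by (rule integral_distr) measurable
  have tp: "(\<lambda>n. \<integral>\<omega>. g (x n \<omega>) \<partial>M) \<longlonglongrightarrow> (\<integral>\<omega>. g (z \<omega>) \<partial>N)" if "trig_poly J g" for g
    using that
  proof induction
    case (cosine w p)
    from lim[of w p] show ?case by (simp add: x_def z_def cong: sum.cong)
  next
    case (add f g)
    note m[measurable] = add.hyps[THEN trig_poly_measurable]
    obtain B C where BC: "\<forall>x. \<bar>f x\<bar> \<le> B" "\<forall>x. \<bar>g x\<bar> \<le> C"
      using add.hyps[THEN trig_poly_bounded] by auto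
    have [simp]: "integrable M (\<lambda>\<omega>. f (x n \<omega>))" "integrable N (\<lambda>\<omega>. f (z \<omega>))" for n
      using BC by (auto intro!: M.integrable_const_bound[where B=B] N.integrable_const_bound[where B=B])
    have [simp]: "integrable M (\<lambda>\<omega>. g (x n \<omega>))" "integrable N (\<lambda>\<omega>. g (z \<omega>))" for n
      using BC by (auto intro!: M.integrable_const_bound[where B=C] N.integrable_const_bound[where B=C])
    from tendsto_add[OF add.IH] show ?case by simp
  next
    case (scale f a)
    from tendsto_mult_left[OF scale.IH, of a] show ?case by simp
  qed
  have "(\<lambda>n. \<integral>\<omega>. f (x n \<omega>) \<partial>M) \<longlonglongrightarrow> (\<integral>\<omega>. f (z \<omega>) \<partial>N)"
  proof (rule LIMSEQ_I)
    fix e :: real assume "0 < e"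
    \<comment> \<open>The error is made of two approximation errors of size \<open>\<epsilon>\<close>, two tail terms \<open>2 * B * card J * \<epsilon>\<close> and the convergence error for \<open>g\<close>.\<close>
    define \<epsilon> where "\<epsilon> = e / (4 + 4 * B * card J)"
    have den: "0 < 4 + 4 * B * card J" using B0 by (intro add_pos_nonneg) auto
    have \<epsilon>: "0 < \<epsilon>" using \<open>0 < e\<close> den by (simp add: \<epsilon>_def)
    have "\<epsilon> * (4 + 4 * B * card J) = e"
      using den unfolding \<epsilon>_def by (metis less_irrefl nonzero_eq_divide_eq)
    then have \<epsilon>e: "4 * \<epsilon> + 4 * (B * card J * \<epsilon>) = e"
      by (simp add: algebra_simps)
    have "\<exists>K. \<forall>L\<ge>K. (\<forall>\<^sub>F n in sequentially. measure M {\<omega>\<in>space M. L < \<bar>X n t \<omega>\<bar>} < \<epsilon>) \<and>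
      measure N {\<omega>\<in>space N. L < \<bar>Z t \<omega>\<bar>} < \<epsilon>" if t: "t \<in> J" for t
    proof (rule tight_of_cos_convergence[OF M N X[OF t] Z[OF t] _ \<epsilon>])
      fix a p
      have *: "(\<Sum>s\<in>J. (if s = t then a else 0) * y s) = a * y t" for y :: "real \<Rightarrow> real"
        using J t by (simp add: if_distrib[of "\<lambda>y. y * _"] sum.delta cong: if_cong)
      from lim[of "\<lambda>s. if s = t then a else 0" p]
      show "(\<lambda>n. \<integral>\<omega>. cos (a * X n t \<omega> + p) \<partial>M) \<longlonglongrightarrow> (\<integral>\<omega>. cos (a * Z t \<omega> + p) \<partial>N)"
        unfolding * .
    qed
    then have "\<forall>t\<in>J. \<exists>K. \<forall>L\<ge>K. (\<forall>\<^sub>F n in sequentially. measure M {\<omega>\<in>space M. L < \<bar>X n t \<omega>\<bar>} < \<epsilon>) \<and>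
      measure N {\<omega>\<in>space N. L < \<bar>Z t \<omega>\<bar>} < \<epsilon>" by blast
    from bchoice[OF this] obtain K where
      "\<forall>t\<in>J. \<forall>L\<ge>K t. (\<forall>\<^sub>F n in sequentially. measure M {\<omega>\<in>space M. L < \<bar>X n t \<omega>\<bar>} < \<epsilon>) \<and>
      measure N {\<omega>\<in>space N. L < \<bar>Z t \<omega>\<bar>} < \<epsilon>" ..
    then have K: "\<And>t L. t \<in> J \<Longrightarrow> K t \<le> L \<Longrightarrow> (\<forall>\<^sub>F n in sequentially. measure M {\<omega>\<in>space M. L < \<bar>X n t \<omega>\<bar>} < \<epsilon>)"
       "\<And>t L. t \<in> J \<Longrightarrow> K t \<le> L \<Longrightarrow> measure N {\<omega>\<in>space N. L < \<bar>Z t \<omega>\<bar>} < \<epsilon>"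
      by blast+
    define R where "R = 1 + (\<Sum>t\<in>J. \<bar>K t\<bar>)"
    have R0: "0 < R" unfolding R_def by (intro add_pos_nonneg sum_nonneg) auto
    have KR: "K t \<le> R" if "t \<in> J" for t
    proof -
      have "\<bar>K t\<bar> \<le> (\<Sum>t\<in>J. \<bar>K t\<bar>)" using that J by (intro member_le_sum) auto
      then show ?thesis unfolding R_def by linarith
    qed
    obtain g where g: "trig_poly J g" "\<And>y. \<bar>f (\<lambda>t\<in>J. fold_line R (y t)) - g y\<bar> < \<epsilon>"
      using trig_poly_approx[OF J f R0 \<epsilon>] by auto
    note gm[measurable] = trig_poly_measurable[OF g(1)]
    obtain C where C: "\<And>x. \<bar>g x\<bar> \<le> C" using trig_poly_bounded[OF g(1)] by auto
    have approx: "\<bar>f y - g y\<bar> \<le> \<epsilon> + (\<Sum>t\<in>J. 2 * B * indicator {x. R < \<bar>x\<bar>} (y t))"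
      if y: "y \<in> (\<Pi>\<^sub>E t\<in>J. UNIV)" for y
    proof (cases "\<forall>t\<in>J. \<bar>y t\<bar> \<le> R")
      case True
      then have "(\<lambda>t\<in>J. fold_line R (y t)) = (\<lambda>t\<in>J. y t)"
        using R0 by (intro restrict_ext fold_line_eq) auto
      also have "\<dots> = y" using y by (rule PiE_restrict)
      finally have "(\<lambda>t\<in>J. fold_line R (y t)) = y" .
      with g(2)[of y] have "\<bar>f y - g y\<bar> \<le> \<epsilon>" by simp
      moreover have "0 \<le> (\<Sum>t\<in>J. 2 * B * indicator {x. R < \<bar>x\<bar>} (y t))" using B0 by (intro sum_nonneg) auto
      ultimately show ?thesis by linarith
    next
      case False
      then obtain t where t: "t \<in> J" "R < \<bar>y t\<bar>" by auto
      have "2 * B * indicator {x. R < \<bar>x\<bar>} (y t) \<le> (\<Sum>t\<in>J. 2 * B * indicator {x. R < \<bar>x\<bar>} (y t))"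
        using t J B0 by (intro member_le_sum) auto
      moreover have "2 * B * indicator {x. R < \<bar>x\<bar>} (y t) = 2 * B" using t by simp
      moreover have "\<bar>f y\<bar> \<le> B" using B y by auto
      moreover have "\<bar>f (\<lambda>t\<in>J. fold_line R (y t))\<bar> \<le> B" by (rule B) auto
      ultimately show ?thesis using g(2)[of y] by linarith
    qed
    have "\<forall>\<^sub>F n in sequentially. \<forall>t\<in>J. measure M {\<omega>\<in>space M. R < \<bar>x n \<omega> t\<bar>} < \<epsilon>"
    proof (intro eventually_ball_finite J ballI)
      fix t assume "t \<in> J"
      from K(1)[OF this KR[OF this]] \<open>t \<in> J\<close>
      show "\<forall>\<^sub>F n in sequentially. measure M {\<omega>\<in>space M. R < \<bar>x n \<omega> t\<bar>} < \<epsilon>"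
        by (simp add: x_def)
    qed
    moreover have "\<forall>\<^sub>F n in sequentially. norm ((\<integral>\<omega>. g (x n \<omega>) \<partial>M) - (\<integral>\<omega>. g (z \<omega>) \<partial>N)) < \<epsilon>"
      using tendstoD[OF tp[OF g(1)] \<epsilon>] by (simp add: dist_norm)
    ultimately have "\<forall>\<^sub>F n in sequentially. norm ((\<integral>\<omega>. f (x n \<omega>) \<partial>M) - (\<integral>\<omega>. f (z \<omega>) \<partial>N)) < e"
    proof eventually_elim
      case (elim n)
      have "\<bar>(\<integral>\<omega>. f (x n \<omega>) \<partial>M) - (\<integral>\<omega>. g (x n \<omega>) \<partial>M)\<bar> \<le> \<epsilon> + 2 * (B * card J * \<epsilon>)"
      proof (rule M.expectation_diff_le_tail[OF J x fm gm B C approx B0])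
        fix t assume "t \<in> J"
        with elim show "measure M {\<omega>\<in>space M. R < \<bar>x n \<omega> t\<bar>} < \<epsilon>" by blast
      qed
      moreover have "\<bar>(\<integral>\<omega>. f (z \<omega>) \<partial>N) - (\<integral>\<omega>. g (z \<omega>) \<partial>N)\<bar> \<le> \<epsilon> + 2 * (B * card J * \<epsilon>)"
      proof (rule N.expectation_diff_le_tail[OF J z fm gm B C approx B0])
        fix t assume t: "t \<in> J"
        from K(2)[OF t KR[OF t]] t show "measure N {\<omega>\<in>space N. R < \<bar>z \<omega> t\<bar>} < \<epsilon>"
          by (simp add: z_def)
      qed
      moreover note elim(2)
      ultimately have "norm ((\<integral>\<omega>. f (x n \<omega>) \<partial>M) - (\<integral>\<omega>. f (z \<omega>) \<partial>N)) <
          2 * (\<epsilon> + 2 * (B * card J * \<epsilon>)) + \<epsilon>"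
        unfolding real_norm_def by (rule abs_diff_chain)
      also have "\<dots> = e - \<epsilon>" unfolding \<epsilon>e[symmetric] by (simp add: algebra_simps)
      also have "\<dots> < e" using \<epsilon> by simp
      finally show ?case .
    qed
    then show "\<exists>no. \<forall>n\<ge>no. norm ((\<integral>\<omega>. f (x n \<omega>) \<partial>M) - (\<integral>\<omega>. f (z \<omega>) \<partial>N)) < e"
      by (simp add: eventually_sequentially)
  qed
  then show "(\<lambda>n. \<integral>y. f y \<partial>fdd M (X n) J) \<longlonglongrightarrow> (\<integral>y. f y \<partial>fdd N Z J)"
    unfolding fx fz .
qed

lemma weak_tendsto_PiM_at_rightI:
  assumes "\<And>r. (\<And>n. r n > 0) \<Longrightarrow> r \<longlonglongrightarrow> 0 \<Longrightarrow> weak_tendsto_PiM J (\<lambda>n::nat. \<mu> (r n)) \<nu> sequentially"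
  shows "weak_tendsto_PiM J \<mu> \<nu> (at_right (0::real))"
  unfolding weak_tendsto_PiM_def
proof (intro allI impI)
  fix f :: "(real \<Rightarrow> real) \<Rightarrow> real"
  assume f: "continuous_map (product_topology (\<lambda>_. euclideanreal) J) euclideanreal f \<and>
           bounded (f ` (\<Pi>\<^sub>E t\<in>J. UNIV))"
  show "((\<lambda>r. integral\<^sup>L (\<mu> r) f) \<longlongrightarrow> integral\<^sup>L \<nu> f) (at_right 0)"
    unfolding tendsto_at_iff_sequentially comp_def
  proof (intro allI impI)
    fix r :: "nat \<Rightarrow> real"
    assume "\<forall>i. r i \<in> {0<..} - {0}" "r \<longlonglongrightarrow> 0"
    then have "weak_tendsto_PiM J (\<lambda>n. \<mu> (r n)) \<nu> sequentially" by (intro assms) auto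
    from this[unfolded weak_tendsto_PiM_def, rule_format, OF f]
    show "(\<lambda>n. integral\<^sup>L (\<mu> (r n)) f) \<longlonglongrightarrow> integral\<^sup>L \<nu> f" .
  qed
qed

section \<open>Powers with varying exponent\<close>

lemma integrable_powr_tails:
  fixes p q :: real
  assumes "-1 < p" "q < -1"
  shows "integrable lborel (\<lambda>x::real. indicator {0<..1} x * x powr p)"
    and "integrable lborel (\<lambda>x::real. indicator {1..} x * x powr q)"
proof -
  have "(\<lambda>x. x powr p) absolutely_integrable_on {0<..1}"
    using assms by (intro nonnegative_absolutely_integrable_1 integrable_on_powr_from_0') auto
  then show "integrable lborel (\<lambda>x::real. indicator {0<..1} x * x powr p)"
    unfolding set_integrable_def by (subst (asm) integrable_completion) auto
  have "(\<lambda>x. x powr q) absolutely_integrable_on {1..}"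
    using has_integral_powr_to_inf[of q 1] assms
    by (intro nonnegative_absolutely_integrable_1) (auto simp: integrable_on_def)
  then show "integrable lborel (\<lambda>x::real. indicator {1..} x * x powr q)"
    unfolding set_integrable_def by (subst (asm) integrable_completion) auto
qed

lemma powr_le_sum:
  fixes z :: real
  assumes "0 < z" "p \<le> s" "s \<le> q"
  shows "z powr s \<le> z powr p + z powr q"
proof (cases "1 \<le> z")
  case True
  then have "z powr s \<le> z powr q" using assms by (intro powr_mono) auto
  then show ?thesis by (simp add: add_increasing)
next
  case False
  then have "z powr s \<le> z powr p" using assms by (intro powr_mono') auto
  then show ?thesis by (simp add: add_increasing2)
qed

lemma abs_ln_le_powr:
  fixes z :: real
  assumes z: "0 < z" and e: "0 < e"
  shows "\<bar>ln z\<bar> \<le> (z powr - e + z powr e) / e"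
proof (cases "1 \<le> z")
  case True
  then have "\<bar>ln z\<bar> \<le> z powr e / e" using ln_powr_bound[OF True e] by simp
  also have "\<dots> \<le> (z powr - e + z powr e) / e" using e by (simp add: divide_right_mono)
  finally show ?thesis .
next
  case False
  then have "1 \<le> inverse z" using z by (simp add: one_le_inverse)
  from ln_powr_bound[OF this e] have "\<bar>ln z\<bar> \<le> z powr - e / e"
    using False z by (simp add: ln_inverse powr_minus inverse_powr)
  also have "\<dots> \<le> (z powr - e + z powr e) / e" using e by (simp add: divide_right_mono)
  finally show ?thesis .
qed

text \<open>The mean value theorem in the exponent produces a factor \<open>ln z\<close>, which is absorbed by moving
the exponents outwards by \<open>e\<close>.\<close>
lemma powr_exponent_diff_le:
  fixes z :: real
  assumes z: "0 < z" and e: "0 < e" and s: "p \<le> s" "s \<le> q" and s': "p \<le> s'" "s' \<le> q"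
  shows "\<bar>z powr s - z powr s'\<bar> \<le> (4 / e) * \<bar>s - s'\<bar> * (z powr (p - e) + z powr (q + e))"
proof -
  have "\<bar>z powr s - z powr s'\<bar> \<le> \<bar>s - s'\<bar> * (\<bar>ln z\<bar> * (z powr p + z powr q))"
  proof -
    have *: "\<exists>\<xi>. p \<le> \<xi> \<and> \<xi> \<le> q \<and> \<bar>z powr a - z powr b\<bar> = \<bar>a - b\<bar> * (\<bar>ln z\<bar> * z powr \<xi>)"
      if "a < b" "p \<le> a" "b \<le> q" for a b
    proof -
      have "\<exists>\<xi>. a < \<xi> \<and> \<xi> < b \<and> z powr b - z powr a = (b - a) * (ln z * z powr \<xi>)"
        using z \<open>a < b\<close> by (intro MVT2) (auto intro!: derivative_eq_intros)
      then obtain \<xi> where \<xi>: "a < \<xi>" "\<xi> < b" "z powr b - z powr a = (b - a) * (ln z * z powr \<xi>)" by auto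
      then have "\<bar>z powr a - z powr b\<bar> = \<bar>(b - a) * (ln z * z powr \<xi>)\<bar>" by (simp add: abs_minus_commute)
      also have "\<dots> = \<bar>a - b\<bar> * (\<bar>ln z\<bar> * z powr \<xi>)" by (simp add: abs_mult abs_minus_commute)
      finally show ?thesis using \<xi> that by (intro exI[of _ \<xi>]) auto
    qed
    consider "s < s'" | "s = s'" | "s' < s" by linarith
    then have "\<exists>\<xi>. p \<le> \<xi> \<and> \<xi> \<le> q \<and> \<bar>z powr s - z powr s'\<bar> = \<bar>s - s'\<bar> * (\<bar>ln z\<bar> * z powr \<xi>)"
    proof cases
      case 1 then show ?thesis using *[of s s'] s s' by blast
    next
      case 2 then show ?thesis using s by auto
    next
      case 3 then show ?thesis using *[of s' s] s s' by (simp add: abs_minus_commute)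
    qed
    then obtain \<xi> where \<xi>: "p \<le> \<xi>" "\<xi> \<le> q" "\<bar>z powr s - z powr s'\<bar> = \<bar>s - s'\<bar> * (\<bar>ln z\<bar> * z powr \<xi>)"
      by blast
    show ?thesis unfolding \<xi>(3)
      by (intro mult_left_mono powr_le_sum[OF z \<xi>(1,2)]) auto
  qed
  also have "\<dots> \<le> \<bar>s - s'\<bar> * ((z powr - e + z powr e) / e * (z powr p + z powr q))"
    by (intro mult_left_mono mult_right_mono abs_ln_le_powr[OF z e]) auto
  also have "(z powr - e + z powr e) / e * (z powr p + z powr q) =
      (z powr (p - e) + z powr (q - e) + z powr (p + e) + z powr (q + e)) / e"
    using powr_add[of z p "- e"] powr_add[of z q "- e"] powr_add[of z p e] powr_add[of z q e]
    by (simp add: algebra_simps add_divide_distrib)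
  also have "\<dots> \<le> (4 * (z powr (p - e) + z powr (q + e))) / e"
  proof (intro divide_right_mono)
    have "z powr (q - e) \<le> z powr (p - e) + z powr (q + e)"
      using e s by (intro powr_le_sum z) auto
    moreover have "z powr (p + e) \<le> z powr (p - e) + z powr (q + e)"
      using e s by (intro powr_le_sum z) auto
    moreover have "0 \<le> z powr (p - e)" "0 \<le> z powr (q + e)" by auto
    moreover have "A + B + C + D \<le> 4 * (A + D)"
      if "B \<le> A + D" "C \<le> A + D" "0 \<le> A" "0 \<le> D" for A B C D :: real using that by simp
    ultimately show "z powr (p - e) + z powr (q - e) + z powr (p + e) + z powr (q + e)
      \<le> 4 * (z powr (p - e) + z powr (q + e))" by blast
  qed (use e in simp)
  also have "\<bar>s - s'\<bar> * ((4 * (z powr (p - e) + z powr (q + e))) / e) =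
      (4 / e) * \<bar>s - s'\<bar> * (z powr (p - e) + z powr (q + e))" by simp
  finally show ?thesis by (simp only: mult_left_mono abs_ge_zero)
qed

section \<open>The constant of a stable law\<close>

definition stable_integral :: "real \<Rightarrow> real" where
  "stable_integral a = (\<integral>x. indicator {0<..} x * (x powr (- a) * sin x) \<partial>lborel)"

lemma stable_const_eq: "stable_const a = inverse (stable_integral a)"
  by (simp add: stable_const_def stable_integral_def set_lebesgue_integral_def)

text \<open>Near 0 the sine supplies a factor \<open>x\<close>, at infinity only its boundedness is used; hence the range of
exponents between -2 and -1.\<close>
lemma integrable_powr_sin_dom:
  fixes p q :: real
  assumes "-2 < p" "p < -1" "-2 < q" "q < -1"
  shows "integrable lborel (\<lambda>x::real. indicator {0<..} x * ((x powr p + x powr q) * \<bar>sin x\<bar>))"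
proof -
  have one: "integrable lborel (\<lambda>x::real. indicator {0<..} x * (x powr r * \<bar>sin x\<bar>))"
    if r: "-2 < r" "r < -1" for r
  proof (rule Bochner_Integration.integrable_bound)
    show "integrable lborel (\<lambda>x::real. indicator {0<..1} x * x powr (r + 1) + indicator {1..} x * x powr r)"
      using r integrable_powr_tails[of "r+1" r] by auto
    show "AE x in lborel. norm (indicator {0<..} x * (x powr r * \<bar>sin x\<bar>))
       \<le> norm (indicator {0<..1} x * x powr (r + 1) + indicator {1..} x * x powr r)"
    proof (rule AE_I2)
      fix x :: real
      consider "x \<le> 0" | "0 < x" "x < 1" | "1 \<le> x" by linarith
      then show "norm (indicator {0<..} x * (x powr r * \<bar>sin x\<bar>))
       \<le> norm (indicator {0<..1} x * x powr (r + 1) + indicator {1..} x * x powr r)"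
      proof cases
        case 2
        have "x powr r * \<bar>sin x\<bar> \<le> x powr r * x"
          using 2 by (intro mult_left_mono order_trans[OF abs_sin_x_le_abs_x]) auto
        then show ?thesis using 2 by (simp add: powr_add)
      next
        case 3
        have "x powr r * \<bar>sin x\<bar> \<le> x powr r * 1" by (intro mult_left_mono) auto
        moreover have "norm (indicator {0<..} x * (x powr r * \<bar>sin x\<bar>)) = x powr r * \<bar>sin x\<bar>"
          using 3 by (simp add: abs_mult)
        moreover have "x powr r \<le> norm (indicator {0<..1} x * x powr (r + 1) + indicator {1..} x * x powr r)"
          using 3 by (simp add: abs_of_nonneg add_nonneg_nonneg)
        ultimately show ?thesis by linarith
      qed simp
    qed
  qed simp
  have "integrable lborel (\<lambda>x::real. indicator {0<..} x * (x powr p * \<bar>sin x\<bar>) + indicator {0<..} x * (x powr q * \<bar>sin x\<bar>))"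
    using one[of p] one[of q] assms by (intro Bochner_Integration.integrable_add) auto
  then show ?thesis by (simp add: distrib_left distrib_right)
qed

lemma integrable_stable_integrand:
  assumes "1 < a" "a < 2"
  shows "integrable lborel (\<lambda>x::real. indicator {0<..} x * (x powr (- a) * sin x))"
proof (rule Bochner_Integration.integrable_bound)
  show "integrable lborel (\<lambda>x::real. indicator {0<..} x * ((x powr -a + x powr -a) * \<bar>sin x\<bar>))"
    using assms by (intro integrable_powr_sin_dom) auto
  show "AE x::real in lborel. norm (indicator {0<..} x * (x powr (- a) * sin x)) \<le>
    norm (indicator {0<..} x * ((x powr -a + x powr -a) * \<bar>sin x\<bar>))"
    by (intro AE_I2) (simp add: abs_mult indicator_def)
qed simp

lemma stable_integral_lipschitz:
  assumes "1 < c" "d < 2"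
  shows "\<exists>L. \<forall>a\<in>{c..d}. \<forall>a'\<in>{c..d}. \<bar>stable_integral a - stable_integral a'\<bar> \<le> L * \<bar>a - a'\<bar>"
proof (cases "c \<le> d")
  case True
  \<comment> \<open>Half the distance of \<open>[c, d]\<close> from the end points 1 and 2, so that the enlarged exponents stay integrable.\<close>
  define e where "e = min (2 - d) (c - 1) / 2"
  have e: "0 < e" "-2 < - d - e" "- c + e < -1" using assms True by (auto simp: e_def min_def field_simps)
  define w where "w x = indicator {0<..} x * ((x powr (- d - e) + x powr (- c + e)) * \<bar>sin x\<bar>)" for x :: real
  have w: "integrable lborel w" unfolding w_def
    using e True by (intro integrable_powr_sin_dom) auto
  show ?thesis
  proof (intro exI[of _ "4 / e * integral\<^sup>L lborel w"] ballI)
    fix a a' assume a: "a \<in> {c..d}" "a' \<in> {c..d}"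
    note i = integrable_stable_integrand[of a] integrable_stable_integrand[of a']
    have "stable_integral a - stable_integral a' =
       (\<integral>x. indicator {0<..} x * (x powr (- a) * sin x) - indicator {0<..} x * (x powr (- a') * sin x) \<partial>lborel)"
      unfolding stable_integral_def using i a assms by (subst Bochner_Integration.integral_diff) auto
    also have "\<bar>\<dots>\<bar> \<le> (\<integral>x. (4 / e * \<bar>a - a'\<bar>) * w x \<partial>lborel)"
    proof (rule integral_abs_bound_integral)
      fix x :: real
      show "\<bar>indicator {0<..} x * (x powr (- a) * sin x) - indicator {0<..} x * (x powr (- a') * sin x)\<bar>
        \<le> (4 / e * \<bar>a - a'\<bar>) * w x"
      proof (cases "0 < x")
        case True
        have "\<bar>x powr (- a) - x powr (- a')\<bar> * \<bar>sin x\<bar> \<le>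
          ((4 / e) * \<bar>- a - - a'\<bar> * (x powr (- d - e) + x powr (- c + e))) * \<bar>sin x\<bar>"
          using a e True by (intro mult_right_mono powr_exponent_diff_le) auto
        moreover have "\<bar>indicator {0<..} x * (x powr (- a) * sin x) - indicator {0<..} x * (x powr (- a') * sin x)\<bar>
          = \<bar>x powr (- a) - x powr (- a')\<bar> * \<bar>sin x\<bar>"
          using True by (simp add: abs_mult[symmetric] left_diff_distrib)
        moreover have "((4 / e) * \<bar>- a - - a'\<bar> * (x powr (- d - e) + x powr (- c + e))) * \<bar>sin x\<bar>
          = (4 / e * \<bar>a - a'\<bar>) * w x"
          using True by (simp add: w_def abs_minus_commute mult_ac)
        ultimately show ?thesis by (simp only:)
      qed (simp add: w_def)
    qed (use i a assms w in auto)
    also have "\<dots> = 4 / e * integral\<^sup>L lborel w * \<bar>a - a'\<bar>" by simp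
    finally show "\<bar>stable_integral a - stable_integral a'\<bar> \<le> 4 / e * integral\<^sup>L lborel w * \<bar>a - a'\<bar>" .
  qed
qed auto

text \<open>Both integrals are iterated integrals of \<open>sin x\<close> over the region \<open>0 < y < x powr - a\<close> of the quadrant: integrating
over \<open>y\<close> first gives \<open>x powr - a * sin x\<close>, integrating over \<open>x\<close> first gives \<open>1 - cos (y powr (- 1 / a))\<close>. The
cosine form is the one that appears in characteristic functions, and it shows positivity.\<close>
lemma
  assumes a: "1 < a" "a < 2"
  shows integrable_one_minus_cos: "integrable lborel (\<lambda>y::real. indicator {0<..} y * (1 - cos (y powr (- 1 / a))))"
    and integral_one_minus_cos:
      "(\<integral>y. indicator {0<..} y * (1 - cos (y powr (- 1 / a))) \<partial>lborel) = stable_integral a"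
proof -
  define F where "F x y = indicator {0<..} x * (indicator {0<..<x powr (- a)} y * sin x)" for x y :: real
  have F1: "F x y = (indicator {0<..} x * sin x) * indicator {0<..<x powr (- a)} y" for x y
    by (simp add: F_def)
  have yx: "y < x powr (- a) \<longleftrightarrow> x < y powr (- 1 / a)" if "0 < x" "0 < y" for x y
  proof -
    have "y < x powr (- a) \<longleftrightarrow> y powr (1 / a) < (x powr (- a)) powr (1 / a)"
      using that a powr_less_mono2[of "1/a" y "x powr (- a)"] powr_mono2[of "1/a" "x powr (- a)" y]
      by (auto simp: not_less[symmetric])
    also have "(x powr (- a)) powr (1 / a) = inverse x"
      using that a powr_powr[of x "- a" "1 / a"] by (simp add: powr_minus_divide inverse_eq_divide)
    also have "y powr (1 / a) < inverse x \<longleftrightarrow> x < inverse (y powr (1 / a))"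
      using that by (auto simp: field_simps)
    also have "inverse (y powr (1 / a)) = y powr (- 1 / a)"
      by (simp add: powr_minus)
    finally show ?thesis .
  qed
  have F2: "F x y = indicator {0<..} y * (indicator {0<..<y powr (- 1 / a)} x * sin x)" for x y
    using yx[of x y] by (auto simp: F_def indicator_def)
  have meas: "case_prod F \<in> borel_measurable (lborel \<Otimes>\<^sub>M lborel)"
    unfolding F_def indicator_def greaterThanLessThan_def by (simp add: greaterThan_def lessThan_def)
  have inner1: "(\<integral>y. F x y \<partial>lborel) = indicator {0<..} x * (x powr (- a) * sin x)" for x
    unfolding F1 by (simp add: mult_ac)
  have int: "integrable (lborel \<Otimes>\<^sub>M lborel) (case_prod F)"
  proof (rule lborel_pair.Fubini_integrable[OF meas])
    have "norm (F x y) = (indicator {0<..} x * \<bar>sin x\<bar>) * indicator {0<..<x powr (- a)} y" for x y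
      by (simp add: F_def abs_mult)
    then have "(\<lambda>x. \<integral>y. norm (F x y) \<partial>lborel) = (\<lambda>x. norm (indicator {0<..} x * (x powr (- a) * sin x)))"
      by (intro ext) (simp add: abs_mult mult_ac)
    then show "integrable lborel (\<lambda>x. \<integral>y. norm (case_prod F (x, y)) \<partial>lborel)"
      using integrable_norm[OF integrable_stable_integrand[OF a]] by simp
    show "AE x in lborel. integrable lborel (\<lambda>y. case_prod F (x, y))"
      by (intro AE_I2) (auto simp: F1 intro!: integrable_mult_right)
  qed
  have inner2: "(\<integral>x. F x y \<partial>lborel) = indicator {0<..} y * (1 - cos (y powr (- 1 / a)))" for y
  proof -
    have "(\<integral>x. indicator {0<..<y powr (- 1 / a)} x * sin x \<partial>lborel) =
        (\<integral>x. sin x * indicator {0..y powr (- 1 / a)} x \<partial>lborel)"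
    proof (rule integral_cong_AE)
      have "AE x::real in lborel. x \<noteq> 0" "AE x::real in lborel. x \<noteq> y powr (- 1 / a)"
        by (rule AE_lborel_singleton)+
      then show "AE x in lborel. indicator {0<..<y powr (- 1 / a)} x * sin x = sin x * indicator {0..y powr (- 1 / a)} x"
        by eventually_elim (auto simp: indicator_def)
    qed auto
    also have "\<dots> = (- cos (y powr (- 1 / a))) - (- cos 0)"
      by (intro integral_FTC_Icc_real) (auto intro!: derivative_eq_intros continuous_intros)
    finally show ?thesis unfolding F2 by simp
  qed
  show "integrable lborel (\<lambda>y::real. indicator {0<..} y * (1 - cos (y powr (- 1 / a))))"
    using lborel_pair.integrable_snd[OF int] by (simp add: inner2)
  show "(\<integral>y. indicator {0<..} y * (1 - cos (y powr (- 1 / a))) \<partial>lborel) = stable_integral a"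
    using lborel_pair.Fubini_integral[OF int] by (simp add: inner1 inner2 stable_integral_def)
qed

lemma stable_integral_pos:
  assumes a: "1 < a" "a < 2"
  shows "0 < stable_integral a"
proof -
  have "0 < (\<integral>y. indicator {1..2::real} y * (1 - cos (1/2::real)) \<partial>lborel)"
  proof -
    have "cos (1/2::real) < cos 0" using pi_gt3 by (intro cos_monotone_0_pi) auto
    then show ?thesis by simp
  qed
  also have "\<dots> \<le> (\<integral>y. indicator {0<..} y * (1 - cos (y powr (- 1 / a))) \<partial>lborel)"
  proof (rule integral_mono)
    fix y :: real
    show "indicator {1..2} y * (1 - cos (1 / 2)) \<le> indicator {0<..} y * (1 - cos (y powr (- 1 / a)))"
    proof (cases "y \<in> {1..2}")
      case True
      have "y powr (- 1 / a) \<le> y powr 0" using True a by (intro powr_mono) auto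
      moreover have "1/2 \<le> y powr (-1)" using True by (simp add: powr_minus field_simps)
      moreover have "y powr (-1) \<le> y powr (- 1 / a)" using True a by (intro powr_mono) auto
      ultimately have "1/2 \<le> y powr (- 1 / a)" "y powr (- 1 / a) \<le> 1"
        using True by (linarith, simp)
      then have "cos (y powr (- 1 / a)) \<le> cos (1/2)" using pi_gt3 by (intro cos_monotone_0_pi_le) auto
      then show ?thesis using True by simp
    qed (auto simp: indicator_def)
  qed (use integrable_one_minus_cos[OF a] in \<open>auto intro!: integrable_mult_left\<close>)
  finally show ?thesis unfolding integral_one_minus_cos[OF a] .
qed

section \<open>Functions that are Lipschitz at a point\<close>

text \<open>Lipschitz behaviour at the single point \<open>u\<close>, known as calmness. It is weaker than differentiability and thus avoids
differentiating the stable integral with respect to the index.\<close>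
definition calm_at :: "(real \<Rightarrow> real) \<Rightarrow> real \<Rightarrow> bool" where
  "calm_at f u \<longleftrightarrow> (\<exists>L. \<forall>\<^sub>F v in nhds u. \<bar>f v - f u\<bar> \<le> L * \<bar>v - u\<bar>)"

lemma calm_atE:
  assumes "calm_at f u"
  obtains L where "0 \<le> L" "\<forall>\<^sub>F v in nhds u. \<bar>f v - f u\<bar> \<le> L * \<bar>v - u\<bar>"
proof -
  from assms obtain L where L: "\<forall>\<^sub>F v in nhds u. \<bar>f v - f u\<bar> \<le> L * \<bar>v - u\<bar>"
    by (auto simp: calm_at_def)
  have "\<forall>\<^sub>F v in nhds u. \<bar>f v - f u\<bar> \<le> \<bar>L\<bar> * \<bar>v - u\<bar>"
    using L by eventually_elim (meson abs_ge_self abs_ge_zero mult_right_mono order_trans)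
  then show ?thesis by (intro that[of "\<bar>L\<bar>"]) auto
qed

lemma calm_at_DERIV:
  assumes "(f has_real_derivative D) (at u)"
  shows "calm_at f u"
proof -
  have "((\<lambda>v. (f v - f u) / (v - u)) \<longlongrightarrow> D) (at u)"
    using assms by (simp add: has_field_derivative_iff)
  then have "((\<lambda>v. \<bar>(f v - f u) / (v - u)\<bar>) \<longlongrightarrow> \<bar>D\<bar>) (at u)" by (rule tendsto_rabs)
  then have "\<forall>\<^sub>F v in at u. \<bar>(f v - f u) / (v - u)\<bar> < \<bar>D\<bar> + 1"
    by (rule order_tendstoD) simp
  moreover have "\<forall>\<^sub>F v in at u. v \<noteq> u" by (simp add: eventually_at_filter)
  ultimately have "\<forall>\<^sub>F v in at u. \<bar>f v - f u\<bar> \<le> (\<bar>D\<bar> + 1) * \<bar>v - u\<bar>"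
    by eventually_elim (simp add: field_simps)
  then show ?thesis unfolding calm_at_def
    by (intro exI[of _ "\<bar>D\<bar> + 1"]) (simp add: eventually_nhds_conv_at)
qed

lemma calm_at_tendsto:
  assumes "calm_at f u"
  shows "(f \<longlongrightarrow> f u) (nhds u)"
proof -
  obtain L where "\<forall>\<^sub>F v in nhds u. norm (f v - f u) \<le> L * \<bar>v - u\<bar>"
    using assms by (auto elim: calm_atE)
  moreover have "((\<lambda>v. L * \<bar>v - u\<bar>) \<longlongrightarrow> L * \<bar>u - u\<bar>) (nhds u)"
    by (intro tendsto_mult tendsto_const tendsto_rabs tendsto_diff filterlim_ident)
  ultimately have "((\<lambda>v. f v - f u) \<longlongrightarrow> 0) (nhds u)"
    by (intro Lim_null_comparison[of "\<lambda>v. f v - f u"]) auto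
  then show ?thesis by (rule LIM_zero_cancel)
qed

lemma calm_at_compose:
  assumes f: "calm_at f u" and g: "(g has_real_derivative D) (at (f u))"
  shows "calm_at (\<lambda>v. g (f v)) u"
proof -
  obtain L where L: "0 \<le> L" "\<forall>\<^sub>F v in nhds u. \<bar>f v - f u\<bar> \<le> L * \<bar>v - u\<bar>"
    using f by (rule calm_atE)
  obtain K where K: "0 \<le> K" "\<forall>\<^sub>F w in nhds (f u). \<bar>g w - g (f u)\<bar> \<le> K * \<bar>w - f u\<bar>"
    using calm_at_DERIV[OF g] by (rule calm_atE)
  have "\<forall>\<^sub>F v in nhds u. \<bar>g (f v) - g (f u)\<bar> \<le> K * \<bar>f v - f u\<bar>"
    using K(2) calm_at_tendsto[OF f] by (rule eventually_compose_filterlim)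
  with L(2) have "\<forall>\<^sub>F v in nhds u. \<bar>g (f v) - g (f u)\<bar> \<le> (K * L) * \<bar>v - u\<bar>"
  proof eventually_elim
    case (elim v)
    from mult_left_mono[OF elim(1) K(1)] elim(2) show ?case by simp
  qed
  then show ?thesis by (auto simp: calm_at_def)
qed

lemma calm_at_mult:
  assumes f: "calm_at f u" and g: "calm_at g u"
  shows "calm_at (\<lambda>v. f v * g v) u"
proof -
  obtain L where L: "0 \<le> L" "\<forall>\<^sub>F v in nhds u. \<bar>f v - f u\<bar> \<le> L * \<bar>v - u\<bar>"
    using f by (rule calm_atE)
  obtain K where K: "0 \<le> K" "\<forall>\<^sub>F v in nhds u. \<bar>g v - g u\<bar> \<le> K * \<bar>v - u\<bar>"
    using g by (rule calm_atE)
  have "\<forall>\<^sub>F v in nhds u. \<bar>g v\<bar> < \<bar>g u\<bar> + 1"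
    using tendsto_rabs[OF calm_at_tendsto[OF g]] by (rule order_tendstoD) simp
  with L(2) K(2) have "\<forall>\<^sub>F v in nhds u. \<bar>f v * g v - f u * g u\<bar> \<le> (L * (\<bar>g u\<bar> + 1) + \<bar>f u\<bar> * K) * \<bar>v - u\<bar>"
  proof eventually_elim
    case (elim v)
    have "f v * g v - f u * g u = (f v - f u) * g v + f u * (g v - g u)" by (simp add: algebra_simps)
    then have "\<bar>f v * g v - f u * g u\<bar> \<le> \<bar>f v - f u\<bar> * \<bar>g v\<bar> + \<bar>f u\<bar> * \<bar>g v - g u\<bar>"
      by (metis abs_mult abs_triangle_ineq)
    also have "\<dots> \<le> (L * \<bar>v - u\<bar>) * (\<bar>g u\<bar> + 1) + \<bar>f u\<bar> * (K * \<bar>v - u\<bar>)"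
      using elim L(1) by (intro add_mono mult_mono mult_left_mono) auto
    finally show ?case by (simp add: algebra_simps)
  qed
  then show ?thesis by (auto simp: calm_at_def)
qed

lemma calm_at_stable_scale:
  assumes cd: "1 < c" "d < 2" "\<And>t. \<alpha> t \<in> {c..d}"
    and \<alpha>: "(\<alpha> has_real_derivative D) (at u)" and b: "(b has_real_derivative D') (at u)"
  shows "calm_at (\<lambda>v. b v * stable_const (\<alpha> v) powr (1 / \<alpha> v)) u"
proof -
  have \<alpha>1: "1 < \<alpha> v" "\<alpha> v < 2" for v using cd(3)[of v] cd(1,2) by auto
  have pos: "0 < stable_integral (\<alpha> v)" for v by (rule stable_integral_pos[OF \<alpha>1])
  have "calm_at (\<lambda>v. stable_integral (\<alpha> v)) u"
  proof -
    obtain L where L: "\<And>a a'. a \<in> {c..d} \<Longrightarrow> a' \<in> {c..d} \<Longrightarrow>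
       \<bar>stable_integral a - stable_integral a'\<bar> \<le> L * \<bar>a - a'\<bar>"
      using stable_integral_lipschitz[OF cd(1,2)] by blast
    obtain K where K: "0 \<le> K" "\<forall>\<^sub>F v in nhds u. \<bar>\<alpha> v - \<alpha> u\<bar> \<le> K * \<bar>v - u\<bar>"
      using calm_at_DERIV[OF \<alpha>] by (rule calm_atE)
    from K(2) have "\<forall>\<^sub>F v in nhds u. \<bar>stable_integral (\<alpha> v) - stable_integral (\<alpha> u)\<bar> \<le> (\<bar>L\<bar> * K) * \<bar>v - u\<bar>"
    proof eventually_elim
      case (elim v)
      have "\<bar>stable_integral (\<alpha> v) - stable_integral (\<alpha> u)\<bar> \<le> \<bar>L\<bar> * \<bar>\<alpha> v - \<alpha> u\<bar>"
        using L[OF cd(3) cd(3), of v u] by (meson abs_ge_self abs_ge_zero mult_right_mono order_trans)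
      also have "\<dots> \<le> \<bar>L\<bar> * (K * \<bar>v - u\<bar>)" using elim by (intro mult_left_mono) auto
      finally show ?case by simp
    qed
    then show ?thesis by (auto simp: calm_at_def)
  qed
  from calm_at_compose[OF this DERIV_ln[OF pos]]
  have "calm_at (\<lambda>v. ln (stable_integral (\<alpha> v))) u" .
  moreover have "((\<lambda>v. - (1 / \<alpha> v)) has_real_derivative D / (\<alpha> u)\<^sup>2) (at u)"
    using \<alpha>1[of u] by (auto intro!: derivative_eq_intros \<alpha> simp: power2_eq_square)
  then have "calm_at (\<lambda>v. - (1 / \<alpha> v)) u" by (rule calm_at_DERIV)
  ultimately have "calm_at (\<lambda>v. - (1 / \<alpha> v) * ln (stable_integral (\<alpha> v))) u" by (rule calm_at_mult[rotated])
  from calm_at_mult[OF calm_at_DERIV[OF b] calm_at_compose[OF this DERIV_exp]]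
  have "calm_at (\<lambda>v. b v * exp (- (1 / \<alpha> v) * ln (stable_integral (\<alpha> v)))) u" .
  moreover have "stable_const (\<alpha> v) powr (1 / \<alpha> v) = exp (- (1 / \<alpha> v) * ln (stable_integral (\<alpha> v)))" for v
    using pos[of v] by (simp add: stable_const_eq powr_def ln_inverse)
  ultimately show ?thesis by simp
qed

text \<open>The exponents \<open>p\<close> and \<open>q\<close> are slightly outside \<open>[1 / d, 1 / c]\<close>. Since \<open>d < 2\<close>, there is room to keep
\<open>p > 1 / 2\<close>, and this makes \<open>\<Gamma>\<^sub>i powr - (2 * p)\<close> summable later.\<close>
lemma scaled_powr_calm:
  assumes cd: "1 < c" "d < 2" "\<And>t. \<alpha> t \<in> {c..d}"
    and \<alpha>: "(\<alpha> has_real_derivative D) (at u)" and B: "calm_at B u"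
  obtains p q K where "1/2 < p" "p \<le> q" "0 \<le> K"
    "\<forall>\<^sub>F v in nhds u. \<forall>z>0. \<bar>B v * z powr (1 / \<alpha> v) - B u * z powr (1 / \<alpha> u)\<bar> \<le> K * \<bar>v - u\<bar> * (z powr p + z powr q)"
proof -
  have \<alpha>1: "1 < \<alpha> v" "\<alpha> v < 2" "c \<le> \<alpha> v" "\<alpha> v \<le> d" for v using cd(3)[of v] cd(1,2) by auto
  have d: "1 < d" using \<alpha>1[of u] by linarith
  \<comment> \<open>The exponents may move by \<open>e\<close> and the smallest one still exceeds \<open>1 / 2\<close>.\<close>
  define e where "e = (1 / d - 1 / 2) / 2"
  have e: "0 < e" "1 / 2 < 1 / d - e" using cd(2) d by (auto simp: e_def field_simps)
  have \<beta>: "1 / d \<le> 1 / \<alpha> v" "1 / \<alpha> v \<le> 1 / c" for v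
    using \<alpha>1[of v] cd(1) by (auto intro!: divide_left_mono mult_pos_pos)
  have "((\<lambda>v. 1 / \<alpha> v) has_real_derivative - D / (\<alpha> u)\<^sup>2) (at u)"
    using \<alpha>1[of u] by (auto intro!: derivative_eq_intros \<alpha> simp: power2_eq_square)
  then obtain L where L: "0 \<le> L" "\<forall>\<^sub>F v in nhds u. \<bar>1 / \<alpha> v - 1 / \<alpha> u\<bar> \<le> L * \<bar>v - u\<bar>"
    by (rule calm_atE[OF calm_at_DERIV])
  obtain K where K: "0 \<le> K" "\<forall>\<^sub>F v in nhds u. \<bar>B v - B u\<bar> \<le> K * \<bar>v - u\<bar>"
    using B by (rule calm_atE)
  show ?thesis
  proof (rule that[of "1 / d - e" "1 / c + e" "K + \<bar>B u\<bar> * (4 / e * L)"])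
    show "1 / d - e \<le> 1 / c + e" using \<beta>[of u] e by linarith
    show "\<forall>\<^sub>F v in nhds u. \<forall>z>0. \<bar>B v * z powr (1 / \<alpha> v) - B u * z powr (1 / \<alpha> u)\<bar>
      \<le> (K + \<bar>B u\<bar> * (4 / e * L)) * \<bar>v - u\<bar> * (z powr (1 / d - e) + z powr (1 / c + e))"
      using L(2) K(2)
    proof eventually_elim
      case (elim v)
      show ?case
      proof (intro allI impI)
        fix z :: real assume z: "0 < z"
        define S where "S = z powr (1 / d - e) + z powr (1 / c + e)"
        have "B v * z powr (1 / \<alpha> v) - B u * z powr (1 / \<alpha> u) =
          (B v - B u) * z powr (1 / \<alpha> v) + B u * (z powr (1 / \<alpha> v) - z powr (1 / \<alpha> u))"
          by (simp add: algebra_simps)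
        also have "\<bar>\<dots>\<bar> \<le> \<bar>B v - B u\<bar> * z powr (1 / \<alpha> v) + \<bar>B u\<bar> * \<bar>z powr (1 / \<alpha> v) - z powr (1 / \<alpha> u)\<bar>"
          by (rule order_trans[OF abs_triangle_ineq]) (simp add: abs_mult)
        also have "\<dots> \<le> (K * \<bar>v - u\<bar>) * S + \<bar>B u\<bar> * ((4 / e) * \<bar>1 / \<alpha> v - 1 / \<alpha> u\<bar> * S)"
          using elim \<beta>[of v] \<beta>[of u] e K(1)
          unfolding S_def by (intro add_mono mult_mono mult_left_mono powr_le_sum powr_exponent_diff_le z) auto
        also have "\<dots> \<le> (K * \<bar>v - u\<bar>) * S + \<bar>B u\<bar> * ((4 / e) * (L * \<bar>v - u\<bar>) * S)"
          using elim e unfolding S_def by (intro add_left_mono mult_left_mono mult_right_mono) auto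
        also have "\<dots> = (K + \<bar>B u\<bar> * (4 / e * L)) * \<bar>v - u\<bar> * S"
          by (simp add: distrib_right distrib_left mult_ac)
        finally show "\<bar>B v * z powr (1 / \<alpha> v) - B u * z powr (1 / \<alpha> u)\<bar>
          \<le> (K + \<bar>B u\<bar> * (4 / e * L)) * \<bar>v - u\<bar> * (z powr (1 / d - e) + z powr (1 / c + e))"
          unfolding S_def .
      qed
    qed
  qed (use e L K in auto)
qed

section \<open>Joint independence and freezing of variables\<close>

text \<open>An event about finitely many entries of the array is an intersection, over finitely many rows, of cylinder
events; independence between the rows and then within each row factorises its probability.\<close>
lemma (in prob_space) indep_vars_pairs:
  fixes X :: "'k \<Rightarrow> 'i \<Rightarrow> 'a \<Rightarrow> 'b" and N :: "'b measure"
  assumes rows: "indep_vars (\<lambda>_. \<Pi>\<^sub>M i\<in>UNIV. N) (\<lambda>k \<omega> i. X k i \<omega>) K"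
    and row: "\<And>k. k \<in> K \<Longrightarrow> indep_vars (\<lambda>_. N) (X k) UNIV"
  shows "indep_vars (\<lambda>_. N) (\<lambda>j. X (fst j) (snd j)) (K \<times> UNIV)"
proof -
  have rv[measurable]: "X k i \<in> measurable M N" if "k \<in> K" for k i
    using row[OF that] by (auto simp: indep_vars_def2)
  show ?thesis unfolding indep_vars_def2
  proof (intro conjI ballI indep_setsI)
    fix j assume "j \<in> K \<times> (UNIV :: 'i set)"
    then have j: "fst j \<in> K" by auto
    from rv[OF this] show "X (fst j) (snd j) \<in> measurable M N" .
    show "{X (fst j) (snd j) -` A \<inter> space M |A. A \<in> sets N} \<subseteq> events"
      using rv[OF j, of "snd j"] by auto
  next
    fix A and J :: "('k \<times> 'i) set"
    assume J: "J \<noteq> {}" "J \<subseteq> K \<times> UNIV" "finite J"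
      and A: "\<forall>j\<in>J. A j \<in> {X (fst j) (snd j) -` A \<inter> space M |A. A \<in> sets N}"
    from A have "\<forall>j\<in>J. \<exists>B. B \<in> sets N \<and> A j = X (fst j) (snd j) -` B \<inter> space M" by blast
    from bchoice[OF this] obtain B where
      B: "\<And>j. j \<in> J \<Longrightarrow> B j \<in> sets N" "\<And>j. j \<in> J \<Longrightarrow> A j = X (fst j) (snd j) -` B j \<inter> space M"
      by blast
    define J' where "J' k = {i. (k, i) \<in> J}" for k
    have J': "J = Sigma (fst ` J) J'" by (force simp: J'_def)
    have J'_eq: "J' k = snd ` (J \<inter> {k} \<times> UNIV)" for k by (force simp: J'_def)
    have finJ': "finite (J' k)" for k unfolding J'_eq using J(3) by auto
    have J'_ne: "J' k \<noteq> {}" if "k \<in> fst ` J" for k using that by (force simp: J'_def)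
    have kK: "k \<in> K" if "k \<in> fst ` J" for k using that J(2) by auto
    define C where "C k = {f \<in> space (\<Pi>\<^sub>M i\<in>UNIV. N). \<forall>i\<in>J' k. f i \<in> B (k, i)}" for k
    have Cs: "C k \<in> sets (\<Pi>\<^sub>M i\<in>(UNIV :: 'i set). N)" for k
      unfolding C_def
    proof (rule sets.sets_Collect_finite_All[OF _ finJ'])
      fix i assume "i \<in> J' k"
      then have "B (k, i) \<in> sets N" by (intro B) (simp add: J'_def)
      then show "{f \<in> space (\<Pi>\<^sub>M i\<in>UNIV. N). f i \<in> B (k, i)} \<in> sets (\<Pi>\<^sub>M i\<in>(UNIV :: 'i set). N)"
        by measurable
    qed
    have vim: "(\<lambda>\<omega> i. X k i \<omega>) -` C k \<inter> space M = (\<Inter>i\<in>J' k. X k i -` B (k, i) \<inter> space M)"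
      if k: "k \<in> fst ` J" for k
      using J'_ne[OF k] measurable_space[OF rv[OF kK[OF k]]]
      by (auto simp: C_def space_PiM)
    have "(\<Inter>j\<in>J. A j) = (\<Inter>j\<in>J. X (fst j) (snd j) -` B j \<inter> space M)" using B by auto
    also have "\<dots> = (\<Inter>k\<in>fst ` J. (\<lambda>\<omega> i. X k i \<omega>) -` C k \<inter> space M)"
    proof -
      have "(\<Inter>j\<in>J. X (fst j) (snd j) -` B j \<inter> space M) = (\<Inter>k\<in>fst ` J. \<Inter>i\<in>J' k. X k i -` B (k, i) \<inter> space M)"
      proof (intro equalityI subsetI INT_I)
        fix x k i assume "x \<in> (\<Inter>j\<in>J. X (fst j) (snd j) -` B j \<inter> space M)" "k \<in> fst ` J" "i \<in> J' k"
        then have "(k, i) \<in> J" and "\<forall>j\<in>J. x \<in> X (fst j) (snd j) -` B j \<inter> space M"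
          unfolding J'_def by blast+
        then have "x \<in> X (fst (k, i)) (snd (k, i)) -` B (k, i) \<inter> space M" by blast
        then show "x \<in> X k i -` B (k, i) \<inter> space M" by simp
      next
        fix x j assume x: "x \<in> (\<Inter>k\<in>fst ` J. \<Inter>i\<in>J' k. X k i -` B (k, i) \<inter> space M)" and j: "j \<in> J"
        then have "fst j \<in> fst ` J" "snd j \<in> J' (fst j)" by (auto simp: J'_def)
        with x have "x \<in> X (fst j) (snd j) -` B (fst j, snd j) \<inter> space M" by blast
        then show "x \<in> X (fst j) (snd j) -` B j \<inter> space M" by simp
      qed
      also have "\<dots> = (\<Inter>k\<in>fst ` J. (\<lambda>\<omega> i. X k i \<omega>) -` C k \<inter> space M)"
        by (intro INF_cong refl vim[symmetric])
      finally show ?thesis .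
    qed
    also have "prob \<dots> = (\<Prod>k\<in>fst ` J. prob ((\<lambda>\<omega> i. X k i \<omega>) -` C k \<inter> space M))"
      using J Cs kK by (intro indep_varsD[OF rows]) auto
    also have "\<dots> = (\<Prod>k\<in>fst ` J. \<Prod>i\<in>J' k. prob (X k i -` B (k, i) \<inter> space M))"
    proof (intro prod.cong refl)
      fix k assume k: "k \<in> fst ` J"
      have "prob (\<Inter>i\<in>J' k. X k i -` B (k, i) \<inter> space M) = (\<Prod>i\<in>J' k. prob (X k i -` B (k, i) \<inter> space M))"
        using J'_ne[OF k] finJ' by (intro indep_varsD[OF row[OF kK[OF k]]]) (auto simp: J'_def intro: B)
      then show "prob ((\<lambda>\<omega> i. X k i \<omega>) -` C k \<inter> space M) = (\<Prod>i\<in>J' k. prob (X k i -` B (k, i) \<inter> space M))"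
        by (simp only: vim[OF k])
    qed
    also have "\<dots> = (\<Prod>(k, i)\<in>Sigma (fst ` J) J'. prob (X k i -` B (k, i) \<inter> space M))"
      using J(3) finJ' by (intro prod.Sigma) auto
    also have "\<dots> = (\<Prod>j\<in>J. prob (A j))"
      unfolding J'[symmetric] by (intro prod.cong) (auto simp: B)
    finally show "prob (\<Inter>j\<in>J. A j) = (\<Prod>j\<in>J. prob (A j))" .
  qed
qed

text \<open>The \<open>\<sigma>\<close>-algebra generated by \<open>X j\<close>, \<open>j \<in> K\<close>, as a measure space of its own; the measurability
prover can then establish what is determined by these variables.\<close>
definition gen_algebra :: "'a measure \<Rightarrow> ('j \<Rightarrow> 'a \<Rightarrow> real) \<Rightarrow> 'j set \<Rightarrow> 'a measure" where
  "gen_algebra M X K = vimage_algebra (space M) (\<lambda>\<omega>. \<lambda>j\<in>K. X j \<omega>) (\<Pi>\<^sub>M j\<in>K. borel)"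

lemma space_gen_algebra[simp]: "space (gen_algebra M X K) = space M"
  by (simp add: gen_algebra_def)

lemma measurable_gen_algebra: "j \<in> K \<Longrightarrow> X j \<in> borel_measurable (gen_algebra M X K)"
proof -
  assume j: "j \<in> K"
  have "(\<lambda>\<omega>. \<lambda>j\<in>K. X j \<omega>) \<in> measurable (gen_algebra M X K) (\<Pi>\<^sub>M j\<in>K. borel)"
    unfolding gen_algebra_def by (rule measurable_vimage_algebra1) (auto simp: space_PiM)
  from measurable_compose[OF this measurable_component_singleton[OF j]] show ?thesis
    using j by simp
qed

lemma sets_gen_algebra:
  "sets (gen_algebra M X K) = {(\<lambda>\<omega>. \<lambda>j\<in>K. X j \<omega>) -` A \<inter> space M |A. A \<in> sets (\<Pi>\<^sub>M j\<in>K. borel)}"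
  unfolding gen_algebra_def by (rule sets_vimage_algebra2) (auto simp: space_PiM)

lemma gen_algebra_measurableD:
  assumes X: "\<And>j. j \<in> K \<Longrightarrow> X j \<in> borel_measurable M" and f: "f \<in> measurable (gen_algebra M X K) N"
  shows "f \<in> measurable M N"
proof -
  have "sets (gen_algebra M X K) \<subseteq> sets M"
    unfolding sets_gen_algebra using X by (auto intro!: measurable_sets)
  then show ?thesis
    using f measurable_mono[of N N "gen_algebra M X K" M] by auto
qed

lemma gen_algebra_mono:
  assumes "K \<subseteq> L" "f \<in> measurable (gen_algebra M X K) N"
  shows "f \<in> measurable (gen_algebra M X L) N"
proof -
  have "sets (gen_algebra M X K) = sets (gen_algebra (gen_algebra M X L) X K)"
    by (simp add: sets_gen_algebra)
  then have "f \<in> measurable (gen_algebra (gen_algebra M X L) X K) N"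
    using assms(2) by (simp cong: measurable_cong_sets)
  then show ?thesis
    by (rule gen_algebra_measurableD[rotated]) (use assms(1) in \<open>auto intro: measurable_gen_algebra\<close>)
qed

lemma (in prob_space) distr_pair_gen_algebra:
  assumes ind: "indep_vars (\<lambda>_. borel) X I" and K: "K \<subseteq> I" and j: "j \<in> I" "j \<notin> K"
    and Y: "Y \<in> measurable (gen_algebra M X K) N"
  shows "distr M N Y \<Otimes>\<^sub>M distr M borel (X j) = distr M (N \<Otimes>\<^sub>M borel) (\<lambda>\<omega>. (Y \<omega>, X j \<omega>))"
proof -
  have rv: "X i \<in> borel_measurable M" if "i \<in> I" for i
    using ind that by (auto simp: indep_vars_def2)
  have Xj[measurable]: "X j \<in> borel_measurable M" using j by (intro rv)
  have Ym[measurable]: "Y \<in> measurable M N"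
    by (rule gen_algebra_measurableD[OF rv Y]) (use K in auto)
  let ?R = "\<lambda>K \<omega>. \<lambda>i\<in>K. X i \<omega>"
  have "indep_var (\<Pi>\<^sub>M i\<in>K. borel) (?R K) (\<Pi>\<^sub>M i\<in>{j}. borel) (?R {j})"
    using indep_var_restrict[OF ind, of K "{j}"] K j by simp
  then have isd: "indep_set (sigma_sets (space M) (sets (gen_algebra M X K)))
       (sigma_sets (space M) (sets (gen_algebra M X {j})))"
    unfolding indep_var_eq sets_gen_algebra by simp
  interpret Y: prob_space "distr M N Y" by (rule prob_space_distr) fact
  interpret Z: prob_space "distr M borel (X j)" by (rule prob_space_distr) fact
  show ?thesis
  proof (rule pair_measure_eqI)
    show "sigma_finite_measure (distr M N Y)" "sigma_finite_measure (distr M borel (X j))"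
      by unfold_locales
    show "sets (distr M N Y \<Otimes>\<^sub>M distr M borel (X j)) = sets (distr M (N \<Otimes>\<^sub>M borel) (\<lambda>\<omega>. (Y \<omega>, X j \<omega>)))"
      by (simp cong: sets_pair_measure_cong)
    fix A B assume "A \<in> sets (distr M N Y)" "B \<in> sets (distr M borel (X j))"
    then have AB[measurable]: "A \<in> sets N" "B \<in> sets borel" by auto
    have "Y -` A \<inter> space M \<in> sets (gen_algebra M X K)"
      using measurable_sets[OF Y AB(1)] by simp
    moreover have "X j -` B \<inter> space M \<in> sets (gen_algebra M X {j})"
      using measurable_sets[OF measurable_gen_algebra[of j "{j}" X M] AB(2)] by simp
    ultimately have "prob ((Y -` A \<inter> space M) \<inter> (X j -` B \<inter> space M)) =
        prob (Y -` A \<inter> space M) * prob (X j -` B \<inter> space M)"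
      using isd unfolding indep_sets2_eq by blast
    moreover have "(\<lambda>\<omega>. (Y \<omega>, X j \<omega>)) -` (A \<times> B) \<inter> space M = (Y -` A \<inter> space M) \<inter> (X j -` B \<inter> space M)"
      by auto
    ultimately show "emeasure (distr M N Y) A * emeasure (distr M borel (X j)) B =
        emeasure (distr M (N \<Otimes>\<^sub>M borel) (\<lambda>\<omega>. (Y \<omega>, X j \<omega>))) (A \<times> B)"
      by (simp add: emeasure_distr emeasure_eq_measure ennreal_mult')
  qed
qed

text \<open>Fubini's theorem for a function of an independent pair. It takes the place of conditional expectations given
the variables in \<open>K\<close>.\<close>
lemma (in prob_space) expectation_freeze:
  fixes f :: "'b \<times> real \<Rightarrow> real"
  assumes ind: "indep_vars (\<lambda>_. borel) X I" and K: "K \<subseteq> I" and j: "j \<in> I" "j \<notin> K"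
    and Y: "Y \<in> measurable (gen_algebra M X K) N"
    and f[measurable]: "f \<in> borel_measurable (N \<Otimes>\<^sub>M borel)" and bd: "\<And>x. \<bar>f x\<bar> \<le> C"
  shows "expectation (\<lambda>\<omega>. f (Y \<omega>, X j \<omega>)) = expectation (\<lambda>\<omega>. \<integral>z. f (Y \<omega>, z) \<partial>distr M borel (X j))"
proof -
  note eq = distr_pair_gen_algebra[OF ind K j Y]
  have rv: "X i \<in> borel_measurable M" if "i \<in> I" for i
    using ind that by (auto simp: indep_vars_def2)
  have Z[measurable]: "X j \<in> borel_measurable M" using j by (intro rv)
  have Ym[measurable]: "Y \<in> measurable M N"
    by (rule gen_algebra_measurableD[OF rv Y]) (use K in auto)
  interpret Y: prob_space "distr M N Y" by (rule prob_space_distr) fact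
  interpret Z: prob_space "distr M borel (X j)" by (rule prob_space_distr) fact
  interpret YZ: pair_prob_space "distr M N Y" "distr M borel (X j)" ..
  have "expectation (\<lambda>\<omega>. f (Y \<omega>, X j \<omega>)) = (\<integral>x. f x \<partial>distr M (N \<Otimes>\<^sub>M borel) (\<lambda>x. (Y x, X j x)))"
    by (subst integral_distr) auto
  also have "\<dots> = (\<integral>y. \<integral>z. f (y, z) \<partial>distr M borel (X j) \<partial>distr M N Y)"
    unfolding eq[symmetric]
  proof (rule YZ.integral_fst'[symmetric])
    show "integrable (distr M N Y \<Otimes>\<^sub>M distr M borel (X j)) f"
      by (rule YZ.integrable_const_bound[where B=C]) (use bd in auto)
  qed
  also have "\<dots> = expectation (\<lambda>\<omega>. \<integral>z. f (Y \<omega>, z) \<partial>distr M borel (X j))"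
  proof (rule integral_distr[OF Ym])
    show "(\<lambda>y. \<integral>z. f (y, z) \<partial>distr M borel (X j)) \<in> borel_measurable N"
      by measurable
  qed
  finally show ?thesis .
qed

section \<open>Arrival times, marks and signs\<close>

locale lepage = prob_space M for M :: "'a measure" +
  fixes \<Gamma> V \<gamma> :: "nat \<Rightarrow> 'a \<Rightarrow> real"
  assumes arrival: "poisson_arrival_times \<Gamma>" and blocks: "iid_dyadic_blocks V"
    and signs: "iid_signs \<gamma>" and indep3: "indep_sequences3 \<Gamma> V \<gamma>"
begin

definition W :: "nat \<Rightarrow> 'a \<Rightarrow> real" where
  "W i \<omega> = (case i of 0 \<Rightarrow> \<Gamma> 0 \<omega> | Suc k \<Rightarrow> \<Gamma> (Suc k) \<omega> - \<Gamma> k \<omega>)"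

lemma W_indep: "indep_vars (\<lambda>_. borel) W UNIV"
  and W_distributed: "distributed M lborel (W i) (exponential_density 1)"
  using arrival unfolding poisson_arrival_times_def Let_def W_def[abs_def] by auto

lemma V_indep: "indep_vars (\<lambda>_. borel) V UNIV"
  and V_distributed: "distributed M lborel (V i) dyadic_block_density"
  using blocks unfolding iid_dyadic_blocks_def by auto

lemma sign_indep: "indep_vars (\<lambda>_. borel) \<gamma> UNIV"
  and prob_sign: "prob {\<omega>\<in>space M. \<gamma> i \<omega> = 1} = 1/2" "prob {\<omega>\<in>space M. \<gamma> i \<omega> = -1} = 1/2"
  using signs unfolding iid_signs_def by auto

lemma W_measurable[measurable]: "W i \<in> borel_measurable M"
  using W_indep by (auto simp: indep_vars_def2)

lemma V_measurable[measurable]: "V i \<in> borel_measurable M"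
  using V_indep by (auto simp: indep_vars_def2)

lemma sign_measurable[measurable]: "\<gamma> i \<in> borel_measurable M"
  using sign_indep by (auto simp: indep_vars_def2)

lemma arrival_eq_sum: "\<Gamma> n \<omega> = (\<Sum>i\<le>n. W i \<omega>)"
  by (induction n) (auto simp: W_def)

lemma arrival_eq_sum': "\<Gamma> n = (\<lambda>\<omega>. \<Sum>i\<le>n. W i \<omega>)"
  by (rule ext) (rule arrival_eq_sum)

lemma arrival_measurable[measurable]: "\<Gamma> n \<in> borel_measurable M"
  by (subst arrival_eq_sum') measurable

text \<open>Waiting times, marks and signs as a single independent family: the first index is the kind of the variable (0, 1 or
2), the second one its position in the sequence.\<close>
definition \<xi> :: "nat \<times> nat \<Rightarrow> 'a \<Rightarrow> real" where
  "\<xi> j = ([W, V, \<gamma>] ! fst j) (snd j)"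

lemma \<xi>_simps: "\<xi> (0, i) = W i" "\<xi> (Suc 0, i) = V i" "\<xi> (2, i) = \<gamma> i"
  by (simp_all add: \<xi>_def)

lemma \<xi>_indep: "indep_vars (\<lambda>_. borel) \<xi> ({..<3} \<times> UNIV)"
proof -
  define Z where "Z k = [W, V, \<gamma>] ! k" for k
  have "indep_vars (\<lambda>_. borel) (\<lambda>j. Z (fst j) (snd j)) ({..<3} \<times> UNIV)"
  proof (rule indep_vars_pairs)
    fix k :: nat assume "k \<in> {..<3}"
    then have "k \<in> {0, 1, 2}" by auto
    then show "indep_vars (\<lambda>_. borel) (Z k) UNIV"
      using W_indep V_indep sign_indep by (auto simp: Z_def)
  next
    define T where "T k f = (if k = (0::nat) then (\<lambda>i. case i of 0 \<Rightarrow> f 0 | Suc n \<Rightarrow> f (Suc n) - f n) else f)"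
      for k and f :: "nat \<Rightarrow> real"
    have T: "T k \<in> measurable (\<Pi>\<^sub>M i\<in>UNIV. borel) (\<Pi>\<^sub>M i\<in>UNIV. borel)" for k
    proof (cases "k = 0")
      case True
      have "(\<lambda>f :: nat \<Rightarrow> real. case i of 0 \<Rightarrow> f 0 | Suc n \<Rightarrow> f (Suc n) - f n) \<in> borel_measurable (\<Pi>\<^sub>M i\<in>UNIV. borel)" for i :: nat
      proof (cases i)
        case (Suc n)
        then show ?thesis by simp
      qed (simp add: measurable_component_singleton)
      then show ?thesis using True by (auto simp: T_def[abs_def] intro!: measurable_PiM_single')
    qed (simp add: T_def[abs_def])
    have "indep_vars (\<lambda>_. \<Pi>\<^sub>M i\<in>UNIV. borel) (\<lambda>k \<omega>. T k (\<lambda>i. ([\<Gamma>, V, \<gamma>] ! k) i \<omega>)) {..<3}"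
      using indep3 T unfolding indep_sequences3_def by (rule indep_vars_compose2)
    also have "?this \<longleftrightarrow> indep_vars (\<lambda>_. \<Pi>\<^sub>M i\<in>UNIV. borel) (\<lambda>k \<omega> i. Z k i \<omega>) {..<3}"
    proof (rule indep_vars_cong)
      fix k :: nat assume "k \<in> {..<3}"
      then have "k \<in> {0, 1, 2}" by auto
      then show "(\<lambda>\<omega>. T k (\<lambda>i. ([\<Gamma>, V, \<gamma>] ! k) i \<omega>)) = (\<lambda>\<omega> i. Z k i \<omega>)"
        by (auto simp: T_def Z_def W_def fun_eq_iff split: nat.splits)
    qed auto
    finally show "indep_vars (\<lambda>_. \<Pi>\<^sub>M i\<in>UNIV. borel) (\<lambda>k \<omega> i. Z k i \<omega>) {..<3}" .
  qed
  then show ?thesis unfolding \<xi>_def[abs_def] Z_def .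
qed

lemma \<xi>_measurable: "j \<in> {..<3} \<times> UNIV \<Longrightarrow> \<xi> j \<in> borel_measurable M"
  using \<xi>_indep by (auto simp: indep_vars_def2)

text \<open>What is known once all arrival times, all marks and the first \<open>n\<close> signs have been revealed.\<close>
definition marks :: "nat \<Rightarrow> 'a measure" where
  "marks n = gen_algebra M \<xi> ({0, 1} \<times> UNIV \<union> {2} \<times> {..<n})"

lemma marks_measurable[measurable]:
  "W i \<in> borel_measurable (marks n)" "V i \<in> borel_measurable (marks n)" "\<Gamma> i \<in> borel_measurable (marks n)"
proof -
  show W[measurable]: "W i \<in> borel_measurable (marks n)" for i
    using measurable_gen_algebra[of "(0, i)" "{0, 1} \<times> UNIV \<union> {2} \<times> {..<n}" \<xi> M]
    by (simp add: marks_def \<xi>_simps)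
  show "V i \<in> borel_measurable (marks n)"
    using measurable_gen_algebra[of "(1, i)" "{0, 1} \<times> UNIV \<union> {2} \<times> {..<n}" \<xi> M]
    by (simp add: marks_def \<xi>_simps)
  show "\<Gamma> i \<in> borel_measurable (marks n)"
    by (subst arrival_eq_sum') measurable
qed

lemma marks_sign_measurable: "i < n \<Longrightarrow> \<gamma> i \<in> borel_measurable (marks n)"
  using measurable_gen_algebra[of "(2, i)" "{0, 1} \<times> UNIV \<union> {2} \<times> {..<n}" \<xi> M]
  by (simp add: marks_def \<xi>_simps)

lemma marks_mono: "f \<in> measurable (marks 0) N \<Longrightarrow> f \<in> measurable (marks n) N"
  unfolding marks_def by (rule gen_algebra_mono) auto

lemma marksD: "f \<in> measurable (marks n) N \<Longrightarrow> f \<in> measurable M N"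
  unfolding marks_def by (rule gen_algebra_measurableD[of "{0, 1} \<times> UNIV \<union> {2} \<times> {..<n}" \<xi>])
    (auto intro!: \<xi>_measurable)

lemma space_marks[simp]: "space (marks n) = space M" by (simp add: marks_def)

lemma AE_sign: "AE \<omega> in M. \<gamma> i \<omega> = 1 \<or> \<gamma> i \<omega> = -1"
proof -
  have "prob {\<omega>\<in>space M. \<gamma> i \<omega> = 1 \<or> \<gamma> i \<omega> = -1} =
    prob ({\<omega>\<in>space M. \<gamma> i \<omega> = 1} \<union> {\<omega>\<in>space M. \<gamma> i \<omega> = -1})"
    by (intro arg_cong[where f=prob]) auto
  also have "\<dots> = 1"
    by (subst finite_measure_Union) (auto simp: prob_sign)
  finally show ?thesis by (subst (asm) prob_Collect_eq_1) auto
qed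

text \<open>The next sign has mean 0 and is independent of everything in \<open>marks n\<close>.\<close>
lemma sign_orthogonal:
  assumes Y: "Y \<in> borel_measurable (marks n)" and bd: "\<And>\<omega>. \<bar>Y \<omega>\<bar> \<le> C"
  shows "integrable M (\<lambda>\<omega>. \<gamma> n \<omega> * Y \<omega>)" "expectation (\<lambda>\<omega>. \<gamma> n \<omega> * Y \<omega>) = 0"
proof -
  note Ym[measurable] = marksD[OF Y]
  have C: "0 \<le> C" using bd[of undefined] by linarith
  show "integrable M (\<lambda>\<omega>. \<gamma> n \<omega> * Y \<omega>)"
  proof (rule integrable_const_bound)
    show "AE \<omega> in M. norm (\<gamma> n \<omega> * Y \<omega>) \<le> C"
      using AE_sign[of n] by eventually_elim (use bd in \<open>auto simp: abs_mult\<close>)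
  qed simp
  \<comment> \<open>Truncation turns the product into a bounded function of the pair and changes it only on a null set.\<close>
  define clip where "clip K x = min K (max (- K) x)" for K x :: real
  have clip_bd: "\<bar>clip K x\<bar> \<le> K" if "0 \<le> K" for K x using that by (auto simp: clip_def)
  have [measurable]: "clip K \<in> borel_measurable borel" for K unfolding clip_def[abs_def] by measurable
  have clipY: "clip C (Y \<omega>) = Y \<omega>" for \<omega> using bd[of \<omega>] by (auto simp: clip_def)
  have "expectation (\<lambda>\<omega>. \<gamma> n \<omega> * Y \<omega>) = expectation (\<lambda>\<omega>. (\<lambda>(y, z). clip C y * clip 1 z) (Y \<omega>, \<xi> (2, n) \<omega>))"
  proof (rule integral_cong_AE)
    show "AE \<omega> in M. \<gamma> n \<omega> * Y \<omega> = (\<lambda>(y, z). clip C y * clip 1 z) (Y \<omega>, \<xi> (2, n) \<omega>)"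
      using AE_sign[of n] by eventually_elim (auto simp: \<xi>_simps clipY, auto simp: clip_def)
  qed (auto simp: \<xi>_simps)
  also have "\<dots> = expectation (\<lambda>\<omega>. \<integral>z. (\<lambda>(y, z). clip C y * clip 1 z) (Y \<omega>, z) \<partial>distr M borel (\<xi> (2, n)))"
  proof (rule expectation_freeze[OF \<xi>_indep _ _ _ Y[unfolded marks_def], where C = C])
    fix x :: "real \<times> real"
    show "\<bar>(\<lambda>(y, z). clip C y * clip 1 z) x\<bar> \<le> C"
      using mult_mono[OF clip_bd[of C "fst x"] clip_bd[of 1 "snd x"]] C
      by (simp add: abs_mult split_beta)
  qed auto
  also have "\<dots> = expectation (\<lambda>\<omega>. Y \<omega> * (\<integral>z. clip 1 z \<partial>distr M borel (\<gamma> n)))"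
    by (simp add: \<xi>_simps clipY)
  also have "(\<integral>z. clip 1 z \<partial>distr M borel (\<gamma> n)) = expectation (\<lambda>\<omega>. clip 1 (\<gamma> n \<omega>))"
    by (rule integral_distr) auto
  also have "\<dots> = expectation (\<lambda>\<omega>. indicator {\<omega>\<in>space M. \<gamma> n \<omega> = 1} \<omega> - indicator {\<omega>\<in>space M. \<gamma> n \<omega> = -1} \<omega>)"
  proof (rule integral_cong_AE)
    show "AE \<omega> in M. clip 1 (\<gamma> n \<omega>) =
      indicator {\<omega>\<in>space M. \<gamma> n \<omega> = 1} \<omega> - indicator {\<omega>\<in>space M. \<gamma> n \<omega> = -1} \<omega>"
      using AE_sign[of n] AE_space by eventually_elim (auto simp: clip_def)
  qed auto
  also have "\<dots> = 0"
  proof -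
    have "integrable M (indicator {\<omega>\<in>space M. \<gamma> n \<omega> = e} :: 'a \<Rightarrow> real)" for e
      by (rule integrable_const_bound[where B=1]) auto
    then show ?thesis by (subst Bochner_Integration.integral_diff) (auto simp: prob_sign)
  qed
  finally show "expectation (\<lambda>\<omega>. \<gamma> n \<omega> * Y \<omega>) = 0" by simp
qed

lemma arrival_distributed: "distributed M lborel (\<Gamma> n) (erlang_density n 1)"
proof -
  have "distributed M lborel (\<lambda>x. \<Sum>i\<in>{..n}. W i x) (erlang_density (card {..n} - 1) 1)"
    using W_indep W_distributed
    by (intro exponential_distributed_sum) (auto intro: indep_vars_subset)
  then show ?thesis by (subst arrival_eq_sum') simp
qed

text \<open>The intensity of a unit-rate Poisson process is Lebesgue measure: for \<open>x \<ge> 0\<close> the Erlang densities are the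
Poisson weights \<open>x ^ n * exp (- x) / fact n\<close>.\<close>
lemma suminf_erlang_density:
  fixes x :: real
  shows "(\<Sum>n. ennreal (erlang_density n 1 x)) = indicator {0..} x"
proof (cases "x < 0")
  case False
  have "(\<lambda>n. x ^ n /\<^sub>R fact n) sums exp x" by (rule exp_converges)
  from sums_mult2[OF this, of "exp (- x)"]
  have "(\<lambda>n. erlang_density n 1 x) sums 1"
    using False by (simp add: erlang_density_def exp_minus divide_inverse mult_ac)
  then have "(\<Sum>n. ennreal (erlang_density n 1 x)) = ennreal 1"
    using False by (intro suminf_ennreal_eq) (auto simp: erlang_density_def)
  then show ?thesis using False by simp
qed (simp add: erlang_density_def)

lemma campbell:
  assumes [measurable]: "g \<in> borel_measurable borel"
  shows "(\<integral>\<^sup>+\<omega>. (\<Sum>n. g (\<Gamma> n \<omega>)) \<partial>M) = (\<integral>\<^sup>+x. indicator {0..} x * g x \<partial>lborel)"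
proof -
  have "(\<integral>\<^sup>+\<omega>. (\<Sum>n. g (\<Gamma> n \<omega>)) \<partial>M) = (\<Sum>n. \<integral>\<^sup>+\<omega>. g (\<Gamma> n \<omega>) \<partial>M)"
    by (intro nn_integral_suminf) measurable
  also have "\<dots> = (\<Sum>n. \<integral>\<^sup>+x. erlang_density n 1 x * g x \<partial>lborel)"
    by (intro suminf_cong distributed_nn_integral[OF arrival_distributed, symmetric]) simp
  also have "\<dots> = (\<integral>\<^sup>+x. (\<Sum>n. erlang_density n 1 x * g x) \<partial>lborel)"
    by (intro nn_integral_suminf[symmetric]) measurable
  also have "\<dots> = (\<integral>\<^sup>+x. indicator {0..} x * g x \<partial>lborel)"
    by (simp add: ennreal_suminf_multc suminf_erlang_density)
  finally show ?thesis .
qed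

lemma AE_summable_arrival_nn:
  fixes g :: "real \<Rightarrow> real"
  assumes [measurable]: "g \<in> borel_measurable borel" and g: "\<And>x. 0 \<le> g x"
    and fin: "(\<integral>\<^sup>+x. indicator {0..} x * ennreal (g x) \<partial>lborel) < \<infinity>"
  shows "AE \<omega> in M. summable (\<lambda>n. g (\<Gamma> n \<omega>))"
proof -
  have "AE \<omega> in M. (\<Sum>n. ennreal (g (\<Gamma> n \<omega>))) \<noteq> \<infinity>"
    using fin campbell[of "\<lambda>x. ennreal (g x)"] by (intro nn_integral_PInf_AE) auto
  then show ?thesis
  proof eventually_elim
    case (elim \<omega>)
    then show ?case using g by (intro summable_suminf_not_top) auto
  qed
qed

text \<open>Campbell's formula bounds the sum over the arrivals after time 1; only finitely many arrivals come before,
since their expected number is 1. Hence the behaviour of \<open>g\<close> at 0 does not matter.\<close>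
lemma AE_summable_arrival:
  fixes g :: "real \<Rightarrow> real"
  assumes [measurable]: "g \<in> borel_measurable borel" and g: "\<And>x. 0 \<le> g x"
    and fin: "integrable lborel (\<lambda>x. indicator {1..} x * g x)"
  shows "AE \<omega> in M. summable (\<lambda>n. g (\<Gamma> n \<omega>))"
proof -
  have "(\<integral>\<^sup>+x. indicator {0..} x * ennreal (indicator {..<1::real} x) \<partial>lborel) =
    (\<integral>\<^sup>+x. indicator {0..<1::real} x \<partial>lborel)"
    by (intro nn_integral_cong) (auto simp: indicator_def)
  then have 1: "AE \<omega> in M. summable (\<lambda>n. indicator {..<1} (\<Gamma> n \<omega>) :: real)"
    by (intro AE_summable_arrival_nn) auto
  have "(\<integral>\<^sup>+x. indicator {0..} x * ennreal (indicator {1..} x * g x) \<partial>lborel) =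
    (\<integral>\<^sup>+x. ennreal (indicator {1..} x * g x) \<partial>lborel)"
    by (intro nn_integral_cong) (auto simp: indicator_def)
  also have "\<dots> < \<infinity>"
    using fin g by (simp add: integrable_iff_bounded)
  finally have 2: "AE \<omega> in M. summable (\<lambda>n. indicator {1..} (\<Gamma> n \<omega>) * g (\<Gamma> n \<omega>))"
    using g by (intro AE_summable_arrival_nn) auto
  from 1 2 show ?thesis
  proof eventually_elim
    case (elim \<omega>)
    have "(\<lambda>n. indicator {..<1} (\<Gamma> n \<omega>) :: real) \<longlonglongrightarrow> 0"
      using elim(1) by (rule summable_LIMSEQ_zero)
    then have "\<forall>\<^sub>F n in sequentially. indicator {..<1} (\<Gamma> n \<omega>) < (1::real)"
      by (rule order_tendstoD) simp
    then have "\<forall>\<^sub>F n in sequentially. indicator {1..} (\<Gamma> n \<omega>) * g (\<Gamma> n \<omega>) = g (\<Gamma> n \<omega>)"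
      by eventually_elim (auto simp: indicator_def split: if_splits)
    from summable_cong[OF this] elim(2) show ?case by simp
  qed
qed

lemma AE_summable_arrival_powr:
  assumes "1 < p"
  shows "AE \<omega> in M. summable (\<lambda>n. \<Gamma> n \<omega> powr - p)"
proof (rule AE_summable_arrival)
  show "integrable lborel (\<lambda>x::real. indicator {1..} x * x powr - p)"
    using assms by (intro integrable_powr_tails(2)[of 0]) auto
qed auto

lemma AE_arrival_pos: "AE \<omega> in M. 0 < \<Gamma> n \<omega>"
proof -
  have "AE \<omega> in M. 0 < W i \<omega>" for i
  proof (subst distributed_AE2[OF W_distributed])
    have "AE x::real in lborel. x \<noteq> 0" by (rule AE_lborel_singleton)
    then show "AE x in lborel. 0 < ennreal (exponential_density 1 x) \<longrightarrow> 0 < x"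
      by eventually_elim (auto simp: exponential_density_def)
  qed auto
  then have "AE \<omega> in M. \<forall>i. 0 < W i \<omega>" by (subst AE_all_countable) simp
  then show ?thesis
    by eventually_elim (subst arrival_eq_sum, auto intro!: sum_pos)
qed

text \<open>Summability of \<open>\<Gamma>\<^sub>n powr - 2\<close> forces the arrival times to infinity.\<close>
lemma AE_arrival_at_top: "AE \<omega> in M. filterlim (\<lambda>n. \<Gamma> n \<omega>) at_top sequentially"
proof -
  have "AE \<omega> in M. \<forall>n. 0 < \<Gamma> n \<omega>"
    by (subst AE_all_countable) (auto intro: AE_arrival_pos)
  moreover have "AE \<omega> in M. summable (\<lambda>n. \<Gamma> n \<omega> powr - 2)" by (rule AE_summable_arrival_powr) simp
  ultimately show ?thesis
  proof eventually_elim
    case (elim \<omega>)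
    have "(\<lambda>n. \<Gamma> n \<omega> powr - 2) \<longlonglongrightarrow> 0" using elim(2) by (rule summable_LIMSEQ_zero)
    show ?case unfolding filterlim_at_top_gt[of _ _ 0]
    proof (intro allI impI)
      fix Z :: real assume Z: "0 < Z"
      have "\<forall>\<^sub>F n in sequentially. \<Gamma> n \<omega> powr - 2 < Z powr - 2"
        using \<open>(\<lambda>n. \<Gamma> n \<omega> powr - 2) \<longlonglongrightarrow> 0\<close> by (rule order_tendstoD) (use Z in simp)
      then show "\<forall>\<^sub>F n in sequentially. Z \<le> \<Gamma> n \<omega>"
      proof eventually_elim
        case (elim n)
        show ?case
        proof (rule ccontr)
          assume "\<not> Z \<le> \<Gamma> n \<omega>"
          then have "Z powr - 2 \<le> \<Gamma> n \<omega> powr - 2"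
            using \<open>\<forall>n. 0 < \<Gamma> n \<omega>\<close> by (intro powr_mono2') auto
          with elim show False by simp
        qed
      qed
    qed
  qed
qed


section \<open>Series with random signs\<close>

definition psum :: "(nat \<Rightarrow> 'a \<Rightarrow> real) \<Rightarrow> nat \<Rightarrow> 'a \<Rightarrow> real" where
  "psum A n \<omega> = (\<Sum>i<n. \<gamma> i \<omega> * A i \<omega>)"

lemma psum_measurable:
  assumes "\<And>i. A i \<in> borel_measurable (marks 0)"
  shows "psum A n \<in> borel_measurable (marks n)"
proof -
  have A': "A i \<in> borel_measurable (marks n)" for i using assms by (rule marks_mono)
  show ?thesis unfolding psum_def[abs_def]
    by (intro borel_measurable_sum borel_measurable_times marks_sign_measurable A') auto
qed

text \<open>Kolmogorov's inequality, restricted to an event \<open>B\<close> that is determined by arrival times and marks and on which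
the squared coefficients are under control. Stop the partial sums when they first reach \<open>\<delta>\<close> in absolute value and let
\<open>\<Phi> n\<close> be \<open>\<delta>\<^sup>2\<close> after that time and the squared partial sum before. Since \<open>\<gamma>\<^sup>2 = 1\<close>, adding
a term increases \<open>\<Phi>\<close> by at most the square of its coefficient plus a multiple of the new sign, and the latter has mean 0.\<close>
lemma maximal_inequality:
  assumes A: "\<And>i. A i \<in> borel_measurable (marks 0)" and B: "B \<in> sets (marks 0)"
    and q[measurable]: "q \<in> borel_measurable M" and qK: "\<And>\<omega>. q \<omega> \<le> K"
    and Aq: "\<And>n \<omega>. \<omega> \<in> B \<Longrightarrow> (\<Sum>i<n. (A i \<omega>)\<^sup>2) \<le> q \<omega>"
    and \<delta>: "0 < \<delta>"
  shows "prob {\<omega>\<in>B. \<exists>n. \<delta> \<le> \<bar>psum A n \<omega>\<bar>} \<le> expectation (\<lambda>\<omega>. indicator B \<omega> * q \<omega>) / \<delta>\<^sup>2"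
proof -
  have A'[measurable]: "A i \<in> borel_measurable (marks n)" for i n using A by (rule marks_mono)
  have AM[measurable]: "A i \<in> borel_measurable M" for i using A by (rule marksD)
  have Bsp: "B \<subseteq> space M" using sets.sets_into_space[OF B] by simp
  then have [simp]: "B \<inter> space M = B" by auto
  have Bn[measurable]: "B \<in> sets (marks n)" for n
    using marks_mono[of "indicator B :: _ \<Rightarrow> real" borel n] B
    by (simp add: borel_measurable_indicator_iff)
  have BM[measurable]: "B \<in> events"
    using marksD[of "indicator B :: _ \<Rightarrow> real" 0 borel] B
    by (simp add: borel_measurable_indicator_iff)
  have Sm: "psum A k \<in> borel_measurable (marks n)" if "k \<le> n" for k n
    unfolding psum_def[abs_def] using that
    by (intro borel_measurable_sum borel_measurable_times marks_sign_measurable A') auto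
  have SM[measurable]: "psum A k \<in> borel_measurable M" for k
    using Sm[of k k] by (intro marksD) auto
  define exceed where "exceed n \<omega> \<longleftrightarrow> (\<exists>k\<in>{..n}. \<delta> \<le> \<bar>psum A k \<omega>\<bar>)" for n \<omega>
  have exm: "Measurable.pred (marks n) (exceed n)" for n
  proof -
    have "Measurable.pred (marks n) (\<lambda>\<omega>. \<delta> \<le> \<bar>psum A k \<omega>\<bar>)" if "k \<le> n" for k
      using Sm[OF that] by measurable
    then show ?thesis unfolding exceed_def[abs_def] by (intro pred_intros_finite) auto
  qed
  have exM[measurable]: "Measurable.pred M (exceed n)" for n
    using exm[of n] marksD by blast
  define \<Phi> where "\<Phi> n \<omega> = (if exceed n \<omega> then \<delta>\<^sup>2 else (psum A n \<omega>)\<^sup>2)" for n \<omega>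
  have \<Phi>M[measurable]: "\<Phi> n \<in> borel_measurable M" for n unfolding \<Phi>_def[abs_def] by measurable
  have \<Phi>bd: "0 \<le> \<Phi> n \<omega>" "\<Phi> n \<omega> \<le> \<delta>\<^sup>2" for n \<omega>
  proof -
    show "0 \<le> \<Phi> n \<omega>" by (simp add: \<Phi>_def)
    show "\<Phi> n \<omega> \<le> \<delta>\<^sup>2"
    proof (cases "exceed n \<omega>")
      case False
      then have "\<bar>psum A n \<omega>\<bar> \<le> \<delta>" by (auto simp: exceed_def not_le less_imp_le)
      then show ?thesis using power_mono[of "\<bar>psum A n \<omega>\<bar>" \<delta> 2] by (simp add: \<Phi>_def)
    qed (simp add: \<Phi>_def)
  qed
  have A2: "(A i \<omega>)\<^sup>2 \<le> K" if "\<omega> \<in> B" for i \<omega>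
  proof -
    have "(A i \<omega>)\<^sup>2 \<le> (\<Sum>i<Suc i. (A i \<omega>)\<^sup>2)" by (simp add: sum_nonneg)
    also have "\<dots> \<le> K" using Aq[OF that] qK by (rule order_trans)
    finally show ?thesis .
  qed
  \<comment> \<open>The coefficient of the new sign in the increment of \<open>\<Phi>\<close>.\<close>
  define Y where "Y n \<omega> = (if \<omega> \<in> B \<and> \<not> exceed n \<omega> then 2 * psum A n \<omega> * A n \<omega> else 0)" for n \<omega>
  have Ym: "Y n \<in> borel_measurable (marks n)" for n
  proof -
    note [measurable] = exm[of n] Sm[of n n, simplified]
    show ?thesis unfolding Y_def[abs_def] by measurable
  qed
  have Ybd: "\<bar>Y n \<omega>\<bar> \<le> \<delta>\<^sup>2 + \<bar>K\<bar>" for n \<omega>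
  proof (cases "\<omega> \<in> B \<and> \<not> exceed n \<omega>")
    case True
    then have "(psum A n \<omega>)\<^sup>2 \<le> \<delta>\<^sup>2" using \<Phi>bd(2)[of n \<omega>] by (simp add: \<Phi>_def)
    moreover have "(A n \<omega>)\<^sup>2 \<le> K" using A2 True by auto
    moreover have "\<bar>2 * psum A n \<omega> * A n \<omega>\<bar> \<le> (psum A n \<omega>)\<^sup>2 + (A n \<omega>)\<^sup>2"
      using sum_squares_bound[of "\<bar>psum A n \<omega>\<bar>" "\<bar>A n \<omega>\<bar>"] by (simp add: abs_mult)
    ultimately show ?thesis using True by (simp add: Y_def)
  qed (auto simp: Y_def)
  have step: "AE \<omega> in M. indicator B \<omega> * \<Phi> (Suc n) \<omega> \<le>
      indicator B \<omega> * \<Phi> n \<omega> + \<gamma> n \<omega> * Y n \<omega> + indicator B \<omega> * (A n \<omega>)\<^sup>2" for n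
    using AE_sign[of n]
  proof eventually_elim
    case (elim \<omega>)
    show ?case
    proof (cases "\<omega> \<in> B")
      case True
      show ?thesis
      proof (cases "exceed n \<omega>")
        case ex: True
        then have "exceed (Suc n) \<omega>" by (auto simp: exceed_def)
        with ex True show ?thesis by (simp add: \<Phi>_def Y_def)
      next
        case ex: False
        have "\<Phi> (Suc n) \<omega> \<le> (psum A (Suc n) \<omega>)\<^sup>2"
        proof (cases "exceed (Suc n) \<omega>")
          case True
          then have "\<delta> \<le> \<bar>psum A (Suc n) \<omega>\<bar>" using ex by (auto simp: exceed_def le_Suc_eq)
          then show ?thesis using True \<delta> power_mono[of \<delta> "\<bar>psum A (Suc n) \<omega>\<bar>" 2] by (simp add: \<Phi>_def)
        qed (simp add: \<Phi>_def)
        also have "\<dots> = (psum A n \<omega>)\<^sup>2 + \<gamma> n \<omega> * (2 * psum A n \<omega> * A n \<omega>) + (\<gamma> n \<omega>)\<^sup>2 * (A n \<omega>)\<^sup>2"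
          by (simp add: psum_def power2_eq_square algebra_simps)
        also have "(\<gamma> n \<omega>)\<^sup>2 = 1" using elim by auto
        finally show ?thesis using True ex by (simp add: \<Phi>_def Y_def)
      qed
    qed (simp add: Y_def)
  qed
  have i\<Phi>: "integrable M (\<lambda>\<omega>. indicator B \<omega> * \<Phi> n \<omega>)" for n
  proof (rule integrable_const_bound[where B="\<delta>\<^sup>2"])
    show "AE \<omega> in M. norm (indicator B \<omega> * \<Phi> n \<omega>) \<le> \<delta>\<^sup>2"
      using \<Phi>bd by (intro AE_I2) (auto simp: indicator_def)
  qed simp
  have iA: "integrable M (\<lambda>\<omega>. indicator B \<omega> * (A n \<omega>)\<^sup>2)" for n
  proof (rule integrable_const_bound[where B="\<bar>K\<bar>"])
    show "AE \<omega> in M. norm (indicator B \<omega> * (A n \<omega>)\<^sup>2) \<le> \<bar>K\<bar>"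
    proof (rule AE_I2)
      fix \<omega>
      show "norm (indicator B \<omega> * (A n \<omega>)\<^sup>2) \<le> \<bar>K\<bar>"
        using A2[of \<omega> n] by (auto simp: indicator_def)
    qed
  qed simp
  have iq: "integrable M (\<lambda>\<omega>. indicator B \<omega> * q \<omega>)"
  proof (rule integrable_const_bound[where B="\<bar>K\<bar>"])
    show "AE \<omega> in M. norm (indicator B \<omega> * q \<omega>) \<le> \<bar>K\<bar>"
    proof (rule AE_I2)
      fix \<omega>
      show "norm (indicator B \<omega> * q \<omega>) \<le> \<bar>K\<bar>"
        using Aq[of \<omega> 0] qK[of \<omega>] by (auto simp: indicator_def)
    qed
  qed simp
  have bound: "expectation (\<lambda>\<omega>. indicator B \<omega> * \<Phi> n \<omega>) \<le> expectation (\<lambda>\<omega>. \<Sum>i<n. indicator B \<omega> * (A i \<omega>)\<^sup>2)" for n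
  proof (induction n)
    case 0
    have "exceed 0 \<omega> \<longleftrightarrow> False" for \<omega> using \<delta> by (simp add: exceed_def psum_def)
    then show ?case by (simp add: \<Phi>_def psum_def)
  next
    case (Suc n)
    have "expectation (\<lambda>\<omega>. indicator B \<omega> * \<Phi> (Suc n) \<omega>) \<le>
      expectation (\<lambda>\<omega>. indicator B \<omega> * \<Phi> n \<omega> + \<gamma> n \<omega> * Y n \<omega> + indicator B \<omega> * (A n \<omega>)\<^sup>2)"
      by (intro integral_mono_AE step i\<Phi> iA Bochner_Integration.integrable_add sign_orthogonal(1)[OF Ym Ybd])
    also have "\<dots> = expectation (\<lambda>\<omega>. indicator B \<omega> * \<Phi> n \<omega>) + expectation (\<lambda>\<omega>. indicator B \<omega> * (A n \<omega>)\<^sup>2)"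
      using i\<Phi>[of n] iA[of n] sign_orthogonal[OF Ym Ybd, of n] by simp
    also have "\<dots> \<le> expectation (\<lambda>\<omega>. \<Sum>i<n. indicator B \<omega> * (A i \<omega>)\<^sup>2) + expectation (\<lambda>\<omega>. indicator B \<omega> * (A n \<omega>)\<^sup>2)"
      using Suc by simp
    also have "\<dots> = expectation (\<lambda>\<omega>. \<Sum>i<Suc n. indicator B \<omega> * (A i \<omega>)\<^sup>2)"
      unfolding sum.lessThan_Suc
      by (rule Bochner_Integration.integral_add[symmetric]) (intro Bochner_Integration.integrable_sum iA)+
    finally show ?case .
  qed
  have fin: "prob {\<omega>\<in>B. exceed n \<omega>} \<le> expectation (\<lambda>\<omega>. indicator B \<omega> * q \<omega>) / \<delta>\<^sup>2" for n
  proof -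
    have exB: "{\<omega>\<in>B. exceed n \<omega>} = {\<omega>\<in>space M. \<omega> \<in> B \<and> exceed n \<omega>}" using Bsp by auto
    have m: "{\<omega>\<in>B. exceed n \<omega>} \<in> events" unfolding exB by measurable
    have "\<delta>\<^sup>2 * prob {\<omega>\<in>B. exceed n \<omega>} = expectation (\<lambda>\<omega>. \<delta>\<^sup>2 * indicator {\<omega>\<in>B. exceed n \<omega>} \<omega>)"
      using m by simp
    also have "\<dots> \<le> expectation (\<lambda>\<omega>. indicator B \<omega> * \<Phi> n \<omega>)"
    proof (rule integral_mono[OF _ i\<Phi>])
      show "integrable M (\<lambda>\<omega>. \<delta>\<^sup>2 * indicator {\<omega>\<in>B. exceed n \<omega>} \<omega>)"
        using m by (intro integrable_mult_right integrable_real_indicator) (auto simp: emeasure_eq_measure)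
      show "\<delta>\<^sup>2 * indicator {\<omega>\<in>B. exceed n \<omega>} \<omega> \<le> indicator B \<omega> * \<Phi> n \<omega>" for \<omega>
        using \<Phi>bd by (auto simp: indicator_def \<Phi>_def)
    qed
    also note bound
    also have "expectation (\<lambda>\<omega>. \<Sum>i<n. indicator B \<omega> * (A i \<omega>)\<^sup>2) \<le> expectation (\<lambda>\<omega>. indicator B \<omega> * q \<omega>)"
    proof (rule integral_mono[OF _ iq])
      show "integrable M (\<lambda>\<omega>. \<Sum>i<n. indicator B \<omega> * (A i \<omega>)\<^sup>2)"
        by (intro Bochner_Integration.integrable_sum iA)
      show "(\<Sum>i<n. indicator B \<omega> * (A i \<omega>)\<^sup>2) \<le> indicator B \<omega> * q \<omega>" for \<omega>
        using Aq[of \<omega> n] by (auto simp: indicator_def)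
    qed
    finally show ?thesis using \<delta> by (simp add: field_simps)
  qed
  have "(\<lambda>n. prob {\<omega>\<in>B. exceed n \<omega>}) \<longlonglongrightarrow> prob (\<Union>n. {\<omega>\<in>B. exceed n \<omega>})"
  proof (rule finite_Lim_measure_incseq)
    have "{\<omega>\<in>B. exceed n \<omega>} = {\<omega>\<in>space M. \<omega> \<in> B \<and> exceed n \<omega>}" for n using Bsp by auto
    then show "range (\<lambda>n. {\<omega>\<in>B. exceed n \<omega>}) \<subseteq> events" by auto
    show "incseq (\<lambda>n. {\<omega>\<in>B. exceed n \<omega>})"
      unfolding exceed_def by (intro monoI) (auto intro: order_trans)
  qed
  moreover have "(\<Union>n. {\<omega>\<in>B. exceed n \<omega>}) = {\<omega>\<in>B. \<exists>n. \<delta> \<le> \<bar>psum A n \<omega>\<bar>}"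
    by (auto simp: exceed_def)
  ultimately show ?thesis
    using fin by (intro LIMSEQ_le_const2[of "\<lambda>n. prob {\<omega>\<in>B. exceed n \<omega>}"]) auto
qed

text \<open>On the event that the sum of the squares is at most \<open>K\<close>, the maximal inequality shows that the series started at
index \<open>m\<close> ever reaches \<open>\<delta>\<close> with a probability that tends to 0 as \<open>m\<close> grows. So almost surely it fails to reach \<open>\<delta>\<close>
for some \<open>m\<close>, and the partial sums are Cauchy.\<close>
lemma AE_summable_sign_series:
  assumes A: "\<And>i. A i \<in> borel_measurable (marks 0)"
    and sum: "AE \<omega> in M. summable (\<lambda>i. (A i \<omega>)\<^sup>2)"
  shows "AE \<omega> in M. summable (\<lambda>i. \<gamma> i \<omega> * A i \<omega>)"
proof -
  have AM[measurable]: "A i \<in> borel_measurable M" for i using A by (rule marksD)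
  define B where "B K = {\<omega>\<in>space M. \<forall>n. (\<Sum>i<n. (A i \<omega>)\<^sup>2) \<le> real K}" for K :: nat
  have B: "B K \<in> sets (marks 0)" for K
  proof -
    have "{\<omega>\<in>space (marks 0). \<forall>n. (\<Sum>i<n. (A i \<omega>)\<^sup>2) \<le> real K} \<in> sets (marks 0)"
      using A by measurable
    then show ?thesis by (simp add: B_def)
  qed
  have BM[measurable]: "B K \<in> events" for K unfolding B_def by measurable
  define q where "q K m \<omega> = (if \<omega> \<in> B K then (\<Sum>i. (A i \<omega>)\<^sup>2) - (\<Sum>i<m. (A i \<omega>)\<^sup>2) else 0)" for K m \<omega>
  have qm[measurable]: "q K m \<in> borel_measurable M" for K m
    unfolding q_def[abs_def] by measurable
  have Bsum: "summable (\<lambda>i. (A i \<omega>)\<^sup>2)" "(\<Sum>i. (A i \<omega>)\<^sup>2) \<le> real K" if "\<omega> \<in> B K" for \<omega> K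
  proof -
    show s: "summable (\<lambda>i. (A i \<omega>)\<^sup>2)"
      using that by (intro summableI_nonneg_bounded[of _ "real K"]) (auto simp: B_def)
    show "(\<Sum>i. (A i \<omega>)\<^sup>2) \<le> real K"
      using that by (intro suminf_le_const[OF s]) (auto simp: B_def)
  qed
  have q0: "0 \<le> q K m \<omega>" for K m \<omega>
    using Bsum[of \<omega> K] by (auto simp: q_def intro!: sum_le_suminf)
  have qK: "q K m \<omega> \<le> real K" for K m \<omega>
    using Bsum[of \<omega> K] sum_nonneg[of "{..<m}" "\<lambda>i. (A i \<omega>)\<^sup>2"] by (auto simp: q_def)
  have q_lim: "(\<lambda>m. expectation (\<lambda>\<omega>. indicator (B K) \<omega> * q K m \<omega>)) \<longlonglongrightarrow> 0" for K
  proof -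
    have "(\<lambda>m. expectation (\<lambda>\<omega>. indicator (B K) \<omega> * q K m \<omega>)) \<longlonglongrightarrow> expectation (\<lambda>\<omega>. 0)"
    proof (rule integral_dominated_convergence[where w="\<lambda>_. real K"])
      show "AE \<omega> in M. (\<lambda>m. indicator (B K) \<omega> * q K m \<omega>) \<longlonglongrightarrow> 0"
      proof (rule AE_I2)
        fix \<omega>
        show "(\<lambda>m. indicator (B K) \<omega> * q K m \<omega>) \<longlonglongrightarrow> 0"
        proof (cases "\<omega> \<in> B K")
          case True
          have "(\<lambda>m. (\<Sum>i. (A i \<omega>)\<^sup>2) - (\<Sum>i<m. (A i \<omega>)\<^sup>2)) \<longlonglongrightarrow> (\<Sum>i. (A i \<omega>)\<^sup>2) - (\<Sum>i. (A i \<omega>)\<^sup>2)"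
            using summable_LIMSEQ[OF Bsum(1)[OF True]] by (intro tendsto_diff tendsto_const)
          then show ?thesis using True by (simp add: q_def)
        qed simp
      qed
      show "AE \<omega> in M. norm (indicator (B K) \<omega> * q K m \<omega>) \<le> real K" for m
        using q0 qK by (intro AE_I2) (auto simp: indicator_def)
    qed auto
    then show ?thesis by simp
  qed
  \<comment> \<open>The series started at index \<open>m\<close> reaches \<open>\<delta>\<close>.\<close>
  define bad where "bad K \<delta> m = {\<omega>\<in>B K. \<exists>n. \<delta> \<le> \<bar>psum (\<lambda>i \<omega>. if m \<le> i then A i \<omega> else 0) n \<omega>\<bar>}" for K \<delta> m
  have bad_le: "prob (bad K \<delta> m) \<le> expectation (\<lambda>\<omega>. indicator (B K) \<omega> * q K m \<omega>) / \<delta>\<^sup>2" if "0 < \<delta>" for K \<delta> m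
    unfolding bad_def
  proof (rule maximal_inequality[OF _ B _ qK _ that])
    show "(\<lambda>\<omega>. if m \<le> i then A i \<omega> else 0) \<in> borel_measurable (marks 0)" for i
      using A by (cases "m \<le> i") auto
    fix n \<omega> assume \<omega>: "\<omega> \<in> B K"
    have "(\<Sum>i<n. (if m \<le> i then A i \<omega> else 0)\<^sup>2) + (\<Sum>i<m. (A i \<omega>)\<^sup>2) =
      (\<Sum>i\<in>{..<n} \<inter> {m..}. (A i \<omega>)\<^sup>2) + (\<Sum>i<m. (A i \<omega>)\<^sup>2)"
      by (simp add: if_distrib[of "\<lambda>x. x\<^sup>2"] sum.inter_restrict atLeast_def cong: if_cong)
    also have "\<dots> = (\<Sum>i\<in>({..<n} \<inter> {m..}) \<union> {..<m}. (A i \<omega>)\<^sup>2)"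
      by (intro sum.union_disjoint[symmetric]) auto
    also have "\<dots> \<le> (\<Sum>i. (A i \<omega>)\<^sup>2)"
      by (intro sum_le_suminf Bsum(1)[OF \<omega>]) auto
    finally show "(\<Sum>i<n. (if m \<le> i then A i \<omega> else 0)\<^sup>2) \<le> q K m \<omega>" using \<omega> by (simp add: q_def)
  qed simp
  have bad_meas: "bad K \<delta> m \<in> events" for K \<delta> m
  proof -
    have "bad K \<delta> m = {\<omega>\<in>space M. \<omega> \<in> B K \<and> (\<exists>n. \<delta> \<le> \<bar>\<Sum>i<n. \<gamma> i \<omega> * (if m \<le> i then A i \<omega> else 0)\<bar>)}"
      using sets.sets_into_space[OF BM] by (auto simp: bad_def psum_def)
    also have "\<dots> \<in> events" by measurable
    finally show ?thesis .
  qed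
  have null: "prob (\<Inter>m. bad K \<delta> m) = 0" if "0 < \<delta>" for K \<delta>
  proof -
    have "prob (\<Inter>m. bad K \<delta> m) \<le> 0"
    proof (rule LIMSEQ_le_const)
      show "(\<lambda>m. expectation (\<lambda>\<omega>. indicator (B K) \<omega> * q K m \<omega>) / \<delta>\<^sup>2) \<longlonglongrightarrow> 0"
        using tendsto_divide[OF q_lim tendsto_const[of "\<delta>\<^sup>2"]] that by simp
      show "\<exists>N. \<forall>m\<ge>N. prob (\<Inter>m. bad K \<delta> m) \<le> expectation (\<lambda>\<omega>. indicator (B K) \<omega> * q K m \<omega>) / \<delta>\<^sup>2"
        using bad_meas by (intro exI allI impI order_trans[OF _ bad_le[OF that]] finite_measure_mono) auto
    qed
    then show ?thesis by (simp add: measure_le_0_iff)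
  qed
  have "AE \<omega> in M. \<omega> \<notin> (\<Inter>m. bad K (1 / real (Suc j)) m)" for K j
  proof -
    have "(\<Inter>m. bad K (1 / real (Suc j)) m) \<in> null_sets M"
      using null[of "1 / real (Suc j)" K] bad_meas by (auto simp: null_sets_def emeasure_eq_measure)
    then show ?thesis by (rule AE_not_in)
  qed
  then have "AE \<omega> in M. \<forall>K j. \<omega> \<notin> (\<Inter>m. bad K (1 / real (Suc j)) m)"
    by (simp add: AE_all_countable)
  with sum AE_space show ?thesis
  proof eventually_elim
    case (elim \<omega>)
    obtain K :: nat where K: "(\<Sum>i. (A i \<omega>)\<^sup>2) \<le> K" using real_arch_simple by blast
    have \<omega>: "\<omega> \<in> B K"
      using elim(2) K sum_le_suminf[OF elim(1), of "{..<n}" for n] unfolding B_def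
      by (auto intro: order_trans)
    have "Cauchy (\<lambda>n. \<Sum>i<n. \<gamma> i \<omega> * A i \<omega>)"
    proof (rule CauchyI)
      fix e :: real assume "0 < e"
      then obtain j where j: "1 / real (Suc j) < e / 2" using nat_approx_posE[of "e/2"] by auto
      from elim(3) obtain m where "\<omega> \<notin> bad K (1 / real (Suc j)) m" by blast
      then have m: "\<bar>psum (\<lambda>i \<omega>. if m \<le> i then A i \<omega> else 0) n \<omega>\<bar> < 1 / real (Suc j)" for n
        using \<omega> by (auto simp: bad_def not_le)
      have tail: "\<bar>(\<Sum>i<n. \<gamma> i \<omega> * A i \<omega>) - (\<Sum>i<m. \<gamma> i \<omega> * A i \<omega>)\<bar> < e / 2" if "m \<le> n" for n
      proof -
        have "{..<n} = {..<m} \<union> {m..<n}" using that by auto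
        then have split: "(\<Sum>i<n. f i) = (\<Sum>i<m. f i) + (\<Sum>i\<in>{m..<n}. f i)" for f :: "nat \<Rightarrow> real"
          by (simp add: sum.union_disjoint ivl_disj_int)
        have "psum (\<lambda>i \<omega>. if m \<le> i then A i \<omega> else 0) n \<omega> = (\<Sum>i\<in>{m..<n}. \<gamma> i \<omega> * A i \<omega>)"
          unfolding psum_def split by simp
        with m[of n] j show ?thesis unfolding split by simp
      qed
      show "\<exists>N. \<forall>n\<ge>N. \<forall>n'\<ge>N. norm ((\<Sum>i<n. \<gamma> i \<omega> * A i \<omega>) - (\<Sum>i<n'. \<gamma> i \<omega> * A i \<omega>)) < e"
      proof (intro exI[of _ m] allI impI)
        fix n n' assume "m \<le> n" "m \<le> n'"
        from tail[OF this(1)] tail[OF this(2)]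
        show "norm ((\<Sum>i<n. \<gamma> i \<omega> * A i \<omega>) - (\<Sum>i<n'. \<gamma> i \<omega> * A i \<omega>)) < e"
          unfolding real_norm_def by linarith
      qed
    qed
    then show ?case unfolding summable_iff_convergent by (rule Cauchy_convergent)
  qed
qed


text \<open>The first term on the right depends neither on \<open>e\<close> nor on \<open>A\<close>: with a fixed dominating sequence \<open>g\<close> one
first chooses \<open>K\<close> large and then \<open>e\<close> small.\<close>
lemma prob_sign_series_ge:
  assumes A: "\<And>i. A i \<in> borel_measurable (marks 0)" and g: "\<And>i. g i \<in> borel_measurable (marks 0)"
    and Ag: "\<And>i \<omega>. \<omega> \<in> space M \<Longrightarrow> \<bar>A i \<omega>\<bar> \<le> e * g i \<omega>"
    and sm: "AE \<omega> in M. summable (\<lambda>i. \<gamma> i \<omega> * A i \<omega>)"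
    and \<delta>: "0 < \<delta>" and K: "0 \<le> K"
  shows "prob {\<omega>\<in>space M. \<delta> \<le> \<bar>\<Sum>i. \<gamma> i \<omega> * A i \<omega>\<bar>}
    \<le> prob {\<omega>\<in>space M. \<not> (\<forall>n. (\<Sum>i<n. (g i \<omega>)\<^sup>2) \<le> K)} + 4 * K * e\<^sup>2 / \<delta>\<^sup>2"
proof -
  have AM[measurable]: "A i \<in> borel_measurable M" for i using A by (rule marksD)
  have gM[measurable]: "g i \<in> borel_measurable M" for i using g by (rule marksD)
  define B where "B = {\<omega>\<in>space M. \<forall>n. (\<Sum>i<n. (g i \<omega>)\<^sup>2) \<le> K}"
  have B: "B \<in> sets (marks 0)"
  proof -
    have "{\<omega>\<in>space (marks 0). \<forall>n. (\<Sum>i<n. (g i \<omega>)\<^sup>2) \<le> K} \<in> sets (marks 0)"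
      using g by measurable
    then show ?thesis by (simp add: B_def)
  qed
  have BM[measurable]: "B \<in> events" unfolding B_def by measurable
  have "prob {\<omega>\<in>B. \<exists>n. \<delta> / 2 \<le> \<bar>psum A n \<omega>\<bar>} \<le> expectation (\<lambda>\<omega>. indicator B \<omega> * (e\<^sup>2 * K)) / (\<delta> / 2)\<^sup>2"
  proof (rule maximal_inequality[OF A B])
    fix n \<omega> assume \<omega>: "\<omega> \<in> B"
    have "(A i \<omega>)\<^sup>2 \<le> e\<^sup>2 * (g i \<omega>)\<^sup>2" for i
      using power_mono[OF Ag[of \<omega> i], of 2] \<omega> by (simp add: B_def power_mult_distrib)
    then have "(\<Sum>i<n. (A i \<omega>)\<^sup>2) \<le> e\<^sup>2 * (\<Sum>i<n. (g i \<omega>)\<^sup>2)"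
      by (simp add: sum_distrib_left sum_mono)
    also have "\<dots> \<le> e\<^sup>2 * K" using \<omega> by (intro mult_left_mono) (auto simp: B_def)
    finally show "(\<Sum>i<n. (A i \<omega>)\<^sup>2) \<le> e\<^sup>2 * K" .
  qed (use \<delta> in auto)
  also have "\<dots> = prob B * (4 * K * e\<^sup>2 / \<delta>\<^sup>2)"
    by (simp add: power2_eq_square field_simps)
  also have "\<dots> \<le> 1 * (4 * K * e\<^sup>2 / \<delta>\<^sup>2)"
    using K by (intro mult_right_mono) auto
  finally have 1: "prob {\<omega>\<in>B. \<exists>n. \<delta> / 2 \<le> \<bar>psum A n \<omega>\<bar>} \<le> 4 * K * e\<^sup>2 / \<delta>\<^sup>2" by simp
  have eqB: "{\<omega>\<in>B. \<exists>n. \<delta> / 2 \<le> \<bar>psum A n \<omega>\<bar>} =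
      {\<omega>\<in>space M. \<omega> \<in> B \<and> (\<exists>n. \<delta> / 2 \<le> \<bar>\<Sum>i<n. \<gamma> i \<omega> * A i \<omega>\<bar>)}"
    by (auto simp: B_def psum_def)
  have m1: "{\<omega>\<in>B. \<exists>n. \<delta> / 2 \<le> \<bar>psum A n \<omega>\<bar>} \<in> events" unfolding eqB by measurable
  have m2: "{\<omega>\<in>space M. \<not> (\<forall>n. (\<Sum>i<n. (g i \<omega>)\<^sup>2) \<le> K)} \<in> events" by measurable
  have "AE \<omega> in M. \<omega> \<in> {\<omega>\<in>space M. \<delta> \<le> \<bar>\<Sum>i. \<gamma> i \<omega> * A i \<omega>\<bar>} \<longrightarrow>
    \<omega> \<in> {\<omega>\<in>space M. \<not> (\<forall>n. (\<Sum>i<n. (g i \<omega>)\<^sup>2) \<le> K)} \<union> {\<omega>\<in>B. \<exists>n. \<delta> / 2 \<le> \<bar>psum A n \<omega>\<bar>}"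
    using sm
  proof (eventually_elim, intro impI)
    fix \<omega> assume "summable (\<lambda>i. \<gamma> i \<omega> * A i \<omega>)" "\<omega> \<in> {\<omega>\<in>space M. \<delta> \<le> \<bar>\<Sum>i. \<gamma> i \<omega> * A i \<omega>\<bar>}"
    then have \<omega>: "\<omega> \<in> space M" "\<delta> \<le> \<bar>\<Sum>i. \<gamma> i \<omega> * A i \<omega>\<bar>" "summable (\<lambda>i. \<gamma> i \<omega> * A i \<omega>)" by auto
    have "(\<lambda>n. \<bar>psum A n \<omega>\<bar>) \<longlonglongrightarrow> \<bar>\<Sum>i. \<gamma> i \<omega> * A i \<omega>\<bar>"
      unfolding psum_def by (intro tendsto_rabs summable_LIMSEQ \<omega>)
    moreover have "\<delta> / 2 < \<bar>\<Sum>i. \<gamma> i \<omega> * A i \<omega>\<bar>" using \<omega>(2) \<delta> by linarith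
    ultimately have "\<forall>\<^sub>F n in sequentially. \<delta> / 2 < \<bar>psum A n \<omega>\<bar>" by (rule order_tendstoD)
    then have "\<exists>n. \<delta> / 2 < \<bar>psum A n \<omega>\<bar>" using eventually_happens'[OF sequentially_bot] by blast
    then have "\<exists>n. \<delta> / 2 \<le> \<bar>psum A n \<omega>\<bar>" by (blast intro: less_imp_le)
    then show "\<omega> \<in> {\<omega>\<in>space M. \<not> (\<forall>n. (\<Sum>i<n. (g i \<omega>)\<^sup>2) \<le> K)} \<union> {\<omega>\<in>B. \<exists>n. \<delta> / 2 \<le> \<bar>psum A n \<omega>\<bar>}"
      using \<omega>(1) unfolding B_def by blast
  qed
  then have "prob {\<omega>\<in>space M. \<delta> \<le> \<bar>\<Sum>i. \<gamma> i \<omega> * A i \<omega>\<bar>} \<le>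
    prob ({\<omega>\<in>space M. \<not> (\<forall>n. (\<Sum>i<n. (g i \<omega>)\<^sup>2) \<le> K)} \<union> {\<omega>\<in>B. \<exists>n. \<delta> / 2 \<le> \<bar>psum A n \<omega>\<bar>})"
    using m1 m2 by (intro finite_measure_mono_AE) auto
  also have "\<dots> \<le> prob {\<omega>\<in>space M. \<not> (\<forall>n. (\<Sum>i<n. (g i \<omega>)\<^sup>2) \<le> K)} +
      prob {\<omega>\<in>B. \<exists>n. \<delta> / 2 \<le> \<bar>psum A n \<omega>\<bar>}"
    using m1 m2 by (rule measure_Un_le[rotated])
  finally show ?thesis using 1 by linarith
qed

end

section \<open>The probability generating functional of a Poisson process\<close>

text \<open>The substitution \<open>x = \<bar>c\<bar> powr a * y\<close> reduces this to \<open>c = 1\<close>; it is the source of the exponent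
\<open>a\<close> in the stable characteristic function.\<close>
lemma one_minus_cos_scaled:
  assumes a: "1 < a" "a < 2"
  shows "integrable lborel (\<lambda>x::real. indicator {0<..} x * (1 - cos (x powr (- 1 / a) * c)))"
    and "(\<integral>x. indicator {0<..} x * (1 - cos (x powr (- 1 / a) * c)) \<partial>lborel) = \<bar>c\<bar> powr a * stable_integral a"
proof -
  let ?f = "\<lambda>x::real. indicator {0<..} x * (1 - cos (x powr (- 1 / a) * c))"
  let ?g = "\<lambda>y::real. indicator {0<..} y * (1 - cos (y powr (- 1 / a)))"
  have "integrable lborel ?f \<and> (\<integral>x. ?f x \<partial>lborel) = \<bar>c\<bar> powr a * stable_integral a"
  proof (cases "c = 0")
    case False
    define \<kappa> where "\<kappa> = \<bar>c\<bar> powr a"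
    have \<kappa>: "0 < \<kappa>" using False by (simp add: \<kappa>_def)
    have f: "?f (0 + \<kappa> * y) = ?g y" for y
    proof (cases "0 < y")
      case True
      have "(\<kappa> * y) powr (- 1 / a) = \<kappa> powr (- 1 / a) * y powr (- 1 / a)"
        using True \<kappa> by (simp add: powr_mult)
      also have "\<kappa> powr (- 1 / a) = \<bar>c\<bar> powr (a * (- 1 / a))"
        unfolding \<kappa>_def by (rule powr_powr)
      also have "\<dots> = 1 / \<bar>c\<bar>" using a False by (simp add: powr_minus_divide)
      finally have "(\<kappa> * y) powr (- 1 / a) * c = y powr (- 1 / a) \<or> (\<kappa> * y) powr (- 1 / a) * c = - (y powr (- 1 / a))"
        using False by (auto simp: abs_if)
      then have "cos ((\<kappa> * y) powr (- 1 / a) * c) = cos (y powr (- 1 / a))" by auto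
      then show ?thesis using True \<kappa> by simp
    next
      case False
      then have "\<not> 0 < \<kappa> * y" using \<kappa> by (simp add: zero_less_mult_iff)
      with False show ?thesis by simp
    qed
    have "integrable lborel (\<lambda>y. ?f (0 + \<kappa> * y))"
      unfolding f by (rule integrable_one_minus_cos[OF a])
    then have i: "integrable lborel ?f"
      using \<kappa> by (subst (asm) lborel_integrable_real_affine_iff) auto
    have "(\<integral>x. ?f x \<partial>lborel) = \<bar>\<kappa>\<bar> *\<^sub>R (\<integral>y. ?f (0 + \<kappa> * y) \<partial>lborel)"
      using \<kappa> by (intro lborel_integral_real_affine) auto
    also have "\<dots> = \<kappa> * stable_integral a"
      unfolding f integral_one_minus_cos[OF a] using \<kappa> by simp
    finally show ?thesis using i by (simp add: \<kappa>_def)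
  qed (use a in simp)
  then show "integrable lborel ?f" "(\<integral>x. ?f x \<partial>lborel) = \<bar>c\<bar> powr a * stable_integral a" by auto
qed

locale stable_kernel = prob_space \<mu> for \<mu> :: "real measure" +
  fixes a :: real and k :: "real \<Rightarrow> real" and \<kappa> :: real
  assumes sets_\<mu>[measurable_cong]: "sets \<mu> = sets borel"
    and a: "1 < a" "a < 2" and k_meas[measurable]: "k \<in> borel_measurable borel"
    and k_bound: "\<And>v. \<bar>k v\<bar> \<le> \<kappa>"
begin

text \<open>The factor that one arrival at time \<open>x\<close> contributes to the characteristic function, averaged over its mark and sign.\<close>
definition psi :: "real \<Rightarrow> real" where
  "psi x = (\<integral>v. cos (x powr (- 1 / a) * k v) \<partial>\<mu>)"

definition rate :: "real \<Rightarrow> real" where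
  "rate x = indicator {0<..} x * (1 - psi x)"

definition tail :: "real \<Rightarrow> real" where
  "tail s = (\<integral>x. indicator {s<..} x * rate x \<partial>lborel)"

text \<open>The expectation of the product of \<open>psi (s + \<Gamma>\<^sub>i)\<close> over all arrivals.\<close>
definition pgf :: "real \<Rightarrow> real" where
  "pgf s = exp (- tail s)"

lemma psi_measurable[measurable]: "psi \<in> borel_measurable borel"
  unfolding psi_def[abs_def] by measurable

lemma psi_bound: "\<bar>psi x\<bar> \<le> 1"
proof -
  have "\<bar>psi x\<bar> \<le> (\<integral>v. \<bar>cos (x powr (- 1 / a) * k v)\<bar> \<partial>\<mu>)"
    unfolding psi_def by (rule integral_abs_bound)
  also have "\<dots> \<le> (\<integral>v. 1 \<partial>\<mu>)"
    by (intro integral_mono integrable_const_bound[where B=1]) auto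
  finally show ?thesis by (simp add: prob_space)
qed

lemma rate_measurable[measurable]: "rate \<in> borel_measurable borel"
  unfolding rate_def[abs_def] by measurable

lemma rate_bound: "0 \<le> rate x" "rate x \<le> 2"
  using psi_bound[of x] by (auto simp: rate_def indicator_def)

lemma psi_isCont:
  assumes "0 < x" shows "isCont psi x"
  unfolding isCont_def tendsto_at_iff_sequentially comp_def
proof (intro allI impI)
  fix X :: "nat \<Rightarrow> real" assume "X \<longlonglongrightarrow> x"
  show "(\<lambda>n. psi (X n)) \<longlonglongrightarrow> psi x"
    unfolding psi_def
  proof (rule integral_dominated_convergence[where w="\<lambda>_. 1"])
    show "AE v in \<mu>. (\<lambda>n. cos (X n powr (- 1 / a) * k v)) \<longlonglongrightarrow> cos (x powr (- 1 / a) * k v)"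
      using assms \<open>X \<longlonglongrightarrow> x\<close> by (intro AE_I2 tendsto_cos tendsto_mult tendsto_powr tendsto_const) auto
  qed auto
qed

lemma
  shows rate_integrable: "integrable lborel rate"
    and rate_integral: "(\<integral>x. rate x \<partial>lborel) = stable_integral a * (\<integral>v. \<bar>k v\<bar> powr a \<partial>\<mu>)"
proof -
  interpret S: sigma_finite_measure \<mu> by unfold_locales
  interpret P: pair_sigma_finite \<mu> lborel ..
  define F where "F v x = indicator {0<..} x * (1 - cos (x powr (- 1 / a) * k v))" for v x :: real
  have F0: "0 \<le> F v x" for v x by (simp add: F_def indicator_def)
  have Fm[measurable]: "case_prod F \<in> borel_measurable (\<mu> \<Otimes>\<^sub>M lborel)"
    unfolding F_def indicator_def[abs_def] by simp
  have inner: "(\<integral>x. F v x \<partial>lborel) = \<bar>k v\<bar> powr a * stable_integral a" for v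
    unfolding F_def by (rule one_minus_cos_scaled(2)[OF a])
  have k0: "\<bar>k v\<bar> powr a \<le> \<kappa> powr a" for v
    using a k_bound by (intro powr_mono2) auto
  have ik: "integrable \<mu> (\<lambda>v. \<bar>k v\<bar> powr a)"
    by (rule integrable_const_bound[where B="\<kappa> powr a"]) (use k0 in auto)
  have int: "integrable (\<mu> \<Otimes>\<^sub>M lborel) (case_prod F)"
  proof (rule P.Fubini_integrable[OF Fm])
    show "integrable \<mu> (\<lambda>v. \<integral>x. norm (case_prod F (v, x)) \<partial>lborel)"
      using ik F0 by (simp add: inner)
    show "AE v in \<mu>. integrable lborel (\<lambda>x. case_prod F (v, x))"
      unfolding F_def using one_minus_cos_scaled(1)[OF a] by (intro AE_I2) simp
  qed
  have outer: "(\<integral>v. F v x \<partial>\<mu>) = rate x" for x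
  proof -
    have "integrable \<mu> (\<lambda>v. cos (x powr (- 1 / a) * k v))"
      by (rule integrable_const_bound[where B=1]) auto
    then show ?thesis by (simp add: F_def rate_def psi_def prob_space)
  qed
  show "integrable lborel rate"
    using P.integrable_snd[OF int] by (simp add: outer)
  show "(\<integral>x. rate x \<partial>lborel) = stable_integral a * (\<integral>v. \<bar>k v\<bar> powr a \<partial>\<mu>)"
    using P.Fubini_integral[OF int] by (simp add: inner outer)
qed

lemma rate_integrable_on: "A \<in> sets borel \<Longrightarrow> integrable lborel (\<lambda>x. indicator A x * rate x)"
  by (rule Bochner_Integration.integrable_bound[OF rate_integrable]) (auto simp: indicator_def)

lemma tail_0: "tail 0 = stable_integral a * (\<integral>v. \<bar>k v\<bar> powr a \<partial>\<mu>)"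
proof -
  have "tail 0 = (\<integral>x. rate x \<partial>lborel)"
    unfolding tail_def by (intro Bochner_Integration.integral_cong) (auto simp: rate_def indicator_def)
  then show ?thesis by (simp add: rate_integral)
qed

lemma tail_nonneg: "0 \<le> tail s"
  unfolding tail_def using rate_bound by (intro integral_nonneg_AE AE_I2) (auto simp: indicator_def)

lemma tail_diff:
  assumes "s \<le> t"
  shows "tail s - tail t = (\<integral>x. indicator {s<..t} x * rate x \<partial>lborel)"
proof -
  have "tail s - tail t = (\<integral>x. indicator {s<..} x * rate x - indicator {t<..} x * rate x \<partial>lborel)"
    unfolding tail_def by (intro Bochner_Integration.integral_diff[symmetric] rate_integrable_on) auto
  also have "\<dots> = (\<integral>x. indicator {s<..t} x * rate x \<partial>lborel)"
    using assms by (intro Bochner_Integration.integral_cong) (auto simp: indicator_def)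
  finally show ?thesis .
qed

lemma tail_lipschitz: "\<bar>tail s - tail t\<bar> \<le> 2 * \<bar>s - t\<bar>"
proof -
  have *: "\<bar>tail s - tail t\<bar> \<le> 2 * \<bar>s - t\<bar>" if "s \<le> t" for s t
  proof -
    have "\<bar>tail s - tail t\<bar> \<le> (\<integral>x. indicator {s<..t} x * 2 \<partial>lborel)"
      unfolding tail_diff[OF that]
    proof (rule integral_abs_bound_integral)
      show "\<bar>indicator {s<..t} x * rate x\<bar> \<le> indicator {s<..t} x * 2" for x
        using rate_bound[of x] by (auto simp: indicator_def)
    qed (use that in \<open>auto intro!: rate_integrable_on integrable_mult_left integrable_real_indicator\<close>)
    also have "\<dots> = 2 * \<bar>s - t\<bar>" using that by simp
    finally show ?thesis .
  qed
  show ?thesis using *[of s t] *[of t s] by (cases "s \<le> t") (auto simp: abs_minus_commute)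
qed

lemma tail_isCont: "isCont tail s"
  unfolding isCont_def
proof (rule LIM_zero_cancel, rule Lim_null_comparison)
  show "\<forall>\<^sub>F t in at s. norm (tail t - tail s) \<le> 2 * \<bar>t - s\<bar>"
    using tail_lipschitz by (intro always_eventually) auto
  have "((\<lambda>t. 2 * \<bar>t - s\<bar>) \<longlongrightarrow> 2 * \<bar>s - s\<bar>) (at s)" by (intro tendsto_intros)
  then show "((\<lambda>t. 2 * \<bar>t - s\<bar>) \<longlongrightarrow> 0) (at s)" by simp
qed

lemma pgf_bounds: "0 < pgf s" "pgf s \<le> 1"
  using tail_nonneg[of s] by (auto simp: pgf_def)

lemma pgf_isCont: "isCont pgf s"
  unfolding pgf_def[abs_def] by (intro isCont_exp' isCont_minus tail_isCont)

lemma pgf_measurable[measurable]: "pgf \<in> borel_measurable borel"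
  by (intro borel_measurable_continuous_onI continuous_at_imp_continuous_on ballI pgf_isCont)

lemma pgf_at_top: "(pgf \<longlongrightarrow> 1) at_top"
proof -
  have "((\<lambda>s. \<integral>x. indicator {s<..} x * rate x \<partial>lborel) \<longlongrightarrow> (\<integral>x. 0 \<partial>(lborel :: real measure))) at_top"
  proof (rule integral_dominated_convergence_at_top[where s="\<lambda>s x. indicator {s<..} x * rate x" and w = rate])
    show "integrable lborel rate" by (rule rate_integrable)
    show "\<forall>\<^sub>F s in at_top. AE x in lborel. norm (indicator {s<..} x * rate x) \<le> rate x"
      using rate_bound by (intro always_eventually allI AE_I2) (auto simp: indicator_def)
    show "AE x in lborel. ((\<lambda>s. indicator {s<..} x * rate x) \<longlongrightarrow> 0) at_top"
    proof (rule AE_I2)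
      fix x :: real
      have "\<forall>\<^sub>F s in at_top. indicator {s<..} x * rate x = 0"
        using eventually_ge_at_top[of x] by eventually_elim auto
      then show "((\<lambda>s. indicator {s<..} x * rate x) \<longlongrightarrow> 0) at_top" by (rule tendsto_eventually)
    qed
  qed auto
  then have "(tail \<longlongrightarrow> 0) at_top" by (simp add: tail_def[abs_def])
  then have "((\<lambda>s. exp (- tail s)) \<longlongrightarrow> exp (- 0)) at_top" by (intro tendsto_exp tendsto_minus)
  then show ?thesis by (simp add: pgf_def[abs_def])
qed

text \<open>Restricted to \<open>y > 0\<close>, because \<^const>\<open>psi\<close> need not be continuous at 0.\<close>
lemma tail_deriv:
  assumes y: "0 < y"
  shows "(tail has_real_derivative - (1 - psi y)) (at y)"
proof -
  let ?c = "y / 2" and ?d = "y + 1"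
  let ?f = "\<lambda>x. 1 - psi x"
  have cont: "continuous_on {?c..?d} ?f"
    using y by (intro continuous_at_imp_continuous_on ballI continuous_intros psi_isCont) auto
  have eq: "tail t = tail ?c - integral {?c..t} ?f" if t: "t \<in> {?c..?d}" for t
  proof -
    have "tail ?c - tail t = (\<integral>x. indicator {?c<..t} x * rate x \<partial>lborel)"
      using t by (intro tail_diff) auto
    also have "\<dots> = (\<integral>x. indicator {?c..t} x * ?f x \<partial>lborel)"
    proof (rule integral_cong_AE)
      have "AE x in lborel. x \<noteq> ?c" by (rule AE_lborel_singleton)
      then show "AE x in lborel. indicator {?c<..t} x * rate x = indicator {?c..t} x * ?f x"
        by eventually_elim (use y in \<open>auto simp: rate_def indicator_def\<close>)
    qed auto
    also have "\<dots> = integral {?c..t} ?f"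
    proof -
      have "set_integrable lborel {?c..t} ?f"
        using t by (intro borel_integrable_atLeastAtMost' continuous_on_subset[OF cont]) auto
      from set_borel_integral_eq_integral(2)[OF this] show ?thesis
        by (simp add: set_lebesgue_integral_def)
    qed
    finally show ?thesis by simp
  qed
  have "((\<lambda>t. integral {?c..t} ?f) has_real_derivative ?f y) (at y within {?c..?d})"
    using cont y by (intro integral_has_real_derivative) auto
  then have "((\<lambda>t. tail ?c - integral {?c..t} ?f) has_real_derivative 0 - ?f y) (at y within {?c..?d})"
    by (intro DERIV_diff DERIV_const)
  then have "(tail has_real_derivative 0 - ?f y) (at y within {?c..?d})"
  proof (rule has_field_derivative_transform_within[where d = 1])
    show "y \<in> {?c..?d}" using y by simp
    show "tail ?c - integral {?c..t} ?f = tail t" if "t \<in> {?c..?d}" for t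
      by (rule eq[OF that, symmetric])
  qed simp
  then show ?thesis using y by (simp add: at_within_Icc_at)
qed

text \<open>Conditioning on the first arrival \<open>w\<close>. The integrand is the derivative of \<open>- exp (- y) * pgf y\<close> at \<open>y = s + w\<close>, up
to the factor \<open>exp s\<close>.\<close>
lemma pgf_renewal:
  assumes s: "0 \<le> s"
  shows "(\<integral>w. indicator {0<..} w * (exp (- w) * psi (s + w) * pgf (s + w)) \<partial>lborel) = pgf s"
proof -
  let ?f = "\<lambda>y. exp (- y) * psi y * pgf y" and ?F = "\<lambda>y. - exp (- y) * pgf y"
  have bd: "\<bar>?f y\<bar> \<le> exp (- y)" for y
  proof -
    have "\<bar>?f y\<bar> = exp (- y) * (\<bar>psi y\<bar> * pgf y)" using pgf_bounds[of y] by (simp add: abs_mult)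
    also have "\<dots> \<le> exp (- y) * (1 * 1)"
      using psi_bound[of y] pgf_bounds[of y] by (intro mult_left_mono mult_mono) auto
    finally show ?thesis by simp
  qed
  have "(LBINT y=ereal s..\<infinity>. ?f y) = 0 - ?F s"
  proof (rule interval_integral_FTC_integrable)
    show "(?F has_vector_derivative ?f y) (at y)" if "ereal s < ereal y" for y
    proof -
      have "0 < y" using s that by simp
      then have "(?F has_real_derivative ?f y) (at y)"
        unfolding pgf_def[abs_def]
        by (auto intro!: derivative_eq_intros tail_deriv) (simp add: algebra_simps)
      then show ?thesis by (simp add: has_real_derivative_iff_has_vector_derivative)
    qed
    show "isCont ?f y" if "ereal s < ereal y" for y
      using s that by (intro continuous_intros psi_isCont pgf_isCont) auto
    show "set_integrable lborel (einterval (ereal s) \<infinity>) ?f"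
      unfolding set_integrable_def
    proof (rule Bochner_Integration.integrable_bound)
      have "(\<lambda>x. exp (- x)) absolutely_integrable_on {s..}"
        using integrable_on_exp_minus_to_infinity[of 1 s] by (intro nonnegative_absolutely_integrable_1) auto
      then show "integrable lborel (\<lambda>x::real. indicator {s..} x * exp (- x))"
        unfolding set_integrable_def by (subst (asm) integrable_completion) auto
      show "AE x in lborel. norm (indicator (einterval (ereal s) \<infinity>) x *\<^sub>R ?f x) \<le> norm (indicator {s..} x * exp (- x))"
        using bd by (intro AE_I2) (auto simp: indicator_def einterval_def)
    qed simp
    have "(?F \<longlongrightarrow> ?F s) (at_right s)"
    proof -
      have "isCont ?F s" by (intro continuous_intros pgf_isCont)
      then show ?thesis unfolding isCont_def by (rule tendsto_within_subset) auto
    qed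
    then show "((?F \<circ> real_of_ereal) \<longlongrightarrow> ?F s) (at_right (ereal s))"
      by (simp add: ereal_tendsto_simps)
    have "((\<lambda>y. exp (- y)) \<longlongrightarrow> (0::real)) at_top"
      by (rule filterlim_compose[OF exp_at_bot filterlim_uminus_at_bot_at_top])
    then have "((\<lambda>y. - exp (- y) * pgf y) \<longlongrightarrow> - 0 * 1) at_top"
      by (intro tendsto_mult tendsto_minus pgf_at_top)
    then show "((?F \<circ> real_of_ereal) \<longlongrightarrow> 0) (at_left \<infinity>)"
      by (simp add: ereal_tendsto_simps)
  qed auto
  then have "(\<integral>y. indicator {s<..} y * ?f y \<partial>lborel) = exp (- s) * pgf s"
    by (simp add: interval_integral_to_infinity_eq set_lebesgue_integral_def)
  also have "(\<integral>y. indicator {s<..} y * ?f y \<partial>lborel) = (\<integral>w. indicator {s<..} (s + 1 * w) * ?f (s + 1 * w) \<partial>lborel)"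
    using lborel_integral_real_affine[of 1 "\<lambda>y. indicator {s<..} y * ?f y" s] by simp
  also have "\<dots> = (\<integral>w. exp (- s) * (indicator {0<..} w * (exp (- w) * psi (s + w) * pgf (s + w))) \<partial>lborel)"
    by (intro Bochner_Integration.integral_cong) (auto simp: indicator_def exp_add[symmetric] mult_ac exp_diff exp_minus field_simps)
  finally show ?thesis by simp
qed

end

section \<open>The law of a stable series\<close>

context lepage begin

text \<open>What is known after \<open>n\<close> complete steps: the first \<open>n\<close> waiting times, marks and signs.\<close>
definition past :: "nat \<Rightarrow> 'a measure" where
  "past n = gen_algebra M \<xi> ({0, 1, 2} \<times> {..<n})"

lemma past_measurable:
  assumes "i < n"
  shows "W i \<in> borel_measurable (past n)" "V i \<in> borel_measurable (past n)"
    "\<gamma> i \<in> borel_measurable (past n)" "\<Gamma> i \<in> borel_measurable (past n)"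
proof -
  have *: "j \<in> {0, 1, 2} \<times> {..<n} \<Longrightarrow> \<xi> j \<in> borel_measurable (past n)" for j
    unfolding past_def by (rule measurable_gen_algebra)
  have W: "W j \<in> borel_measurable (past n)" if "j < n" for j
    using *[of "(0, j)"] that by (simp add: \<xi>_simps)
  show "W i \<in> borel_measurable (past n)" using W assms .
  show "V i \<in> borel_measurable (past n)" using *[of "(1, i)"] assms by (simp add: \<xi>_simps)
  show "\<gamma> i \<in> borel_measurable (past n)" using *[of "(2, i)"] assms by (simp add: \<xi>_simps)
  show "\<Gamma> i \<in> borel_measurable (past n)"
    by (subst arrival_eq_sum', intro borel_measurable_sum W) (use assms in auto)
qed

lemma distr_V: "distr M borel (V i) = density lborel dyadic_block_density"
proof -
  have "distr M borel (V i) = distr M lborel (V i)" by (rule distr_cong) auto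
  then show ?thesis by (simp only: distributed_distr_eq_density[OF V_distributed])
qed

lemma distr_W: "distr M borel (W i) = density lborel (exponential_density 1)"
proof -
  have "distr M borel (W i) = distr M lborel (W i)" by (rule distr_cong) auto
  then show ?thesis by (simp only: distributed_distr_eq_density[OF W_distributed])
qed

lemma AE_summable_stable_series:
  assumes a: "0 < a" "a < 2" and [measurable]: "k \<in> borel_measurable borel" and k: "\<And>v. \<bar>k v\<bar> \<le> \<kappa>"
  shows "AE \<omega> in M. summable (\<lambda>i. \<gamma> i \<omega> * (\<Gamma> i \<omega> powr (- 1 / a) * k (V i \<omega>)))"
proof (rule AE_summable_sign_series)
  have "1 < 2 / a" using a by simp
  from AE_summable_arrival_powr[OF this]
  show "AE \<omega> in M. summable (\<lambda>i. (\<Gamma> i \<omega> powr (- 1 / a) * k (V i \<omega>))\<^sup>2)"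
  proof eventually_elim
    case (elim \<omega>)
    show ?case
    proof (rule summable_comparison_test'[where N=0])
      show "summable (\<lambda>i. \<Gamma> i \<omega> powr - (2 / a) * \<kappa>\<^sup>2)" using elim by (rule summable_mult2)
      fix n :: nat
      have "(\<Gamma> n \<omega> powr (- 1 / a))\<^sup>2 = \<Gamma> n \<omega> powr - (2 / a)"
        by (simp add: power2_eq_square powr_add[symmetric])
      moreover have "(k (V n \<omega>))\<^sup>2 \<le> \<kappa>\<^sup>2"
        using k[of "V n \<omega>"] by (metis abs_ge_zero power2_abs power_mono)
      ultimately show "norm ((\<Gamma> n \<omega> powr (- 1 / a) * k (V n \<omega>))\<^sup>2) \<le> \<Gamma> n \<omega> powr - (2 / a) * \<kappa>\<^sup>2"
        by (simp add: power_mult_distrib mult_left_mono)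
    qed
  qed
qed measurable

text \<open>With \<open>T n\<close> the time of the last of the first \<open>n\<close> arrivals, the expectation of \<open>cos (P n + \<phi>) * pgf (T n)\<close>
does not depend on \<open>n\<close>: averaging over the sign, the mark and the waiting time of step \<open>n\<close>, in this order, turns the
factor for \<open>n + 1\<close> into the one for \<open>n\<close>. At \<open>n = 0\<close> it is \<open>cos \<phi> * pgf 0\<close>; as \<open>n\<close> tends to
infinity, \<open>pgf (T n)\<close> tends to 1.\<close>
lemma expectation_cos_stable_series:
  assumes a: "1 < a" "a < 2" and k_meas[measurable]: "k \<in> borel_measurable borel" and k: "\<And>v. \<bar>k v\<bar> \<le> \<kappa>"
  shows "expectation (\<lambda>\<omega>. cos ((\<Sum>i. \<gamma> i \<omega> * (\<Gamma> i \<omega> powr (- 1 / a) * k (V i \<omega>))) + \<phi>)) =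
    cos \<phi> * exp (- (stable_integral a * (\<integral>v. \<bar>k v\<bar> powr a \<partial>density lborel dyadic_block_density)))"
proof -
  let ?\<mu> = "distr M borel (V 0)"
  have sk: "stable_kernel ?\<mu> a k \<kappa>"
    unfolding stable_kernel_def stable_kernel_axioms_def
    using a k by (auto intro: prob_space_distr)
  interpret K: stable_kernel ?\<mu> a k \<kappa> by (rule sk)
  have law_V: "distr M borel (V n) = ?\<mu>" for n by (simp only: distr_V)
  define A where "A i \<omega> = \<Gamma> i \<omega> powr (- 1 / a) * k (V i \<omega>)" for i \<omega>
  have AM0: "A i \<in> borel_measurable (marks 0)" for i unfolding A_def[abs_def] by measurable
  have AM[measurable]: "A i \<in> borel_measurable M" for i using AM0 by (rule marksD)
  define P where "P = psum A"
  have PM[measurable]: "P n \<in> borel_measurable M" for n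
    unfolding P_def using psum_measurable[OF AM0] by (rule marksD)
  \<comment> \<open>Here \<open>T 0 = 0\<close> and \<open>T (Suc n) = \<Gamma> n\<close>, as arrivals are numbered from 0.\<close>
  define T where "T n \<omega> = (\<Sum>i<n. W i \<omega>)" for n \<omega>
  have TM[measurable]: "T n \<in> borel_measurable M" for n unfolding T_def[abs_def] by measurable
  have T_Suc: "T (Suc n) \<omega> = \<Gamma> n \<omega>" for n \<omega>
    unfolding T_def by (subst arrival_eq_sum) (simp only: lessThan_Suc_atMost)
  have T_W: "\<Gamma> n \<omega> = T n \<omega> + W n \<omega>" for n \<omega>
  proof -
    have "T (Suc n) \<omega> = T n \<omega> + W n \<omega>" by (simp add: T_def)
    then show ?thesis by (simp only: T_Suc)
  qed
  have T0: "AE \<omega> in M. 0 \<le> T n \<omega>" for n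
  proof (cases n)
    case (Suc m)
    show ?thesis unfolding Suc T_Suc using AE_arrival_pos[of m] by eventually_elim simp
  qed (simp add: T_def)
  have Ppast: "P n \<in> borel_measurable (past n)" for n
  proof -
    have "(\<lambda>\<omega>. \<gamma> i \<omega> * A i \<omega>) \<in> borel_measurable (past n)" if "i < n" for i
    proof -
      note [measurable] = past_measurable[OF that]
      show ?thesis unfolding A_def by measurable
    qed
    then show ?thesis unfolding P_def psum_def[abs_def] by (intro borel_measurable_sum) auto
  qed
  have Tpast: "T n \<in> borel_measurable (past n)" for n
    unfolding T_def[abs_def] by (intro borel_measurable_sum past_measurable) auto
  have pgf1: "\<bar>K.pgf s\<bar> \<le> 1" for s using K.pgf_bounds[of s] by simp
  have cc: "\<bar>x * y\<bar> \<le> 1" if "\<bar>x\<bar> \<le> 1" "\<bar>y\<bar> \<le> 1" for x y :: real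
    using mult_mono[OF that] by (simp add: abs_mult)
  define e where "e n = expectation (\<lambda>\<omega>. cos (P n \<omega> + \<phi>) * K.pgf (T n \<omega>))" for n
  have step: "e (Suc n) = e n" for n
  proof -
    have "e (Suc n) = expectation (\<lambda>\<omega>. cos (P n \<omega> + \<phi>) * cos (A n \<omega>) * K.pgf (\<Gamma> n \<omega>)
        - \<gamma> n \<omega> * (sin (P n \<omega> + \<phi>) * sin (A n \<omega>) * K.pgf (\<Gamma> n \<omega>)))"
      unfolding e_def
    proof (rule integral_cong_AE)
      show "AE \<omega> in M. cos (P (Suc n) \<omega> + \<phi>) * K.pgf (T (Suc n) \<omega>) =
        cos (P n \<omega> + \<phi>) * cos (A n \<omega>) * K.pgf (\<Gamma> n \<omega>)
        - \<gamma> n \<omega> * (sin (P n \<omega> + \<phi>) * sin (A n \<omega>) * K.pgf (\<Gamma> n \<omega>))"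
        using AE_sign[of n]
      proof eventually_elim
        case (elim \<omega>)
        have "P (Suc n) \<omega> + \<phi> = (P n \<omega> + \<phi>) + \<gamma> n \<omega> * A n \<omega>" by (simp add: P_def psum_def)
        then have "cos (P (Suc n) \<omega> + \<phi>) = cos (P n \<omega> + \<phi>) * cos (\<gamma> n \<omega> * A n \<omega>) - sin (P n \<omega> + \<phi>) * sin (\<gamma> n \<omega> * A n \<omega>)"
          by (simp only: cos_add)
        moreover have "cos (\<gamma> n \<omega> * A n \<omega>) = cos (A n \<omega>)" "sin (\<gamma> n \<omega> * A n \<omega>) = \<gamma> n \<omega> * sin (A n \<omega>)"
          using elim by auto
        ultimately have "cos (P (Suc n) \<omega> + \<phi>) = cos (P n \<omega> + \<phi>) * cos (A n \<omega>) - \<gamma> n \<omega> * (sin (P n \<omega> + \<phi>) * sin (A n \<omega>))"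
          by simp
        then show ?case by (simp only: T_Suc left_diff_distrib mult.assoc)
      qed
    qed measurable
    also have "\<dots> = expectation (\<lambda>\<omega>. cos (P n \<omega> + \<phi>) * cos (A n \<omega>) * K.pgf (\<Gamma> n \<omega>))"
    proof -
      have Y: "(\<lambda>\<omega>. sin (P n \<omega> + \<phi>) * sin (A n \<omega>) * K.pgf (\<Gamma> n \<omega>)) \<in> borel_measurable (marks n)"
      proof -
        have [measurable]: "P n \<in> borel_measurable (marks n)" unfolding P_def using AM0 by (rule psum_measurable)
        have [measurable]: "A n \<in> borel_measurable (marks n)" using AM0 by (rule marks_mono)
        show ?thesis by measurable
      qed
      have bd: "\<bar>sin (P n \<omega> + \<phi>) * sin (A n \<omega>) * K.pgf (\<Gamma> n \<omega>)\<bar> \<le> 1" for \<omega>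
        by (intro cc pgf1) auto
      have "integrable M (\<lambda>\<omega>. cos (P n \<omega> + \<phi>) * cos (A n \<omega>) * K.pgf (\<Gamma> n \<omega>))"
      proof (rule integrable_const_bound[where B=1])
        show "AE \<omega> in M. norm (cos (P n \<omega> + \<phi>) * cos (A n \<omega>) * K.pgf (\<Gamma> n \<omega>)) \<le> 1"
          unfolding real_norm_def by (intro AE_I2 cc pgf1) auto
      qed simp
      then show ?thesis using sign_orthogonal[OF Y bd] by (subst Bochner_Integration.integral_diff) auto
    qed
    also have "\<dots> = expectation (\<lambda>\<omega>. cos (P n \<omega> + \<phi>) * K.psi (\<Gamma> n \<omega>) * K.pgf (\<Gamma> n \<omega>))"
    proof -
      let ?f = "\<lambda>x :: (real \<times> real) \<times> real.
        cos (fst (fst x) + \<phi>) * cos (snd (fst x) powr (- 1 / a) * k (snd x)) * K.pgf (snd (fst x))"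
      let ?K = "{0, 1, 2} \<times> {..<n} \<union> {(0, n)}"
      have "expectation (\<lambda>\<omega>. ?f ((P n \<omega>, \<Gamma> n \<omega>), \<xi> (1, n) \<omega>)) =
        expectation (\<lambda>\<omega>. \<integral>v. ?f ((P n \<omega>, \<Gamma> n \<omega>), v) \<partial>distr M borel (\<xi> (1, n)))"
      proof (rule expectation_freeze[OF \<xi>_indep, where f = ?f and K = ?K and C = 1 and Y = "\<lambda>\<omega>. (P n \<omega>, \<Gamma> n \<omega>)"
            and N = "borel \<Otimes>\<^sub>M borel"])
        show "(\<lambda>\<omega>. (P n \<omega>, \<Gamma> n \<omega>)) \<in> measurable (gen_algebra M \<xi> ?K) (borel \<Otimes>\<^sub>M borel)"
        proof (rule measurable_Pair)
          show "P n \<in> borel_measurable (gen_algebra M \<xi> ?K)"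
            using Ppast[of n] unfolding past_def by (rule gen_algebra_mono[rotated]) auto
          have "T n \<in> borel_measurable (gen_algebra M \<xi> ?K)"
            using Tpast[of n] unfolding past_def by (rule gen_algebra_mono[rotated]) auto
          moreover have "W n \<in> borel_measurable (gen_algebra M \<xi> ?K)"
            using measurable_gen_algebra[of "(0, n)" ?K \<xi> M] by (simp add: \<xi>_simps)
          ultimately have "(\<lambda>\<omega>. T n \<omega> + W n \<omega>) \<in> borel_measurable (gen_algebra M \<xi> ?K)"
            by (rule borel_measurable_add)
          then show "\<Gamma> n \<in> borel_measurable (gen_algebra M \<xi> ?K)"
            by (simp only: T_W[symmetric])
        qed
        show "\<bar>?f x\<bar> \<le> 1" for x
          by (intro cc pgf1) auto
      qed auto
      moreover have "(\<integral>v. cos (g powr - (1 / a) * k v) \<partial>distr M borel (V n)) = K.psi g" for g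
        by (simp add: law_V[of n] K.psi_def)
      ultimately show ?thesis by (simp add: \<xi>_simps A_def)
    qed
    also have "\<dots> = expectation (\<lambda>\<omega>. cos (P n \<omega> + \<phi>) * K.pgf (T n \<omega>))"
    proof -
      let ?f = "\<lambda>x :: (real \<times> real) \<times> real.
        cos (fst (fst x) + \<phi>) * (K.psi (snd (fst x) + snd x) * K.pgf (snd (fst x) + snd x))"
      have "expectation (\<lambda>\<omega>. ?f ((P n \<omega>, T n \<omega>), \<xi> (0, n) \<omega>)) =
        expectation (\<lambda>\<omega>. \<integral>w. ?f ((P n \<omega>, T n \<omega>), w) \<partial>distr M borel (\<xi> (0, n)))"
      proof (rule expectation_freeze[OF \<xi>_indep, where f = ?f and K = "{0, 1, 2} \<times> {..<n}" and C = 1 and Y = "\<lambda>\<omega>. (P n \<omega>, T n \<omega>)"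
            and N = "borel \<Otimes>\<^sub>M borel"])
        show "(\<lambda>\<omega>. (P n \<omega>, T n \<omega>)) \<in> measurable (gen_algebra M \<xi> ({0, 1, 2} \<times> {..<n})) (borel \<Otimes>\<^sub>M borel)"
          unfolding past_def[symmetric] by (intro measurable_Pair Ppast Tpast)
        show "\<bar>?f x\<bar> \<le> 1" for x
          by (intro cc pgf1 K.psi_bound) auto
      qed auto
      moreover have "(\<integral>w. ?f ((p, s), w) \<partial>distr M borel (\<xi> (0, n))) = cos (p + \<phi>) * K.pgf s" if s: "0 \<le> s" for p s
      proof -
        have "(\<integral>w. K.psi (s + w) * K.pgf (s + w) \<partial>distr M borel (W n)) =
          (\<integral>w. exponential_density 1 w * (K.psi (s + w) * K.pgf (s + w)) \<partial>lborel)"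
          unfolding distr_W by (subst integral_real_density) (auto simp: exponential_density_nonneg)
        also have "\<dots> = (\<integral>w. indicator {0<..} w * (exp (- w) * K.psi (s + w) * K.pgf (s + w)) \<partial>lborel)"
        proof (rule integral_cong_AE)
          have "AE w::real in lborel. w \<noteq> 0" by (rule AE_lborel_singleton)
          then show "AE w in lborel. exponential_density 1 w * (K.psi (s + w) * K.pgf (s + w)) =
            indicator {0<..} w * (exp (- w) * K.psi (s + w) * K.pgf (s + w))"
            by eventually_elim (auto simp: exponential_density_def indicator_def)
        qed auto
        also have "\<dots> = K.pgf s" by (rule K.pgf_renewal[OF s])
        finally show ?thesis by (simp add: \<xi>_simps)
      qed
      ultimately show ?thesis
      proof -
        assume 1: "expectation (\<lambda>\<omega>. ?f ((P n \<omega>, T n \<omega>), \<xi> (0, n) \<omega>)) =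
            expectation (\<lambda>\<omega>. \<integral>w. ?f ((P n \<omega>, T n \<omega>), w) \<partial>distr M borel (\<xi> (0, n)))"
          and 2: "\<And>s p. 0 \<le> s \<Longrightarrow> (\<integral>w. ?f ((p, s), w) \<partial>distr M borel (\<xi> (0, n))) = cos (p + \<phi>) * K.pgf s"
        have "expectation (\<lambda>\<omega>. \<integral>w. ?f ((P n \<omega>, T n \<omega>), w) \<partial>distr M borel (\<xi> (0, n))) =
          expectation (\<lambda>\<omega>. cos (P n \<omega> + \<phi>) * K.pgf (T n \<omega>))"
        proof (rule integral_cong_AE)
          show "AE \<omega> in M. (\<integral>w. ?f ((P n \<omega>, T n \<omega>), w) \<partial>distr M borel (\<xi> (0, n))) = cos (P n \<omega> + \<phi>) * K.pgf (T n \<omega>)"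
            using T0[of n] by eventually_elim (rule 2)
          interpret Z: prob_space "distr M borel (\<xi> (0, n))"
            unfolding \<xi>_simps by (rule prob_space_distr) simp
          show "(\<lambda>\<omega>. \<integral>w. ?f ((P n \<omega>, T n \<omega>), w) \<partial>distr M borel (\<xi> (0, n))) \<in> borel_measurable M"
            by measurable
        qed measurable
        with 1 show ?thesis by (simp add: \<xi>_simps T_W[symmetric] mult.assoc)
      qed
    qed
    finally show ?thesis unfolding e_def .
  qed
  have e0: "e n = cos \<phi> * K.pgf 0" for n
  proof (induction n)
    case 0
    then show ?case by (simp add: e_def P_def psum_def T_def prob_space)
  qed (simp add: step)
  have "e \<longlonglongrightarrow> expectation (\<lambda>\<omega>. cos ((\<Sum>i. \<gamma> i \<omega> * A i \<omega>) + \<phi>) * 1)"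
    unfolding e_def
  proof (rule integral_dominated_convergence[where w="\<lambda>_. 1"])
    have sm: "AE \<omega> in M. summable (\<lambda>i. \<gamma> i \<omega> * A i \<omega>)"
      unfolding A_def using a by (intro AE_summable_stable_series[OF _ _ k_meas k]) auto
    from sm AE_arrival_at_top
    show "AE \<omega> in M. (\<lambda>n. cos (P n \<omega> + \<phi>) * K.pgf (T n \<omega>)) \<longlonglongrightarrow> cos ((\<Sum>i. \<gamma> i \<omega> * A i \<omega>) + \<phi>) * 1"
    proof eventually_elim
      case (elim \<omega>)
      have "(\<lambda>n. K.pgf (T (Suc n) \<omega>)) \<longlonglongrightarrow> 1"
        unfolding T_Suc by (rule filterlim_compose[OF K.pgf_at_top elim(2)])
      then have "(\<lambda>n. K.pgf (T n \<omega>)) \<longlonglongrightarrow> 1" by (rule LIMSEQ_imp_Suc)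
      moreover have "(\<lambda>n. P n \<omega>) \<longlonglongrightarrow> (\<Sum>i. \<gamma> i \<omega> * A i \<omega>)"
        unfolding P_def psum_def by (rule summable_LIMSEQ[OF elim(1)])
      ultimately show ?case by (intro tendsto_mult tendsto_cos tendsto_add tendsto_const)
    qed
    show "AE \<omega> in M. norm (cos (P n \<omega> + \<phi>) * K.pgf (T n \<omega>)) \<le> 1" for n
      unfolding real_norm_def by (intro AE_I2 cc pgf1) auto
  qed auto
  moreover have "e \<longlonglongrightarrow> cos \<phi> * K.pgf 0" unfolding e0[abs_def] by (rule tendsto_const)
  ultimately have "expectation (\<lambda>\<omega>. cos ((\<Sum>i. \<gamma> i \<omega> * A i \<omega>) + \<phi>) * 1) = cos \<phi> * K.pgf 0"
    by (rule LIMSEQ_unique)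
  also have "K.pgf 0 = exp (- (stable_integral a * (\<integral>v. \<bar>k v\<bar> powr a \<partial>density lborel dyadic_block_density)))"
    unfolding K.pgf_def K.tail_0 by (simp only: distr_V)
  finally show ?thesis by (simp add: A_def)
qed

end

section \<open>Kernels on the half line and on the line\<close>

text \<open>The factor \<open>2 powr (j / a)\<close> of the block that contains \<open>v\<close>; it is the density of the marks to the power
\<open>- 1 / a\<close>.\<close>
definition block_weight :: "real \<Rightarrow> real \<Rightarrow> real" where
  "block_weight a v = 2 powr (real (Suc (nat \<lfloor>v\<rfloor>)) / a)"

lemma block_weight_measurable[measurable]: "block_weight a \<in> borel_measurable borel"
  unfolding block_weight_def[abs_def] by measurable

lemma mem_block_iff: "v \<in> {real j..<real (Suc j)} \<longleftrightarrow> 0 \<le> v \<and> j = nat \<lfloor>v\<rfloor>"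
  by (auto simp: nat_eq_iff floor_eq_iff) linarith+

text \<open>At most one block contains \<open>v\<close>; for negative \<open>v\<close> both sides vanish.\<close>
lemma suminf_blocks:
  "(\<Sum>j. c * 2 powr (real (Suc j) / a) * indicator ({0..t} \<inter> {real j..<real (Suc j)}) v) =
    c * (block_weight a v * indicator {0..t} v)"
proof -
  have sing: "sum f {n} = f n" for f :: "nat \<Rightarrow> real" and n by simp
  define n where "n = nat \<lfloor>v\<rfloor>"
  have "(\<Sum>j. c * 2 powr (real (Suc j) / a) * indicator ({0..t} \<inter> {real j..<real (Suc j)}) v) =
    (\<Sum>j\<in>{n}. c * 2 powr (real (Suc j) / a) * indicator ({0..t} \<inter> {real j..<real (Suc j)}) v)"
  proof (rule suminf_finite)
    fix j assume "j \<notin> {n}"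
    then have "v \<notin> {real j..<real (Suc j)}" unfolding mem_block_iff n_def by simp
    then show "c * 2 powr (real (Suc j) / a) * indicator ({0..t} \<inter> {real j..<real (Suc j)}) v = 0"
      by simp
  qed simp
  also have "\<dots> = c * 2 powr (real (Suc n) / a) * indicator ({0..t} \<inter> {real n..<real (Suc n)}) v"
    by (rule sing)
  also have "indicator ({0..t} \<inter> {real n..<real (Suc n)}) v = (indicator {0..t} v :: real)"
    using mem_block_iff[of v n] by (auto simp: indicator_def n_def)
  finally show ?thesis by (simp add: block_weight_def n_def mult.assoc)
qed

lemma block_weight_le:
  assumes "0 < a" "0 \<le> v" "v \<le> T"
  shows "block_weight a v \<le> 2 powr ((T + 1) / a)"
  unfolding block_weight_def
proof (intro powr_mono divide_right_mono)
  have "real (nat \<lfloor>v\<rfloor>) \<le> v" using assms of_int_floor_le[of v] by simp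
  then show "real (Suc (nat \<lfloor>v\<rfloor>)) \<le> T + 1" using assms(3) unfolding of_nat_Suc by linarith
qed (use assms in auto)

lemma block_weight_indicator_le:
  assumes "0 < a" "t \<le> T" "0 \<le> T"
  shows "\<bar>block_weight a v * indicator {0..t} v\<bar> \<le> 2 powr ((T + 1) / a)"
proof (cases "v \<in> {0..t}")
  case True
  then have "block_weight a v \<le> 2 powr ((T + 1) / a)" using assms by (intro block_weight_le) auto
  then show ?thesis using True by (simp add: block_weight_def)
qed simp

lemma dyadic_block_density_eq:
  "dyadic_block_density x = ennreal (indicator {0..} x * (1/2) ^ Suc (nat \<lfloor>x\<rfloor>))"
proof -
  have "dyadic_block_density x = (\<Sum>j\<in>{nat \<lfloor>x\<rfloor>}. ennreal ((1/2) ^ Suc j) * indicator {real j..<real (Suc j)} x)"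
    unfolding dyadic_block_density_def
  proof (rule suminf_finite)
    fix j assume "j \<notin> {nat \<lfloor>x\<rfloor>}"
    then have "x \<notin> {real j..<real (Suc j)}" unfolding mem_block_iff by simp
    then show "ennreal ((1/2) ^ Suc j) * indicator {real j..<real (Suc j)} x = 0" by simp
  qed simp
  also have "\<dots> = ennreal (indicator {0..} x * (1/2) ^ Suc (nat \<lfloor>x\<rfloor>))"
    using mem_block_iff[of x "nat \<lfloor>x\<rfloor>"] by (cases "0 \<le> x") (auto simp: indicator_def)
  finally show ?thesis .
qed

text \<open>The weights compensate the density of the marks, so that Lebesgue measure is the control measure.\<close>
lemma integral_block_weight:
  assumes a: "0 < a" and [measurable]: "f \<in> borel_measurable borel"
  shows "(\<integral>v. \<bar>block_weight a v * f v\<bar> powr a \<partial>density lborel dyadic_block_density) =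
    (\<integral>v. indicator {0..} v * \<bar>f v\<bar> powr a \<partial>lborel)"
proof -
  have "(\<integral>v. \<bar>block_weight a v * f v\<bar> powr a \<partial>density lborel dyadic_block_density) =
    (\<integral>v. indicator {0..} v * (1/2) ^ Suc (nat \<lfloor>v\<rfloor>) * \<bar>block_weight a v * f v\<bar> powr a \<partial>lborel)"
    unfolding dyadic_block_density_eq[abs_def] by (subst integral_real_density) auto
  also have "\<dots> = (\<integral>v. indicator {0..} v * \<bar>f v\<bar> powr a \<partial>lborel)"
  proof (intro Bochner_Integration.integral_cong refl)
    fix v :: real
    have "\<bar>block_weight a v * f v\<bar> powr a = block_weight a v powr a * \<bar>f v\<bar> powr a"
      by (simp add: abs_mult powr_mult block_weight_def)
    also have "block_weight a v powr a = 2 powr real (Suc (nat \<lfloor>v\<rfloor>))"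
      unfolding block_weight_def powr_powr using a by simp
    also have "\<dots> = 2 ^ Suc (nat \<lfloor>v\<rfloor>)" by (rule powr_realpow) simp
    finally show "indicator {0..} v * (1/2) ^ Suc (nat \<lfloor>v\<rfloor>) * \<bar>block_weight a v * f v\<bar> powr a =
      indicator {0..} v * \<bar>f v\<bar> powr a"
      by (simp add: power_one_over)
  qed
  finally show ?thesis .
qed

text \<open>The integrand of \<^const>\<open>levy_motion\<close>, including the sign for negative times.\<close>
definition signed_interval :: "real \<Rightarrow> real \<Rightarrow> real" where
  "signed_interval t y = (if 0 \<le> t then indicator {0..t} y else - indicator {t..0} y)"

lemma signed_interval_measurable[measurable]: "signed_interval t \<in> borel_measurable borel"
  unfolding signed_interval_def[abs_def] by measurable

lemma signed_interval_bound: "\<bar>signed_interval t y\<bar> \<le> 1"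
  by (simp add: signed_interval_def indicator_def)

lemma signed_interval_support: "signed_interval t y \<noteq> 0 \<Longrightarrow> \<bar>y\<bar> \<le> \<bar>t\<bar>"
  by (auto simp: signed_interval_def indicator_def split: if_splits)

text \<open>The exponent in the characteristic function of \<open>\<Sum>t\<in>J. w t * L t\<close> for a Levy motion \<open>L\<close> of index \<open>a\<close>.\<close>
definition levy_exponent :: "real \<Rightarrow> real set \<Rightarrow> (real \<Rightarrow> real) \<Rightarrow> real" where
  "levy_exponent a J w = (\<integral>y. \<bar>\<Sum>t\<in>J. w t * signed_interval t y\<bar> powr a \<partial>lborel)"

lemma signed_interval_sum_support:
  assumes "finite J" "(\<Sum>t\<in>J. w t * signed_interval t y) \<noteq> 0"
  shows "\<bar>y\<bar> \<le> (\<Sum>t\<in>J. \<bar>t\<bar>)"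
proof -
  from assms(2) obtain t where t: "t \<in> J" "w t * signed_interval t y \<noteq> 0"
    by (meson sum.neutral)
  then have "\<bar>y\<bar> \<le> \<bar>t\<bar>" by (intro signed_interval_support) auto
  also have "\<dots> \<le> (\<Sum>t\<in>J. \<bar>t\<bar>)" using t assms(1) by (intro member_le_sum) auto
  finally show ?thesis .
qed

lemma signed_interval_sum_bound: "\<bar>\<Sum>t\<in>J. w t * signed_interval t y\<bar> \<le> (\<Sum>t\<in>J. \<bar>w t\<bar>)"
proof -
  have "\<bar>\<Sum>t\<in>J. w t * signed_interval t y\<bar> \<le> (\<Sum>t\<in>J. \<bar>w t * signed_interval t y\<bar>)" by (rule sum_abs)
  also have "\<dots> \<le> (\<Sum>t\<in>J. \<bar>w t\<bar>)"
    using signed_interval_bound by (intro sum_mono) (simp add: abs_mult mult_left_le)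
  finally show ?thesis .
qed

lemma signed_interval_sum_Lp:
  assumes "finite J" "0 < a"
  shows "(\<lambda>y. \<Sum>t\<in>J. w t * signed_interval t y) \<in> Lp_real a"
proof -
  let ?f = "\<lambda>y. \<Sum>t\<in>J. w t * signed_interval t y"
  let ?T = "\<Sum>t\<in>J. \<bar>t\<bar>" and ?C = "\<Sum>t\<in>J. \<bar>w t\<bar>"
  have "integrable lborel (\<lambda>y. \<bar>?f y\<bar> powr a)"
  proof (rule Bochner_Integration.integrable_bound)
    have "0 \<le> ?T" by (rule sum_nonneg) simp
    then show "integrable lborel (\<lambda>y. indicator {- ?T..?T} y * ?C powr a)"
      by (intro integrable_mult_left integrable_real_indicator) auto
    show "AE y in lborel. norm (\<bar>?f y\<bar> powr a) \<le> norm (indicator {- ?T..?T} y * ?C powr a)"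
    proof (rule AE_I2)
      fix y
      show "norm (\<bar>?f y\<bar> powr a) \<le> norm (indicator {- ?T..?T} y * ?C powr a)"
      proof (cases "?f y = 0")
        case False
        have "y \<in> {- ?T..?T}" using signed_interval_sum_support[OF assms(1) False] by auto
        moreover have "\<bar>?f y\<bar> powr a \<le> ?C powr a"
          using assms(2) by (intro powr_mono2 signed_interval_sum_bound) auto
        ultimately show ?thesis by simp
      qed (use assms in simp)
    qed
  qed measurable
  moreover have "?f \<in> borel_measurable lborel" by measurable
  ultimately show ?thesis by (simp add: Lp_real_def)
qed

text \<open>Self-similarity: the substitution \<open>x = u + r * y\<close>. The condition \<open>0 \<le> u + r * t\<close> makes the restriction to
\<open>x \<ge> 0\<close> harmless.\<close>
lemma levy_exponent_rescaled:
  assumes J: "finite J" and r: "0 < r" and u: "0 \<le> u" "\<And>t. t \<in> J \<Longrightarrow> 0 \<le> u + r * t" and a: "0 < a"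
  shows "(\<integral>x. indicator {0..} x * \<bar>\<Sum>t\<in>J. w t * (indicator {0..u + r * t} x - indicator {0..u} x)\<bar> powr a \<partial>lborel) =
    r * levy_exponent a J w"
proof -
  let ?f = "\<lambda>x. indicator {0..} x * \<bar>\<Sum>t\<in>J. w t * (indicator {0..u + r * t} x - indicator {0..u} x)\<bar> powr a"
  have "(\<integral>x. ?f x \<partial>lborel) = \<bar>r\<bar> *\<^sub>R (\<integral>y. ?f (u + r * y) \<partial>lborel)"
    using r by (intro lborel_integral_real_affine) auto
  also have "(\<integral>y. ?f (u + r * y) \<partial>lborel) = levy_exponent a J w"
    unfolding levy_exponent_def
  proof (rule integral_cong_AE)
    have "AE y::real in lborel. y \<notin> insert 0 J"
      by (rule AE_not_in) (intro countable_imp_null_set_lborel countable_finite finite.insertI J)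
    then show "AE y in lborel. ?f (u + r * y) = \<bar>\<Sum>t\<in>J. w t * signed_interval t y\<bar> powr a"
    proof eventually_elim
      case (elim y)
      have le: "r * y \<le> r * t \<longleftrightarrow> y \<le> t" "r * y \<le> 0 \<longleftrightarrow> y \<le> 0" for t
        using r by (auto simp: mult_le_0_iff)
      show ?case
      proof (cases "0 \<le> u + r * y")
        case True
        have "indicator {0..u + r * t} (u + r * y) - indicator {0..u} (u + r * y) = signed_interval t y"
          if "t \<in> J" for t
          using True elim that by (auto simp: indicator_def le signed_interval_def)
        then show ?thesis using True by (simp cong: sum.cong)
      next
        case False
        have "signed_interval t y = 0" if "t \<in> J" for t
        proof -
          have "\<not> u \<le> u + r * y" using False u(1) by linarith
          then have "y < 0" using r by (simp add: zero_le_mult_iff)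
          moreover have "\<not> t \<le> y"
          proof
            assume "t \<le> y"
            then have "r * t \<le> r * y" using r by simp
            then show False using False u(2)[OF that] by linarith
          qed
          ultimately show ?thesis by (simp add: signed_interval_def)
        qed
        then show ?thesis using False a by simp
      qed
    qed
  qed measurable
  finally show ?thesis using r by simp
qed

text \<open>A measure-preserving rearrangement of the half line into the line, which moves the block \<open>[n, n + 1)\<close> to
\<open>[m, m + 1)\<close>, where \<open>m = int_decode n\<close> runs through all integers.\<close>
definition half_to_line :: "real \<Rightarrow> real" where
  "half_to_line x = x - real (nat \<lfloor>x\<rfloor>) + real_of_int (int_decode (nat \<lfloor>x\<rfloor>))"

lemma half_to_line_measurable[measurable]: "half_to_line \<in> borel_measurable borel"
proof -
  have "(\<lambda>x::real. real_of_int (int_decode (nat \<lfloor>x\<rfloor>))) \<in> borel_measurable borel"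
    by measurable
  then show ?thesis unfolding half_to_line_def[abs_def] by measurable
qed

lemma nn_integral_half_to_line:
  fixes F :: "real \<Rightarrow> ennreal"
  assumes [measurable]: "F \<in> borel_measurable borel"
  shows "(\<integral>\<^sup>+x. indicator {0..} x * F (half_to_line x) \<partial>lborel) = (\<integral>\<^sup>+y. F y \<partial>lborel)"
proof -
  let ?I = "\<lambda>n::nat. {real n..<real (Suc n)}"
  let ?D = "\<lambda>n. real_of_int (int_decode n)"
  have dec: "indicator {0..} x * F (half_to_line x) = (\<Sum>n. indicator (?I n) x * F (x - real n + ?D n))" for x
  proof -
    have "(\<Sum>n. indicator (?I n) x * F (x - real n + ?D n)) =
      (\<Sum>n\<in>{nat \<lfloor>x\<rfloor>}. indicator (?I n) x * F (x - real n + ?D n))"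
    proof (rule suminf_finite)
      fix n assume "n \<notin> {nat \<lfloor>x\<rfloor>}"
      then have "x \<notin> ?I n" unfolding mem_block_iff by simp
      then show "indicator (?I n) x * F (x - real n + ?D n) = 0" by simp
    qed simp
    also have "\<dots> = indicator {0..} x * F (half_to_line x)"
      using mem_block_iff[of x "nat \<lfloor>x\<rfloor>"] by (cases "0 \<le> x") (auto simp: indicator_def half_to_line_def)
    finally show ?thesis ..
  qed
  have "(\<integral>\<^sup>+x. indicator {0..} x * F (half_to_line x) \<partial>lborel) =
    (\<Sum>n. \<integral>\<^sup>+x. indicator (?I n) x * F (x - real n + ?D n) \<partial>lborel)"
    unfolding dec by (intro nn_integral_suminf) measurable
  also have "\<dots> = (\<Sum>n. \<integral>\<^sup>+y. indicator {?D n..<?D n + 1} y * F y \<partial>lborel)"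
  proof (intro suminf_cong)
    fix n
    have "(\<integral>\<^sup>+x. indicator (?I n) x * F (x - real n + ?D n) \<partial>lborel) =
      ennreal \<bar>1\<bar> * (\<integral>\<^sup>+y. indicator (?I n) ((real n - ?D n) + 1 * y) * F ((real n - ?D n) + 1 * y - real n + ?D n) \<partial>lborel)"
      by (rule nn_integral_real_affine) auto
    also have "\<dots> = (\<integral>\<^sup>+y. indicator {?D n..<?D n + 1} y * F y \<partial>lborel)"
      by (auto intro!: nn_integral_cong simp: indicator_def)
    finally show "(\<integral>\<^sup>+x. indicator (?I n) x * F (x - real n + ?D n) \<partial>lborel) =
      (\<integral>\<^sup>+y. indicator {?D n..<?D n + 1} y * F y \<partial>lborel)" .
  qed
  also have "\<dots> = (\<integral>\<^sup>+y. (\<Sum>n. indicator {?D n..<?D n + 1} y * F y) \<partial>lborel)"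
    by (intro nn_integral_suminf[symmetric]) measurable
  also have "\<dots> = (\<integral>\<^sup>+y. F y \<partial>lborel)"
  proof (intro nn_integral_cong)
    fix y :: real
    have mem: "y \<in> {?D n..<?D n + 1} \<longleftrightarrow> n = int_encode \<lfloor>y\<rfloor>" for n
    proof -
      have "y \<in> {?D n..<?D n + 1} \<longleftrightarrow> \<lfloor>y\<rfloor> = int_decode n" by (simp add: floor_eq_iff)
      also have "\<dots> \<longleftrightarrow> n = int_encode \<lfloor>y\<rfloor>" by (metis int_decode_inverse int_encode_inverse)
      finally show ?thesis .
    qed
    have "(\<Sum>n. indicator {?D n..<?D n + 1} y * F y) = (\<Sum>n\<in>{int_encode \<lfloor>y\<rfloor>}. indicator {?D n..<?D n + 1} y * F y)"
      using mem by (intro suminf_finite) (auto simp: indicator_def)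
    also have "\<dots> = F y" using mem[of "int_encode \<lfloor>y\<rfloor>"] by simp
    finally show "(\<Sum>n. indicator {?D n..<?D n + 1} y * F y) = F y" .
  qed
  finally show ?thesis .
qed

lemma integral_half_to_line:
  fixes F :: "real \<Rightarrow> real"
  assumes [measurable]: "F \<in> borel_measurable borel" and F: "\<And>y. 0 \<le> F y"
  shows "(\<integral>x. indicator {0..} x * F (half_to_line x) \<partial>lborel) = (\<integral>y. F y \<partial>lborel)"
proof -
  have "(\<integral>x. indicator {0..} x * F (half_to_line x) \<partial>lborel) =
    enn2real (\<integral>\<^sup>+x. ennreal (indicator {0..} x * F (half_to_line x)) \<partial>lborel)"
    using F by (intro integral_eq_nn_integral) auto
  also have "(\<integral>\<^sup>+x. ennreal (indicator {0..} x * F (half_to_line x)) \<partial>lborel) =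
    (\<integral>\<^sup>+x. indicator {0..} x * ennreal (F (half_to_line x)) \<partial>lborel)"
    by (intro nn_integral_cong) (auto simp: indicator_def)
  also have "\<dots> = (\<integral>\<^sup>+y. ennreal (F y) \<partial>lborel)"
    by (rule nn_integral_half_to_line) measurable
  also have "enn2real \<dots> = (\<integral>y. F y \<partial>lborel)"
    using F by (intro integral_eq_nn_integral[symmetric]) auto
  finally show ?thesis .
qed

section \<open>Increments of the multistable process\<close>

text \<open>The point \<open>u\<close> of localisation is fixed throughout, and the smoothness of \<open>\<alpha>\<close> and \<open>b\<close> is expressed at \<open>u\<close>.\<close>
locale multistable = lepage M \<Gamma> V \<gamma> for M :: "'a measure" and \<Gamma> V \<gamma> +
  fixes \<alpha> b :: "real \<Rightarrow> real" and c d u :: real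
  assumes cd: "1 < c" "d < 2" and \<alpha>_range: "\<And>t. \<alpha> t \<in> {c..d}" and b_pos: "\<And>t. 0 < b t"
    and \<alpha>_diff: "\<exists>D. (\<alpha> has_real_derivative D) (at u)" and b_diff: "\<exists>D. (b has_real_derivative D) (at u)"
    and u: "0 \<le> u"
begin

abbreviation Y :: "real \<Rightarrow> 'a \<Rightarrow> real" where
  "Y \<equiv> multistable_levy \<alpha> b \<Gamma> V \<gamma>"

lemma \<alpha>1: "1 < \<alpha> t" "\<alpha> t < 2"
  using \<alpha>_range[of t] cd by auto

definition scale :: "real \<Rightarrow> real" where
  "scale s = b s * stable_const (\<alpha> s) powr (1 / \<alpha> s)"

text \<open>The \<open>i\<close>-th coefficient in the series for \<open>X s v\<close>: the indicator is that of time \<open>s\<close>, whereas index and scale are taken at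
\<open>v\<close>.\<close>
definition coeff :: "real \<Rightarrow> real \<Rightarrow> nat \<Rightarrow> 'a \<Rightarrow> real" where
  "coeff v s i \<omega> = \<Gamma> i \<omega> powr (- 1 / \<alpha> v) * (scale v * (block_weight (\<alpha> v) (V i \<omega>) * indicator {0..s} (V i \<omega>)))"

lemma coeff_measurable[measurable]: "coeff v s i \<in> borel_measurable (marks n)"
  unfolding coeff_def[abs_def] by measurable

lemma kernel_bound:
  "\<bar>x * (block_weight (\<alpha> v) y * indicator {0..s} y)\<bar> \<le> \<bar>x\<bar> * 2 powr ((max s 0 + 1) / \<alpha> v)"
  using \<alpha>1[of v] block_weight_indicator_le[of "\<alpha> v" s "max s 0" y]
  by (simp only: abs_mult[of x]) (intro mult_left_mono, auto)

lemma coeff_summable: "AE \<omega> in M. summable (\<lambda>i. \<gamma> i \<omega> * coeff v s i \<omega>)"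
  unfolding coeff_def
  using \<alpha>1[of v] by (intro AE_summable_stable_series[OF _ _ _ kernel_bound[of "scale v" v _ s]]) auto

lemma Y_eq: "Y s \<omega> = scale s * (\<Sum>i. \<gamma> i \<omega> * (\<Gamma> i \<omega> powr (- 1 / \<alpha> s) *
    (1 * (block_weight (\<alpha> s) (V i \<omega>) * indicator {0..s} (V i \<omega>)))))"
  unfolding multistable_levy_def suminf_blocks scale_def by (simp add: mult.assoc)

lemma Y_measurable: "Y s \<in> borel_measurable M"
  unfolding Y_eq[abs_def] by measurable

lemma Y_sums: "AE \<omega> in M. (\<lambda>i. \<gamma> i \<omega> * coeff s s i \<omega>) sums Y s \<omega>"
proof -
  have "AE \<omega> in M. summable (\<lambda>i. \<gamma> i \<omega> * (\<Gamma> i \<omega> powr (- 1 / \<alpha> s) *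
      (1 * (block_weight (\<alpha> s) (V i \<omega>) * indicator {0..s} (V i \<omega>)))))"
    using \<alpha>1[of s] by (intro AE_summable_stable_series[OF _ _ _ kernel_bound[of 1 s _ s]]) auto
  then show ?thesis
  proof eventually_elim
    case (elim \<omega>)
    from sums_mult[OF summable_sums[OF elim], of "scale s"]
    show ?case by (simp add: coeff_def Y_eq mult_ac)
  qed
qed

definition main_coeff :: "real set \<Rightarrow> (real \<Rightarrow> real) \<Rightarrow> real \<Rightarrow> nat \<Rightarrow> 'a \<Rightarrow> real" where
  "main_coeff J w r i \<omega> = (\<Sum>t\<in>J. w t * (r powr (- 1 / \<alpha> u) * (coeff u (u + r * t) i \<omega> - coeff u u i \<omega>)))"

definition rem_coeff :: "real set \<Rightarrow> (real \<Rightarrow> real) \<Rightarrow> real \<Rightarrow> nat \<Rightarrow> 'a \<Rightarrow> real" where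
  "rem_coeff J w r i \<omega> = (\<Sum>t\<in>J. w t * (r powr (- 1 / \<alpha> u) * (coeff (u + r * t) (u + r * t) i \<omega> - coeff u (u + r * t) i \<omega>)))"

lemma main_coeff_measurable[measurable]: "main_coeff J w r i \<in> borel_measurable (marks n)"
  unfolding main_coeff_def[abs_def] by measurable

lemma rem_coeff_measurable[measurable]: "rem_coeff J w r i \<in> borel_measurable (marks n)"
  unfolding rem_coeff_def[abs_def] by measurable

lemma increments_split:
  assumes J: "finite J"
  shows "AE \<omega> in M. summable (\<lambda>i. \<gamma> i \<omega> * rem_coeff J w r i \<omega>) \<and>
    (\<Sum>t\<in>J. w t * (r powr (- (1 / \<alpha> u)) * (Y (u + r * t) \<omega> - Y u \<omega>))) =
    (\<Sum>i. \<gamma> i \<omega> * main_coeff J w r i \<omega>) + (\<Sum>i. \<gamma> i \<omega> * rem_coeff J w r i \<omega>)"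
proof -
  have "AE \<omega> in M. \<forall>t\<in>J. summable (\<lambda>i. \<gamma> i \<omega> * coeff u (u + r * t) i \<omega>)"
    using J by (intro AE_ball_countable' coeff_summable) (auto intro: countable_finite)
  moreover have "AE \<omega> in M. \<forall>t\<in>J. (\<lambda>i. \<gamma> i \<omega> * coeff (u + r * t) (u + r * t) i \<omega>) sums Y (u + r * t) \<omega>"
    using J by (intro AE_ball_countable' Y_sums) (auto intro: countable_finite)
  moreover note Y_sums[of u]
  ultimately show ?thesis
  proof eventually_elim
    case (elim \<omega>)
    define X where "X t = (\<Sum>i. \<gamma> i \<omega> * coeff u (u + r * t) i \<omega>)" for t
    have X: "(\<lambda>i. \<gamma> i \<omega> * coeff u (u + r * t) i \<omega>) sums X t" if "t \<in> J" for t
      using elim(1) that unfolding X_def by (intro summable_sums) auto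
    let ?h = "r powr (- 1 / \<alpha> u)"
    have "(\<lambda>i. \<Sum>t\<in>J. w t * (?h * (\<gamma> i \<omega> * coeff u (u + r * t) i \<omega> - \<gamma> i \<omega> * coeff u u i \<omega>))) sums
        (\<Sum>t\<in>J. w t * (?h * (X t - Y u \<omega>)))"
      by (intro sums_sum sums_mult sums_diff X elim(3))
    then have main: "(\<lambda>i. \<gamma> i \<omega> * main_coeff J w r i \<omega>) sums (\<Sum>t\<in>J. w t * (?h * (X t - Y u \<omega>)))"
      by (simp add: main_coeff_def sum_distrib_left right_diff_distrib mult_ac)
    have "(\<lambda>i. \<Sum>t\<in>J. w t * (?h * (\<gamma> i \<omega> * coeff (u + r * t) (u + r * t) i \<omega> - \<gamma> i \<omega> * coeff u (u + r * t) i \<omega>))) sums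
        (\<Sum>t\<in>J. w t * (?h * (Y (u + r * t) \<omega> - X t)))"
      using elim(2) by (intro sums_sum sums_mult sums_diff X) auto
    then have rem: "(\<lambda>i. \<gamma> i \<omega> * rem_coeff J w r i \<omega>) sums (\<Sum>t\<in>J. w t * (?h * (Y (u + r * t) \<omega> - X t)))"
      by (simp add: rem_coeff_def sum_distrib_left right_diff_distrib mult_ac)
    have "(\<Sum>t\<in>J. w t * (?h * (Y (u + r * t) \<omega> - Y u \<omega>))) =
      (\<Sum>t\<in>J. w t * (?h * (X t - Y u \<omega>))) + (\<Sum>t\<in>J. w t * (?h * (Y (u + r * t) \<omega> - X t)))"
      by (simp add: sum.distrib[symmetric] algebra_simps)
    then show ?case using main rem by (simp add: sums_iff)
  qed
qed

lemma scale_pos: "0 < scale s"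
  using b_pos[of s] stable_integral_pos[OF \<alpha>1, of s] by (simp add: scale_def stable_const_eq)

lemma scale_powr: "stable_integral (\<alpha> u) * scale u powr \<alpha> u = b u powr \<alpha> u"
proof -
  have pos: "0 < stable_integral (\<alpha> u)" by (rule stable_integral_pos[OF \<alpha>1])
  then have sc: "0 < stable_const (\<alpha> u)" by (simp add: stable_const_eq)
  have "scale u powr \<alpha> u = b u powr \<alpha> u * (stable_const (\<alpha> u) powr (1 / \<alpha> u)) powr \<alpha> u"
    using b_pos[of u] by (simp add: scale_def powr_mult)
  also have "(stable_const (\<alpha> u) powr (1 / \<alpha> u)) powr \<alpha> u = stable_const (\<alpha> u)"
    using \<alpha>1[of u] sc by (simp add: powr_powr)
  finally show ?thesis using pos by (simp add: stable_const_eq)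
qed

text \<open>The right-hand side does not depend on \<open>r\<close>: the factor \<open>r\<close> from the substitution cancels against the power
\<open>\<alpha> u\<close> of \<open>r powr (- 1 / \<alpha> u)\<close>.\<close>
lemma expectation_cos_main:
  assumes J: "finite J" and r: "0 < r" and nn: "\<And>t. t \<in> J \<Longrightarrow> 0 \<le> u + r * t"
  shows "expectation (\<lambda>\<omega>. cos ((\<Sum>i. \<gamma> i \<omega> * main_coeff J w r i \<omega>) + \<phi>)) =
    cos \<phi> * exp (- (b u powr \<alpha> u * levy_exponent (\<alpha> u) J w))"
proof -
  let ?a = "\<alpha> u" and ?h = "r powr (- 1 / \<alpha> u)"
  define s where "s v = (\<Sum>t\<in>J. w t * (indicator {0..u + r * t} v - indicator {0..u} v))" for v :: real
  define k where "k v = block_weight ?a v * (scale u * ?h * s v)" for v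
  have sm[measurable]: "s \<in> borel_measurable borel" unfolding s_def[abs_def] by measurable
  have k_eq: "k v = (\<Sum>t\<in>J. w t * (?h * (scale u * (block_weight ?a v * indicator {0..u + r * t} v)
      - scale u * (block_weight ?a v * indicator {0..u} v))))" for v
    unfolding k_def s_def by (simp add: sum_distrib_left right_diff_distrib mult_ac)
  have main: "main_coeff J w r i \<omega> = \<Gamma> i \<omega> powr (- 1 / ?a) * k (V i \<omega>)" for i \<omega>
    unfolding main_coeff_def coeff_def k_eq by (simp add: sum_distrib_left right_diff_distrib mult_ac)
  have km[measurable]: "k \<in> borel_measurable borel" unfolding k_def[abs_def] by measurable
  have "\<exists>\<kappa>. \<forall>v. \<bar>k v\<bar> \<le> \<kappa>"
  proof (intro exI allI)
    fix v
    have "\<bar>k v\<bar> \<le> (\<Sum>t\<in>J. \<bar>w t * (?h * (scale u * (block_weight ?a v * indicator {0..u + r * t} v)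
      - scale u * (block_weight ?a v * indicator {0..u} v)))\<bar>)"
      unfolding k_eq by (rule sum_abs)
    also have "\<dots> \<le> (\<Sum>t\<in>J. \<bar>w t\<bar> * (\<bar>?h\<bar> * (\<bar>scale u\<bar> * 2 powr ((max (u + r * t) 0 + 1) / ?a)
      + \<bar>scale u\<bar> * 2 powr ((max u 0 + 1) / ?a))))"
      unfolding abs_mult[of "w _"] abs_mult[of ?h]
      by (intro sum_mono mult_left_mono order_trans[OF abs_triangle_ineq4] add_mono kernel_bound) auto
    finally show "\<bar>k v\<bar> \<le> (\<Sum>t\<in>J. \<bar>w t\<bar> * (\<bar>?h\<bar> * (\<bar>scale u\<bar> * 2 powr ((max (u + r * t) 0 + 1) / ?a)
      + \<bar>scale u\<bar> * 2 powr ((max u 0 + 1) / ?a))))" .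
  qed
  then obtain \<kappa> where \<kappa>: "\<And>v. \<bar>k v\<bar> \<le> \<kappa>" by blast
  have "(\<integral>v. \<bar>k v\<bar> powr ?a \<partial>density lborel dyadic_block_density) =
    (\<integral>v. indicator {0..} v * \<bar>scale u * ?h * s v\<bar> powr ?a \<partial>lborel)"
    unfolding k_def using \<alpha>1[of u] by (intro integral_block_weight) auto
  also have "\<dots> = (\<integral>v. (scale u powr ?a * (1 / r)) * (indicator {0..} v * \<bar>s v\<bar> powr ?a) \<partial>lborel)"
  proof (intro Bochner_Integration.integral_cong refl)
    fix v
    have "\<bar>scale u * ?h * s v\<bar> powr ?a = scale u powr ?a * (?h powr ?a) * \<bar>s v\<bar> powr ?a"
      using scale_pos[of u] by (simp add: abs_mult powr_mult)
    also have "?h powr ?a = 1 / r"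
      unfolding powr_powr using \<alpha>1[of u] r by (simp add: powr_minus_divide)
    finally show "indicator {0..} v * \<bar>scale u * ?h * s v\<bar> powr ?a =
      (scale u powr ?a * (1 / r)) * (indicator {0..} v * \<bar>s v\<bar> powr ?a)" by simp
  qed
  also have "\<dots> = (scale u powr ?a * (1 / r)) * (\<integral>v. indicator {0..} v * \<bar>s v\<bar> powr ?a \<partial>lborel)"
    by (rule integral_mult_right_zero)
  also have "(\<integral>v. indicator {0..} v * \<bar>s v\<bar> powr ?a \<partial>lborel) = r * levy_exponent ?a J w"
    unfolding s_def using \<alpha>1[of u] by (intro levy_exponent_rescaled[OF J r u nn]) auto
  finally have I: "(\<integral>v. \<bar>k v\<bar> powr ?a \<partial>density lborel dyadic_block_density) = scale u powr ?a * levy_exponent ?a J w"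
    using r by simp
  have "stable_integral ?a * (scale u powr ?a * levy_exponent ?a J w) = b u powr ?a * levy_exponent ?a J w"
    unfolding scale_powr[symmetric] by simp
  with expectation_cos_stable_series[OF \<alpha>1 km \<kappa>, of u \<phi>] show ?thesis
    unfolding main I by simp
qed

lemma prob_partial_sums_unbounded:
  fixes g :: "nat \<Rightarrow> 'a \<Rightarrow> real"
  assumes g[measurable]: "\<And>i. g i \<in> borel_measurable M" and sm: "AE \<omega> in M. summable (\<lambda>i. (g i \<omega>)\<^sup>2)" and \<eta>: "0 < \<eta>"
  shows "\<exists>K\<ge>0. prob {\<omega>\<in>space M. \<not> (\<forall>n. (\<Sum>i<n. (g i \<omega>)\<^sup>2) \<le> K)} < \<eta>"
proof -
  define C where "C k = {\<omega>\<in>space M. \<not> (\<forall>n. (\<Sum>i<n. (g i \<omega>)\<^sup>2) \<le> real k)}" for k :: nat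
  have Cm[measurable]: "C k \<in> events" for k unfolding C_def by measurable
  have "(\<lambda>k. prob (C k)) \<longlonglongrightarrow> prob (\<Inter>k. C k)"
  proof (rule finite_Lim_measure_decseq)
    show "decseq C"
    proof (rule antimonoI, rule subsetI)
      fix j k :: nat and \<omega> assume "j \<le> k" "\<omega> \<in> C k"
      then show "\<omega> \<in> C j" unfolding C_def by (auto intro: order_trans)
    qed
  qed auto
  moreover have "prob (\<Inter>k. C k) = 0"
  proof -
    have "AE \<omega> in M. \<omega> \<notin> (\<Inter>k. C k)"
      using sm
    proof eventually_elim
      case (elim \<omega>)
      obtain k :: nat where k: "(\<Sum>i. (g i \<omega>)\<^sup>2) \<le> k" using real_arch_simple by blast
      have "(\<Sum>i<n. (g i \<omega>)\<^sup>2) \<le> real k" for n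
        using sum_le_suminf[OF elim, of "{..<n}"] k by auto
      then have "\<omega> \<notin> C k" by (auto simp: C_def)
      then show ?case by blast
    qed
    then show ?thesis by (subst prob_eq_0) auto
  qed
  ultimately have "(\<lambda>k. prob (C k)) \<longlonglongrightarrow> 0" by simp
  from order_tendstoD(2)[OF this \<eta>] obtain k where "prob (C k) < \<eta>"
    using eventually_happens'[OF sequentially_bot] by blast
  then show ?thesis unfolding C_def by (intro exI[of _ "real k"]) auto
qed

text \<open>Arrival time and block enter only through the quotient \<open>z\<close>, which is the form needed for \<open>scaled_powr_calm\<close>.\<close>
lemma coeff_eq:
  assumes "0 < \<Gamma> i \<omega>"
  shows "coeff v s i \<omega> = indicator {0..s} (V i \<omega>) *
    (scale v * (2 powr real (Suc (nat \<lfloor>V i \<omega>\<rfloor>)) / \<Gamma> i \<omega>) powr (1 / \<alpha> v))"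
proof -
  have "(2 powr real (Suc (nat \<lfloor>V i \<omega>\<rfloor>)) / \<Gamma> i \<omega>) powr (1 / \<alpha> v) =
    (2 powr real (Suc (nat \<lfloor>V i \<omega>\<rfloor>))) powr (1 / \<alpha> v) / \<Gamma> i \<omega> powr (1 / \<alpha> v)"
    using assms by (simp add: powr_divide)
  also have "\<dots> = block_weight (\<alpha> v) (V i \<omega>) * \<Gamma> i \<omega> powr (- 1 / \<alpha> v)"
    by (simp add: block_weight_def powr_powr powr_minus_divide)
  finally show ?thesis by (simp add: coeff_def)
qed

text \<open>The coefficients are at most \<open>e r * g i\<close>, where \<open>e r\<close> is of order \<open>r powr (1 - 1 / \<alpha> u)\<close> and \<open>g i\<close> is a
square-summable function of \<open>\<Gamma>\<^sub>i\<close>. The exponent \<open>1 - 1 / \<alpha> u\<close> is positive because the index exceeds 1.\<close>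
lemma remainder_small:
  assumes J: "finite J" and \<delta>: "0 < \<delta>" and \<eta>: "0 < \<eta>"
  shows "\<forall>\<^sub>F r in at_right 0. prob {\<omega>\<in>space M. \<delta> \<le> \<bar>\<Sum>i. \<gamma> i \<omega> * rem_coeff J w r i \<omega>\<bar>} < \<eta>"
proof -
  obtain D D' where D: "(\<alpha> has_real_derivative D) (at u)" "(b has_real_derivative D') (at u)"
    using \<alpha>_diff b_diff by blast
  have "calm_at scale u"
    unfolding scale_def[abs_def] by (rule calm_at_stable_scale[OF cd \<alpha>_range D])
  from scaled_powr_calm[OF cd \<alpha>_range D(1) this]
  obtain p q K where pq: "1/2 < p" "p \<le> q" "0 \<le> K" and
    K: "\<forall>\<^sub>F v in nhds u. \<forall>z>0. \<bar>scale v * z powr (1 / \<alpha> v) - scale u * z powr (1 / \<alpha> u)\<bar> \<le> K * \<bar>v - u\<bar> * (z powr p + z powr q)"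
    by blast
  define T where "T = u + (\<Sum>t\<in>J. \<bar>t\<bar>)"
  \<comment> \<open>For small \<open>r\<close> only marks up to \<open>T\<close> matter, and \<open>\<Lambda>\<close> bounds the inverse density of the marks there.\<close>
  define \<Lambda> where "\<Lambda> = 2 powr (T + 1)"
  have T0: "0 \<le> T" unfolding T_def using u by (intro add_nonneg_nonneg sum_nonneg) auto
  have \<Lambda>1: "1 \<le> \<Lambda>" unfolding \<Lambda>_def using T0 by (intro ge_one_powr_ge_zero) auto
  define g where "g i \<omega> = \<Gamma> i \<omega> powr - p + \<Gamma> i \<omega> powr - q" for i \<omega>
  have gm: "g i \<in> borel_measurable (marks 0)" for i unfolding g_def[abs_def] by measurable
  have gM: "g i \<in> borel_measurable M" for i using gm by (rule marksD)
  have g_sum: "AE \<omega> in M. summable (\<lambda>i. (g i \<omega>)\<^sup>2)"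
  proof -
    have "AE \<omega> in M. summable (\<lambda>i. \<Gamma> i \<omega> powr - (2 * p))"
      using pq by (intro AE_summable_arrival_powr) auto
    moreover have "AE \<omega> in M. summable (\<lambda>i. \<Gamma> i \<omega> powr - (2 * q))"
      using pq by (intro AE_summable_arrival_powr) auto
    ultimately show ?thesis
    proof eventually_elim
      case (elim \<omega>)
      show ?case
      proof (rule summable_comparison_test'[where N=0])
        show "summable (\<lambda>i. 2 * (\<Gamma> i \<omega> powr - (2 * p) + \<Gamma> i \<omega> powr - (2 * q)))"
          by (intro summable_mult summable_add elim)
        fix i :: nat
        have sq: "(\<Gamma> i \<omega> powr - s)\<^sup>2 = \<Gamma> i \<omega> powr - (2 * s)" for s
          by (simp add: power2_eq_square powr_add[symmetric])
        have "(g i \<omega>)\<^sup>2 \<le> 2 * ((\<Gamma> i \<omega> powr - p)\<^sup>2 + (\<Gamma> i \<omega> powr - q)\<^sup>2)"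
          unfolding g_def using sum_squares_bound[of "\<Gamma> i \<omega> powr - p" "\<Gamma> i \<omega> powr - q"]
          by (simp add: power2_sum)
        then show "norm ((g i \<omega>)\<^sup>2) \<le> 2 * (\<Gamma> i \<omega> powr - (2 * p) + \<Gamma> i \<omega> powr - (2 * q))"
          by (simp add: sq)
      qed
    qed
  qed
  have "0 < \<eta> / 2" using \<eta> by simp
  from prob_partial_sums_unbounded[OF gM g_sum this]
  obtain B where B: "0 \<le> B" "prob {\<omega>\<in>space M. \<not> (\<forall>n. (\<Sum>i<n. (g i \<omega>)\<^sup>2) \<le> B)} < \<eta> / 2" by blast
  define L where "L = (\<Sum>t\<in>J. \<bar>w t\<bar> * \<bar>t\<bar>) * (K * \<Lambda> powr q)"
  define e where "e r = L * r powr (1 - 1 / \<alpha> u)" for r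
  have "((\<lambda>r. 4 * B * (e r)\<^sup>2 / \<delta>\<^sup>2) \<longlongrightarrow> 4 * B * (L * 0)\<^sup>2 / \<delta>\<^sup>2) (at_right 0)"
    unfolding e_def
  proof (intro tendsto_divide tendsto_mult tendsto_power tendsto_const)
    show "((\<lambda>r. r powr (1 - 1 / \<alpha> u)) \<longlongrightarrow> 0) (at_right 0)"
    proof (rule tendsto_zero_powrI)
      show "((\<lambda>r::real. r) \<longlongrightarrow> 0) (at_right 0)" by (rule tendsto_ident_at)
      show "\<forall>\<^sub>F r::real in at_right 0. 0 \<le> r" by (simp add: eventually_at_right_less eventually_mono[OF eventually_at_right_less] less_imp_le)
      show "0 < 1 - 1 / \<alpha> u" using \<alpha>1[of u] by simp
    qed (rule tendsto_const)
  qed (use \<delta> in simp)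
  then have "((\<lambda>r. 4 * B * (e r)\<^sup>2 / \<delta>\<^sup>2) \<longlongrightarrow> 0) (at_right 0)" by simp
  from order_tendstoD(2)[OF this \<open>0 < \<eta> / 2\<close>]
  have e_small: "\<forall>\<^sub>F r in at_right 0. 4 * B * (e r)\<^sup>2 / \<delta>\<^sup>2 < \<eta> / 2" .
  have near: "\<forall>\<^sub>F r in at_right 0. \<forall>t\<in>J. \<forall>z>0. \<bar>scale (u + r * t) * z powr (1 / \<alpha> (u + r * t)) - scale u * z powr (1 / \<alpha> u)\<bar>
      \<le> K * \<bar>(u + r * t) - u\<bar> * (z powr p + z powr q)"
  proof (intro eventually_ball_finite J ballI)
    fix t
    have "((\<lambda>r. u + r * t) \<longlongrightarrow> u + 0 * t) (at_right 0)"
      by (intro tendsto_add tendsto_mult tendsto_const tendsto_ident_at)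
    then have "filterlim (\<lambda>r. u + r * t) (nhds u) (at_right 0)" by simp
    from eventually_compose_filterlim[OF K this]
    show "\<forall>\<^sub>F r in at_right 0. \<forall>z>0. \<bar>scale (u + r * t) * z powr (1 / \<alpha> (u + r * t)) - scale u * z powr (1 / \<alpha> u)\<bar>
      \<le> K * \<bar>(u + r * t) - u\<bar> * (z powr p + z powr q)" .
  qed
  have r01: "\<forall>\<^sub>F r::real in at_right 0. r \<in> {0<..<1}"
    by (rule eventually_at_right_real) simp
  from e_small near r01 show ?thesis
  proof eventually_elim
    case (elim r)
    then have r: "0 < r" "r < 1" by auto
    let ?h = "r powr (- 1 / \<alpha> u)"
    \<comment> \<open>Almost surely the arrival times are positive; on the exceptional null set the bound could fail.\<close>
    define A where "A i \<omega> = (if 0 < \<Gamma> i \<omega> then rem_coeff J w r i \<omega> else 0)" for i \<omega>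
    have Am: "A i \<in> borel_measurable (marks 0)" for i unfolding A_def[abs_def] by measurable
    have Ag: "\<bar>A i \<omega>\<bar> \<le> e r * g i \<omega>" for i \<omega>
    proof (cases "0 < \<Gamma> i \<omega>")
      case True
      define z where "z = 2 powr real (Suc (nat \<lfloor>V i \<omega>\<rfloor>)) / \<Gamma> i \<omega>"
      have z: "0 < z" using True by (simp add: z_def)
      have g0: "0 \<le> g i \<omega>" by (simp add: g_def)
      have t_bd: "\<bar>coeff (u + r * t) (u + r * t) i \<omega> - coeff u (u + r * t) i \<omega>\<bar> \<le> K * (r * \<bar>t\<bar>) * (\<Lambda> powr q * g i \<omega>)"
        if t: "t \<in> J" for t
      proof (cases "V i \<omega> \<in> {0..u + r * t}")
        case V: True
        have "u + r * t \<le> T"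
        proof -
          have "r * t \<le> r * \<bar>t\<bar>" using r by (intro mult_left_mono) auto
          also have "\<dots> \<le> 1 * \<bar>t\<bar>" using r by (intro mult_right_mono) auto
          also have "\<dots> \<le> (\<Sum>t\<in>J. \<bar>t\<bar>)" using t J by (simp add: member_le_sum)
          finally show ?thesis by (simp add: T_def)
        qed
        then have "V i \<omega> \<le> T" "0 \<le> V i \<omega>" using V by auto
        then have "2 powr real (Suc (nat \<lfloor>V i \<omega>\<rfloor>)) \<le> \<Lambda>"
          using block_weight_le[of 1 "V i \<omega>" T] by (simp add: block_weight_def \<Lambda>_def)
        then have z\<Lambda>: "z \<le> \<Lambda> / \<Gamma> i \<omega>" unfolding z_def using True by (intro divide_right_mono) auto
        have zs: "z powr s \<le> \<Lambda> powr q * \<Gamma> i \<omega> powr - s" if s: "0 \<le> s" "s \<le> q" for s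
        proof -
          have "z powr s \<le> (\<Lambda> / \<Gamma> i \<omega>) powr s" using z z\<Lambda> s by (intro powr_mono2) auto
          also have "\<dots> = \<Lambda> powr s * \<Gamma> i \<omega> powr - s"
            using True \<Lambda>1 by (simp add: powr_divide powr_minus_divide)
          also have "\<dots> \<le> \<Lambda> powr q * \<Gamma> i \<omega> powr - s"
            using \<Lambda>1 s by (intro mult_right_mono powr_mono) auto
          finally show ?thesis .
        qed
        have "\<bar>coeff (u + r * t) (u + r * t) i \<omega> - coeff u (u + r * t) i \<omega>\<bar> =
            \<bar>scale (u + r * t) * z powr (1 / \<alpha> (u + r * t)) - scale u * z powr (1 / \<alpha> u)\<bar>"
          using V by (simp add: coeff_eq[OF True] z_def)
        also have "\<dots> \<le> K * \<bar>(u + r * t) - u\<bar> * (z powr p + z powr q)" using elim(2) t z by blast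
        also have "\<dots> = K * (r * \<bar>t\<bar>) * (z powr p + z powr q)" using r by (simp add: abs_mult)
        also have "\<dots> \<le> K * (r * \<bar>t\<bar>) * (\<Lambda> powr q * g i \<omega>)"
        proof (rule mult_left_mono)
          show "z powr p + z powr q \<le> \<Lambda> powr q * g i \<omega>"
            using zs[of p] zs[of q] pq by (simp add: g_def distrib_left add_mono)
        qed (use pq r in simp)
        finally show ?thesis .
      next
        case False
        then show ?thesis using pq r g0 by (simp add: coeff_def)
      qed
      have "\<bar>A i \<omega>\<bar> \<le> (\<Sum>t\<in>J. \<bar>w t * (?h * (coeff (u + r * t) (u + r * t) i \<omega> - coeff u (u + r * t) i \<omega>))\<bar>)"
        using True unfolding A_def rem_coeff_def by (simp add: sum_abs)
      also have "\<dots> \<le> (\<Sum>t\<in>J. \<bar>w t\<bar> * (?h * (K * (r * \<bar>t\<bar>) * (\<Lambda> powr q * g i \<omega>))))"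
        unfolding abs_mult by (intro sum_mono mult_mono t_bd) auto
      also have "\<dots> = (?h * r) * ((\<Sum>t\<in>J. \<bar>w t\<bar> * \<bar>t\<bar>) * (K * \<Lambda> powr q) * g i \<omega>)"
        by (simp add: sum_distrib_left sum_distrib_right mult_ac)
      also have "?h * r = r powr (1 - 1 / \<alpha> u)"
        using r by (simp add: powr_diff powr_minus_divide)
      finally show ?thesis by (simp add: e_def L_def mult_ac)
    next
      case False
      have "0 \<le> L" unfolding L_def using pq by (intro mult_nonneg_nonneg sum_nonneg) auto
      then show ?thesis using False by (simp add: A_def e_def g_def)
    qed
    have pos: "AE \<omega> in M. \<forall>i. 0 < \<Gamma> i \<omega>" by (subst AE_all_countable) (auto intro: AE_arrival_pos)
    have sm: "AE \<omega> in M. summable (\<lambda>i. \<gamma> i \<omega> * A i \<omega>)"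
      using pos increments_split[OF J, of w r] by eventually_elim (simp add: A_def)
    have "prob {\<omega>\<in>space M. \<delta> \<le> \<bar>\<Sum>i. \<gamma> i \<omega> * rem_coeff J w r i \<omega>\<bar>} =
      prob {\<omega>\<in>space M. \<delta> \<le> \<bar>\<Sum>i. \<gamma> i \<omega> * A i \<omega>\<bar>}"
    proof (rule prob_eq_AE)
      show "AE \<omega> in M. (\<delta> \<le> \<bar>\<Sum>i. \<gamma> i \<omega> * rem_coeff J w r i \<omega>\<bar>) = (\<delta> \<le> \<bar>\<Sum>i. \<gamma> i \<omega> * A i \<omega>\<bar>)"
        using pos by eventually_elim (simp add: A_def)
    next
      note [measurable] = marksD[OF Am] marksD[OF rem_coeff_measurable]
      show "{\<omega>\<in>space M. \<delta> \<le> \<bar>\<Sum>i. \<gamma> i \<omega> * A i \<omega>\<bar>} \<in> events"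
        "{\<omega>\<in>space M. \<delta> \<le> \<bar>\<Sum>i. \<gamma> i \<omega> * rem_coeff J w r i \<omega>\<bar>} \<in> events"
        by measurable
    qed
    also have "\<dots> \<le> prob {\<omega>\<in>space M. \<not> (\<forall>n. (\<Sum>i<n. (g i \<omega>)\<^sup>2) \<le> B)} + 4 * B * (e r)\<^sup>2 / \<delta>\<^sup>2"
      by (rule prob_sign_series_ge[OF Am gm Ag sm \<delta> B(1)])
    also have "\<dots> < \<eta>" using B(2) elim(1) by linarith
    finally show ?case .
  qed
qed

end

section \<open>The local form\<close>

lemma (in prob_space) cos_expectation_close:
  assumes [measurable]: "X \<in> borel_measurable M" "D \<in> borel_measurable M" "R \<in> borel_measurable M"
    and X: "AE \<omega> in M. X \<omega> = D \<omega> + R \<omega>" and \<delta>: "0 < \<delta>"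
  shows "\<bar>expectation (\<lambda>\<omega>. cos (X \<omega> + \<phi>)) - expectation (\<lambda>\<omega>. cos (D \<omega> + \<phi>))\<bar> \<le>
    \<delta> + 2 * prob {\<omega>\<in>space M. \<delta> \<le> \<bar>R \<omega>\<bar>}"
proof -
  have i: "integrable M (\<lambda>\<omega>. cos (f \<omega> + \<phi>))" if [measurable]: "f \<in> borel_measurable M" for f
    by (rule integrable_const_bound[where B=1]) auto
  have ind: "integrable M (\<lambda>\<omega>. indicator {\<omega>\<in>space M. \<delta> \<le> \<bar>R \<omega>\<bar>} \<omega> :: real)"
    by (rule integrable_const_bound[where B=1]) auto
  have "\<bar>expectation (\<lambda>\<omega>. cos (X \<omega> + \<phi>)) - expectation (\<lambda>\<omega>. cos (D \<omega> + \<phi>))\<bar> =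
    \<bar>expectation (\<lambda>\<omega>. cos (X \<omega> + \<phi>) - cos (D \<omega> + \<phi>))\<bar>"
    using i by (subst Bochner_Integration.integral_diff) auto
  also have "\<dots> \<le> expectation (\<lambda>\<omega>. \<bar>cos (X \<omega> + \<phi>) - cos (D \<omega> + \<phi>)\<bar>)"
    by (rule integral_abs_bound)
  also have "\<dots> \<le> expectation (\<lambda>\<omega>. \<delta> + 2 * indicator {\<omega>\<in>space M. \<delta> \<le> \<bar>R \<omega>\<bar>} \<omega>)"
  proof (rule integral_mono_AE)
    show "AE \<omega> in M. \<bar>cos (X \<omega> + \<phi>) - cos (D \<omega> + \<phi>)\<bar> \<le> \<delta> + 2 * indicator {\<omega>\<in>space M. \<delta> \<le> \<bar>R \<omega>\<bar>} \<omega>"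
      using X AE_space
    proof eventually_elim
      case (elim \<omega>)
      have lip: "\<bar>cos (x + y) - cos x\<bar> \<le> \<bar>y\<bar>" for x y :: real
      proof -
        have "cos (x + y) - cos x = 2 * sin ((x + y + x) / 2) * sin ((x - (x + y)) / 2)"
          by (rule cos_diff_cos)
        then have "\<bar>cos (x + y) - cos x\<bar> = 2 * \<bar>sin ((x + y + x) / 2)\<bar> * \<bar>sin (- y / 2)\<bar>"
          by (simp add: abs_mult)
        also have "\<dots> \<le> 2 * 1 * \<bar>- y / 2\<bar>"
          by (intro mult_mono abs_sin_x_le_abs_x) auto
        finally show ?thesis by simp
      qed
      have eq: "X \<omega> + \<phi> = (D \<omega> + \<phi>) + R \<omega>" using elim by simp
      show ?case
      proof (cases "\<delta> \<le> \<bar>R \<omega>\<bar>")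
        case True
        have "\<bar>cos (X \<omega> + \<phi>) - cos (D \<omega> + \<phi>)\<bar> \<le> \<bar>cos (X \<omega> + \<phi>)\<bar> + \<bar>cos (D \<omega> + \<phi>)\<bar>" by (rule abs_triangle_ineq4)
        also have "\<dots> \<le> 1 + 1" by (intro add_mono abs_cos_le_one)
        finally show ?thesis using True elim \<delta> by simp
      next
        case False
        then show ?thesis using lip[of "D \<omega> + \<phi>" "R \<omega>"] unfolding eq by simp
      qed
    qed
  qed (use i ind in auto)
  also have "\<dots> = \<delta> + 2 * prob {\<omega>\<in>space M. \<delta> \<le> \<bar>R \<omega>\<bar>}"
    using ind by (subst Bochner_Integration.integral_add) (auto simp: prob_space)
  finally show ?thesis .
qed

context multistable begin

lemma cos_increments_limit:
  assumes J: "finite J" "J \<subseteq> local_times {0..} u"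
  shows "((\<lambda>r. expectation (\<lambda>\<omega>. cos ((\<Sum>t\<in>J. w t * (r powr (- (1 / \<alpha> u)) * (Y (u + r * t) \<omega> - Y u \<omega>))) + \<phi>)))
    \<longlongrightarrow> cos \<phi> * exp (- (b u powr \<alpha> u * levy_exponent (\<alpha> u) J w))) (at_right 0)"
proof (rule tendstoI)
  fix e :: real assume e: "0 < e"
  have "\<forall>\<^sub>F r in at_right 0. \<forall>t\<in>J. 0 \<le> u + r * t"
    using J by (intro eventually_ball_finite) (auto simp: local_times_def)
  moreover have "\<forall>\<^sub>F r in at_right 0. prob {\<omega>\<in>space M. e / 2 \<le> \<bar>\<Sum>i. \<gamma> i \<omega> * rem_coeff J w r i \<omega>\<bar>} < e / 4"
    using e by (intro remainder_small[OF J(1)]) auto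
  moreover have "\<forall>\<^sub>F r :: real in at_right 0. 0 < r" by (rule eventually_at_right_less)
  ultimately show "\<forall>\<^sub>F r in at_right 0. dist (expectation (\<lambda>\<omega>. cos ((\<Sum>t\<in>J. w t * (r powr (- (1 / \<alpha> u)) * (Y (u + r * t) \<omega> - Y u \<omega>))) + \<phi>)))
    (cos \<phi> * exp (- (b u powr \<alpha> u * levy_exponent (\<alpha> u) J w))) < e"
  proof eventually_elim
    case (elim r)
    let ?X = "\<lambda>\<omega>. \<Sum>t\<in>J. w t * (r powr (- (1 / \<alpha> u)) * (Y (u + r * t) \<omega> - Y u \<omega>))"
    let ?D = "\<lambda>\<omega>. \<Sum>i. \<gamma> i \<omega> * main_coeff J w r i \<omega>"
    let ?R = "\<lambda>\<omega>. \<Sum>i. \<gamma> i \<omega> * rem_coeff J w r i \<omega>"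
    note [measurable] = Y_measurable marksD[OF main_coeff_measurable] marksD[OF rem_coeff_measurable]
    have "\<bar>expectation (\<lambda>\<omega>. cos (?X \<omega> + \<phi>)) - expectation (\<lambda>\<omega>. cos (?D \<omega> + \<phi>))\<bar> \<le>
      e / 2 + 2 * prob {\<omega>\<in>space M. e / 2 \<le> \<bar>?R \<omega>\<bar>}"
    proof (rule cos_expectation_close)
      show "AE \<omega> in M. ?X \<omega> = ?D \<omega> + ?R \<omega>"
        using increments_split[OF J(1), of w r] by eventually_elim blast
      show "?X \<in> borel_measurable M" "?D \<in> borel_measurable M" "?R \<in> borel_measurable M"
        by measurable
    qed (use e in simp)
    also have "\<dots> < e" using elim(2) by simp
    also have "expectation (\<lambda>\<omega>. cos (?D \<omega> + \<phi>)) = cos \<phi> * exp (- (b u powr \<alpha> u * levy_exponent (\<alpha> u) J w))"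
      using elim by (intro expectation_cos_main J) auto
    finally show ?case by (simp add: dist_real_def)
  qed
qed

text \<open>Any process with the cosine transforms of \<open>b u\<close> times a Levy motion is a local form; both halves of the
theorem are instances.\<close>
lemma local_form_of_cos_law:
  fixes N :: "'b measure" and Z :: "real \<Rightarrow> 'b \<Rightarrow> real"
  assumes N: "prob_space N" and Z: "\<And>t. t \<in> local_times {0..} u \<Longrightarrow> Z t \<in> borel_measurable N"
    and law: "\<And>J w \<phi>. finite J \<Longrightarrow> J \<subseteq> local_times {0..} u \<Longrightarrow>
      (\<integral>\<omega>. cos ((\<Sum>t\<in>J. w t * Z t \<omega>) + \<phi>) \<partial>N) = cos \<phi> * exp (- (b u powr \<alpha> u * levy_exponent (\<alpha> u) J w))"
  shows "is_local_form M Y {0..} (1 / \<alpha> u) u N Z"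
  unfolding is_local_form_def
proof (intro conjI ballI N Z Y_measurable)
  interpret N: prob_space N by fact
  show "prob_space M" by unfold_locales
  have t1: "1 \<in> local_times {0..} u"
  proof -
    have "\<forall>\<^sub>F r :: real in at_right 0. 0 < r" by (rule eventually_at_right_less)
    then show ?thesis unfolding local_times_def using u by (auto elim!: eventually_mono)
  qed
  show "\<exists>t\<in>local_times {0..} u. \<not> (AE \<omega> in N. Z t \<omega> = 0)"
  proof (intro bexI[OF _ t1] notI)
    assume "AE \<omega> in N. Z 1 \<omega> = 0"
    then have "(\<integral>\<omega>. cos ((\<Sum>t\<in>{1}. 1 * Z t \<omega>) + 0) \<partial>N) = (\<integral>\<omega>. 1 \<partial>N)"
      using Z[OF t1] by (intro integral_cong_AE) auto
    also have "(\<integral>\<omega>. cos ((\<Sum>t\<in>{1}. 1 * Z t \<omega>) + 0) \<partial>N) =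
        exp (- (b u powr \<alpha> u * levy_exponent (\<alpha> u) {1} (\<lambda>_. 1)))"
      using law[of "{1}" "\<lambda>_. 1" 0] t1 by simp
    also have "levy_exponent (\<alpha> u) {1} (\<lambda>_. 1) = (\<integral>y. indicator {0..1::real} y \<partial>lborel)"
      unfolding levy_exponent_def signed_interval_def
      by (intro Bochner_Integration.integral_cong) (use \<alpha>1[of u] in \<open>auto simp: indicator_def\<close>)
    finally have "b u powr \<alpha> u = 0" by (simp add: N.prob_space)
    then show False using b_pos[of u] by simp
  qed
  show "fdd_tendsto (local_times {0..} u) M
      (\<lambda>r t \<omega>. r powr - (1 / \<alpha> u) * (Y (u + r * t) \<omega> - Y u \<omega>)) N Z (at_right 0)"
    unfolding fdd_tendsto_def
  proof (intro allI impI, elim conjE)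
    fix J assume J: "finite J" "J \<subseteq> local_times {0..} u"
    show "weak_tendsto_PiM J (\<lambda>r. fdd M (\<lambda>t \<omega>. r powr - (1 / \<alpha> u) * (Y (u + r * t) \<omega> - Y u \<omega>)) J) (fdd N Z J) (at_right 0)"
    proof (rule weak_tendsto_PiM_at_rightI)
      fix r :: "nat \<Rightarrow> real" assume r: "\<And>n. r n > 0" "r \<longlonglongrightarrow> 0"
      have lim: "filterlim r (at_right 0) sequentially"
        using r by (intro tendsto_imp_filterlim_at_right) auto
      show "weak_tendsto_PiM J (\<lambda>n. fdd M (\<lambda>t \<omega>. r n powr - (1 / \<alpha> u) * (Y (u + r n * t) \<omega> - Y u \<omega>)) J) (fdd N Z J) sequentially"
      proof (rule weak_tendsto_PiM_sequentially)
        show "prob_space M" by unfold_locales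
        note [measurable] = Y_measurable
        show "(\<lambda>\<omega>. r n powr - (1 / \<alpha> u) * (Y (u + r n * t) \<omega> - Y u \<omega>)) \<in> borel_measurable M" for n t
          by measurable
        show "Z t \<in> borel_measurable N" if "t \<in> J" for t using that J by (intro Z) auto
        fix w \<phi>
        show "(\<lambda>n. expectation (\<lambda>\<omega>. cos ((\<Sum>t\<in>J. w t * (r n powr - (1 / \<alpha> u) * (Y (u + r n * t) \<omega> - Y u \<omega>))) + \<phi>)))
          \<longlonglongrightarrow> (\<integral>\<omega>. cos ((\<Sum>t\<in>J. w t * Z t \<omega>) + \<phi>) \<partial>N)"
          unfolding law[OF J] by (rule filterlim_compose[OF cos_increments_limit[OF J] lim])
      qed (rule N J(1))+
    qed
  qed
qed

end

lemma indicator_Lp: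
  fixes s t :: real
  assumes a: "0 < a"
  shows "indicator {s..t} \<in> Lp_real a"
proof -
  have "(\<lambda>y. \<bar>indicator {s..t} y :: real\<bar> powr a) = indicator {s..t}"
    using a by (auto simp: indicator_def)
  moreover have "integrable lborel (indicator {s..t} :: real \<Rightarrow> real)"
    by (rule integrable_real_indicator) (auto simp: emeasure_lborel_Icc_eq)
  ultimately show ?thesis by (simp add: Lp_real_def)
qed

text \<open>Linear combinations of the values of the Levy motion are integrals of step functions.\<close>
lemma sas_integral_signed_sum:
  assumes sas: "sas_integral N a J" and a: "0 < a" and F: "finite F"
  shows "AE \<omega> in N. J (\<lambda>y. \<Sum>t\<in>F. w t * signed_interval t y) \<omega> = (\<Sum>t\<in>F. w t * levy_motion J t \<omega>)"
proof -
  have lin: "AE \<omega> in N. J (\<lambda>x. p * f x + q * g x) \<omega> = p * J f \<omega> + q * J g \<omega>"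
    if "f \<in> Lp_real a" "g \<in> Lp_real a" for f g p q
    using sas that unfolding sas_integral_def by blast
  note ind = indicator_Lp[OF a]
  have Lp1: "signed_interval t \<in> Lp_real a" for t
    using signed_interval_sum_Lp[of "{t}" a "\<lambda>_. 1"] a by simp
  have single: "AE \<omega> in N. J (signed_interval t) \<omega> = levy_motion J t \<omega>" for t
  proof (cases "0 \<le> t")
    case True
    then have "signed_interval t = indicator {0..t}" by (auto simp: signed_interval_def fun_eq_iff)
    then show ?thesis using True by (simp add: levy_motion_def)
  next
    case False
    then have "signed_interval t = (\<lambda>x. (-1) * indicator {t..0} x + 0 * indicator {t..0} x)"
      by (auto simp: signed_interval_def fun_eq_iff)
    then show ?thesis using False lin[OF ind ind, of "-1" t 0 0 t 0] by (simp add: levy_motion_def)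
  qed
  show ?thesis using F
  proof induction
    case empty
    show ?case using lin[OF ind ind, of 0 0 0 0 0 0] by simp
  next
    case (insert t F)
    have "AE \<omega> in N. J (\<lambda>y. w t * signed_interval t y + 1 * (\<Sum>t\<in>F. w t * signed_interval t y)) \<omega> =
        w t * J (signed_interval t) \<omega> + 1 * J (\<lambda>y. \<Sum>t\<in>F. w t * signed_interval t y) \<omega>"
      by (intro lin Lp1 signed_interval_sum_Lp insert.hyps a)
    with single[of t] insert.IH show ?case
    proof eventually_elim
      case (elim \<omega>)
      then show ?case using insert.hyps by simp
    qed
  qed
qed

context multistable begin

lemma local_form_levy_motion:
  fixes N :: "'b measure"
  assumes sas: "sas_integral N (\<alpha> u) J"
  shows "is_local_form M Y {0..} (1 / \<alpha> u) u N (\<lambda>t \<omega>. b u * levy_motion J t \<omega>)"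
proof (rule local_form_of_cos_law)
  let ?a = "\<alpha> u"
  have a: "0 < ?a" using \<alpha>1[of u] by simp
  show N: "prob_space N" using sas by (simp add: sas_integral_def)
  interpret N: prob_space N by fact
  have Jm: "J f \<in> borel_measurable N" if "f \<in> Lp_real ?a" for f
    using sas that by (auto simp: sas_integral_def)
  have ch: "char (distr N borel (J f)) 1 = of_real (exp (- (\<integral>x. \<bar>f x\<bar> powr ?a \<partial>lborel)))"
    if "f \<in> Lp_real ?a" for f
    using sas that by (auto simp: sas_integral_def)
  note ind = indicator_Lp[OF a]
  show Lm: "(\<lambda>\<omega>. b u * levy_motion J t \<omega>) \<in> borel_measurable N" for t
    using Jm[OF ind] by (cases "0 \<le> t") (simp_all add: levy_motion_def)
  fix F :: "real set" and w :: "real \<Rightarrow> real" and \<phi> :: real assume F: "finite F"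
  let ?f = "\<lambda>y. \<Sum>t\<in>F. (b u * w t) * signed_interval t y"
  have f: "?f \<in> Lp_real ?a" by (rule signed_interval_sum_Lp[OF F a])
  note [measurable] = Jm[OF f] Lm
  have "(\<integral>x. \<bar>?f x\<bar> powr ?a \<partial>lborel) = b u powr ?a * levy_exponent ?a F w"
  proof -
    have "?f x = b u * (\<Sum>t\<in>F. w t * signed_interval t x)" for x
      by (simp add: sum_distrib_left mult_ac)
    then have "\<bar>?f x\<bar> powr ?a = b u powr ?a * \<bar>\<Sum>t\<in>F. w t * signed_interval t x\<bar> powr ?a" for x
      using b_pos[of u] by (simp add: abs_mult powr_mult)
    then show ?thesis by (simp add: levy_exponent_def)
  qed
  with ch[OF f] N.char_distr_eq_cos[OF Jm[OF f], of 1]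
  have E: "(\<integral>\<omega>. cos (J ?f \<omega>) \<partial>N) = exp (- (b u powr ?a * levy_exponent ?a F w))"
    "(\<integral>\<omega>. sin (J ?f \<omega>) \<partial>N) = 0"
    by (simp_all add: complex_eq_iff cos_diff)
  have i: "integrable N (\<lambda>\<omega>. cos (J ?f \<omega>))" "integrable N (\<lambda>\<omega>. sin (J ?f \<omega>))"
    by (auto intro!: N.integrable_const_bound[where B=1])
  have "(\<integral>\<omega>. cos ((\<Sum>t\<in>F. w t * (b u * levy_motion J t \<omega>)) + \<phi>) \<partial>N) =
    (\<integral>\<omega>. cos \<phi> * cos (J ?f \<omega>) - sin \<phi> * sin (J ?f \<omega>) \<partial>N)"
  proof (rule integral_cong_AE)
    show "AE \<omega> in N. cos ((\<Sum>t\<in>F. w t * (b u * levy_motion J t \<omega>)) + \<phi>) = cos \<phi> * cos (J ?f \<omega>) - sin \<phi> * sin (J ?f \<omega>)"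
      using sas_integral_signed_sum[OF sas a F, of "\<lambda>t. b u * w t"]
      by eventually_elim (simp add: cos_add mult_ac)
  qed measurable
  also have "\<dots> = cos \<phi> * exp (- (b u powr ?a * levy_exponent ?a F w))"
    using i E by (subst Bochner_Integration.integral_diff) auto
  finally show "(\<integral>\<omega>. cos ((\<Sum>t\<in>F. w t * (b u * levy_motion J t \<omega>)) + \<phi>) \<partial>N) =
    cos \<phi> * exp (- (b u powr ?a * levy_exponent ?a F w))" .
qed

text \<open>The kernel of a Levy motion on the whole line, although the marks live on the half line.\<close>
definition line_kernel :: "real \<Rightarrow> real \<Rightarrow> real" where
  "line_kernel t v = block_weight (\<alpha> u) v * (scale u * (indicator {0..} v * signed_interval t (half_to_line v)))"

lemma line_kernel_measurable[measurable]: "line_kernel t \<in> borel_measurable borel"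
  unfolding line_kernel_def[abs_def] by measurable

text \<open>Only finitely many blocks of the half line are moved into \<open>[- \<bar>t\<bar>, \<bar>t\<bar>]\<close>, so the block weights stay bounded.\<close>
lemma line_kernel_bounded: "\<exists>\<kappa>. \<forall>v. \<bar>line_kernel t v\<bar> \<le> \<kappa>"
proof -
  define K where "K = \<lceil>\<bar>t\<bar>\<rceil> + 1"
  define n0 where "n0 = Max (int_encode ` {- K..K})"
  have "\<bar>line_kernel t v\<bar> \<le> 2 powr (real (Suc n0) / \<alpha> u) * \<bar>scale u\<bar>" for v
  proof (cases "line_kernel t v = 0")
    case False
    define n where "n = nat \<lfloor>v\<rfloor>"
    from False have v: "0 \<le> v" "signed_interval t (half_to_line v) \<noteq> 0"
      by (auto simp: line_kernel_def indicator_def split: if_splits)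
    then have h: "\<bar>half_to_line v\<bar> \<le> \<bar>t\<bar>" by (intro signed_interval_support)
    have nv: "real n \<le> v" "v < real n + 1" unfolding n_def using v(1) by linarith+
    then have "\<bar>half_to_line v - real_of_int (int_decode n)\<bar> \<le> 1"
      unfolding half_to_line_def n_def[symmetric] by auto
    with h have "\<bar>real_of_int (int_decode n)\<bar> \<le> real_of_int K"
      unfolding K_def by linarith
    then have "int_decode n \<in> {- K..K}" by auto
    then have "int_encode (int_decode n) \<in> int_encode ` {- K..K}" by (rule imageI)
    then have "n \<le> n0" unfolding n0_def by (intro Max_ge) auto
    then have bw: "block_weight (\<alpha> u) v \<le> 2 powr (real (Suc n0) / \<alpha> u)"
      unfolding block_weight_def n_def[symmetric] using \<alpha>1[of u]
      by (intro powr_mono divide_right_mono) auto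
    have "\<bar>line_kernel t v\<bar> = block_weight (\<alpha> u) v * (\<bar>scale u\<bar> * \<bar>signed_interval t (half_to_line v)\<bar>)"
      using v by (simp add: line_kernel_def abs_mult block_weight_def)
    also have "\<dots> \<le> 2 powr (real (Suc n0) / \<alpha> u) * (\<bar>scale u\<bar> * 1)"
      by (intro mult_mono bw mult_left_mono signed_interval_bound) auto
    finally show ?thesis by simp
  qed simp
  then show ?thesis by blast
qed

definition limit_process :: "real \<Rightarrow> 'a \<Rightarrow> real" where
  "limit_process t \<omega> = (\<Sum>i. \<gamma> i \<omega> * (\<Gamma> i \<omega> powr (- 1 / \<alpha> u) * line_kernel t (V i \<omega>)))"

lemma limit_process_measurable[measurable]: "limit_process t \<in> borel_measurable M"
  unfolding limit_process_def[abs_def] by measurable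

lemma limit_process_law:
  assumes J: "finite J"
  shows "expectation (\<lambda>\<omega>. cos ((\<Sum>t\<in>J. w t * limit_process t \<omega>) + \<phi>)) =
    cos \<phi> * exp (- (b u powr \<alpha> u * levy_exponent (\<alpha> u) J w))"
proof -
  let ?a = "\<alpha> u"
  define k where "k v = (\<Sum>t\<in>J. w t * line_kernel t v)" for v
  have km[measurable]: "k \<in> borel_measurable borel" unfolding k_def[abs_def] by measurable
  from line_kernel_bounded have "\<forall>t. \<exists>\<kappa>. \<forall>v. \<bar>line_kernel t v\<bar> \<le> \<kappa>" by blast
  from choice[OF this] obtain \<kappa> where \<kappa>: "\<And>t v. \<bar>line_kernel t v\<bar> \<le> \<kappa> t" by blast
  have kb: "\<bar>k v\<bar> \<le> (\<Sum>t\<in>J. \<bar>w t\<bar> * \<kappa> t)" for v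
  proof -
    have "\<bar>k v\<bar> \<le> (\<Sum>t\<in>J. \<bar>w t * line_kernel t v\<bar>)" unfolding k_def by (rule sum_abs)
    also have "\<dots> \<le> (\<Sum>t\<in>J. \<bar>w t\<bar> * \<kappa> t)"
      unfolding abs_mult by (intro sum_mono mult_left_mono \<kappa>) auto
    finally show ?thesis .
  qed
  have "AE \<omega> in M. \<forall>t\<in>J. summable (\<lambda>i. \<gamma> i \<omega> * (\<Gamma> i \<omega> powr (- 1 / ?a) * line_kernel t (V i \<omega>)))"
  proof (intro AE_ball_countable')
    show "countable J" using J by (rule countable_finite)
    show "AE \<omega> in M. summable (\<lambda>i. \<gamma> i \<omega> * (\<Gamma> i \<omega> powr (- 1 / ?a) * line_kernel t (V i \<omega>)))" for t
      using \<alpha>1[of u] by (intro AE_summable_stable_series[OF _ _ line_kernel_measurable \<kappa>]) auto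
  qed
  then have ae: "AE \<omega> in M. (\<Sum>t\<in>J. w t * limit_process t \<omega>) = (\<Sum>i. \<gamma> i \<omega> * (\<Gamma> i \<omega> powr (- 1 / ?a) * k (V i \<omega>)))"
  proof eventually_elim
    case (elim \<omega>)
    have "(\<lambda>i. \<Sum>t\<in>J. w t * (\<gamma> i \<omega> * (\<Gamma> i \<omega> powr (- 1 / ?a) * line_kernel t (V i \<omega>)))) sums
      (\<Sum>t\<in>J. w t * limit_process t \<omega>)"
      unfolding limit_process_def using elim by (intro sums_sum sums_mult summable_sums) auto
    then have "(\<lambda>i. \<gamma> i \<omega> * (\<Gamma> i \<omega> powr (- 1 / ?a) * k (V i \<omega>))) sums (\<Sum>t\<in>J. w t * limit_process t \<omega>)"
      by (simp add: k_def sum_distrib_left mult_ac)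
    then show ?case by (rule sums_unique)
  qed
  have "expectation (\<lambda>\<omega>. cos ((\<Sum>t\<in>J. w t * limit_process t \<omega>) + \<phi>)) =
    expectation (\<lambda>\<omega>. cos ((\<Sum>i. \<gamma> i \<omega> * (\<Gamma> i \<omega> powr (- 1 / ?a) * k (V i \<omega>))) + \<phi>))"
  proof (rule integral_cong_AE)
    show "AE \<omega> in M. cos ((\<Sum>t\<in>J. w t * limit_process t \<omega>) + \<phi>) =
      cos ((\<Sum>i. \<gamma> i \<omega> * (\<Gamma> i \<omega> powr (- 1 / ?a) * k (V i \<omega>))) + \<phi>)"
      using ae by eventually_elim simp
  qed measurable
  also have "\<dots> = cos \<phi> * exp (- (stable_integral ?a * (\<integral>v. \<bar>k v\<bar> powr ?a \<partial>density lborel dyadic_block_density)))"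
    by (rule expectation_cos_stable_series[OF \<alpha>1 km kb])
  also have "(\<integral>v. \<bar>k v\<bar> powr ?a \<partial>density lborel dyadic_block_density) = scale u powr ?a * levy_exponent ?a J w"
  proof -
    let ?s = "\<lambda>y. \<Sum>t\<in>J. w t * signed_interval t y"
    have "k v = block_weight ?a v * (scale u * (indicator {0..} v * ?s (half_to_line v)))" for v
      unfolding k_def line_kernel_def by (simp add: sum_distrib_left mult_ac)
    then have "(\<integral>v. \<bar>k v\<bar> powr ?a \<partial>density lborel dyadic_block_density) =
      (\<integral>v. indicator {0..} v * \<bar>scale u * (indicator {0..} v * ?s (half_to_line v))\<bar> powr ?a \<partial>lborel)"
      using \<alpha>1[of u] by (simp only:) (intro integral_block_weight, auto)
    also have "\<dots> = (\<integral>v. scale u powr ?a * (indicator {0..} v * \<bar>?s (half_to_line v)\<bar> powr ?a) \<partial>lborel)"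
      using scale_pos[of u]
      by (intro Bochner_Integration.integral_cong refl) (simp add: abs_mult powr_mult indicator_def)
    also have "\<dots> = scale u powr ?a * (\<integral>v. indicator {0..} v * \<bar>?s (half_to_line v)\<bar> powr ?a \<partial>lborel)"
      by (rule integral_mult_right_zero)
    also have "(\<integral>v. indicator {0..} v * \<bar>?s (half_to_line v)\<bar> powr ?a \<partial>lborel) = levy_exponent ?a J w"
      unfolding levy_exponent_def by (rule integral_half_to_line) auto
    finally show ?thesis .
  qed
  also have "stable_integral ?a * (scale u powr ?a * levy_exponent ?a J w) = b u powr ?a * levy_exponent ?a J w"
    unfolding scale_powr[symmetric] by simp
  finally show ?thesis .
qed

text \<open>The law of the limit process on the path space, with the coordinates as the process, is the witness.\<close>
lemma localisable_Y: "localisable M Y {0..} (1 / \<alpha> u) u"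
  unfolding localisable_def
proof (intro exI)
  let ?P = "\<Pi>\<^sub>M t\<in>(UNIV :: real set). (borel :: real measure)"
  have m[measurable]: "(\<lambda>\<omega> t. limit_process t \<omega>) \<in> measurable M ?P"
    by (rule measurable_PiM_single') auto
  show "is_local_form M Y {0..} (1 / \<alpha> u) u (distr M ?P (\<lambda>\<omega> t. limit_process t \<omega>)) (\<lambda>t f. f t)"
  proof (rule local_form_of_cos_law)
    show "prob_space (distr M ?P (\<lambda>\<omega> t. limit_process t \<omega>))" by (rule prob_space_distr) (rule m)
    show "(\<lambda>f. f t) \<in> borel_measurable (distr M ?P (\<lambda>\<omega> t. limit_process t \<omega>))" for t
      by simp
    fix J :: "real set" and w :: "real \<Rightarrow> real" and \<phi> :: real assume "finite J"
    then show "(\<integral>f. cos ((\<Sum>t\<in>J. w t * f t) + \<phi>) \<partial>distr M ?P (\<lambda>\<omega> t. limit_process t \<omega>)) =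
      cos \<phi> * exp (- (b u powr \<alpha> u * levy_exponent (\<alpha> u) J w))"
      by (subst integral_distr) (auto simp: limit_process_law)
  qed
qed

end

theorem theorem7:
  fixes M :: "'a measure"
    and \<alpha> b :: "real \<Rightarrow> real" and c d :: real
    and \<Gamma> V \<gamma> :: "nat \<Rightarrow> 'a \<Rightarrow> real"
  assumes "prob_space M"
    and "1 < c" and "d < 2" and "\<And>t. \<alpha> t \<in> {c..d}" and "\<And>t. 0 < b t"
    and "\<alpha> C1_differentiable_on UNIV" and "b C1_differentiable_on UNIV"
    and "prob_space.poisson_arrival_times M \<Gamma>"
    and "prob_space.iid_dyadic_blocks M V"
    and "prob_space.iid_signs M \<gamma>"
    and "prob_space.indep_sequences3 M \<Gamma> V \<gamma>"
  defines "Y \<equiv> multistable_levy \<alpha> b \<Gamma> V \<gamma>"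
  shows "\<forall>u\<in>{0..}.
    localisable M Y {0..} (1 / \<alpha> u) u \<and>
    (\<forall>(N :: 'b measure) J. sas_integral N (\<alpha> u) J \<longrightarrow>
      is_local_form M Y {0..} (1 / \<alpha> u) u N (\<lambda>t \<omega>. b u * levy_motion J t \<omega>))"
proof
  fix u :: real assume u: "u \<in> {0..}"
  have diff: "\<exists>D. (f has_real_derivative D) (at u)" if "f C1_differentiable_on UNIV" for f :: "real \<Rightarrow> real"
    using that unfolding C1_differentiable_on_def has_real_derivative_iff_has_vector_derivative by blast
  have "multistable M \<Gamma> V \<gamma> \<alpha> b c d u"
    using assms(1-5) assms(8-11) u diff[OF assms(6)] diff[OF assms(7)]
    by (simp add: multistable_def multistable_axioms_def lepage_def lepage_axioms_def)
  then interpret multistable M \<Gamma> V \<gamma> \<alpha> b c d u .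
  show "localisable M Y {0..} (1 / \<alpha> u) u \<and>
    (\<forall>(N :: 'b measure) J. sas_integral N (\<alpha> u) J \<longrightarrow>
      is_local_form M Y {0..} (1 / \<alpha> u) u N (\<lambda>t \<omega>. b u * levy_motion J t \<omega>))"
    unfolding Y_def using localisable_Y local_form_levy_motion by blast
qed

end
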